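(* Let $m\ge3$ and let $X_n$ be the space requirement (number of nodes) of a uniformly random $m$-ary search tree on $n$ keys, i.e. the additive functional with toll $b_n=1$ for $n\ge m-1$ and initial values $(x_0,x_1,\dots,x_{m-2})=(0,1,\dots,1)$. Let $$d_1:=\frac{m(1-\rho\,m^{1/(m-1)})}{(m-1)\alpha^*},\quad \delta_1:=d_1^2+\sum_{j=1}^{m-2}\big[1-(j+1)d_1\big]^2\rho^j,\quad B_2:=\frac{a_0}{-a_1(m-1)}\Big[\delta_1-\frac{a_0}{m(m-1)}\Big],$$ and $\sigma^2:=2B_2/(-a_1)$. Then $\dfrac{X_n-d_1(n+1)}{\sqrt n}\to N(0,\sigma^2)$ in law and $\dfrac{X_n-\mathbb EX_n}{\sqrt{\operatorname{Var}X_n}}\to N(0,1)$ in law.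
   Context: Fix an integer $m\ge2$. Let $\tau_n$ be the number of $m$-ary search trees on $n$ keys: $\tau_0=\dots=\tau_{m-2}=1$ and $\tau_n=\sum\tau_{j_1}\cdots\tau_{j_m}$ for $n\ge m-1$, summed over $(j_1,\dots,j_m)\ge0$ with $j_1+\dots+j_m=n-(m-1)$. Let $\rho$ be the unique number in $(0,1)$ with $m^m(\sum_{j=1}^{m-1}\rho^j)^{m-1}=(m-1)^{m-1}$. Define $\alpha^*:=m-(m^{m/(m-1)}-1)(\rho^{-1}-1)^{-1}$, $a_0:=m^{-1/(m-1)}\rho^{-1}$, $a_1:=-\sqrt{2m\alpha^*}\,m^{-m/(m-1)}\rho^{-1}$. Additive functional: given a real toll $(b_n)_{n\ge m-1}$ and real initial values $x_0,\dots,x_{m-2}$, $X_j=x_j$ (deterministic) for $0\le j\le m-2$ and, for $n\ge m-1$, $X_n\overset{d}{=}\sum_{k=1}^mX^{(k)}_{J_k}+b_n$, where $X^{(k)}_j\overset{d}{=}X_j$, $\mathbf J$ and the families $(X^{(k)}_j)_j$ are independent, and $\Pr[\mathbf J=(j_1,\dots,j_m)]=\tau_{j_1}\cdots\tau_{j_m}/\tau_n$ for $(j_1,\dots,j_m)\ge0$ with sum $n-(m-1)$ (i.e. $X_n$ is the functional $f$ with $f(T)=\sum_if(L_i(T))+b_{|T|}$ evaluated on a uniformly random $m$-ary search tree on $n$ keys). *)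

theory Defs
  imports "HOL-Probability.Probability"
begin

definition comps :: "nat \<Rightarrow> nat \<Rightarrow> nat list set" where
  "comps m s = {js. length js = m \<and> sum_list js = s}"

text \<open>The list [tau_0, ..., tau_n] of numbers of m-ary search trees.\<close>
fun taus :: "nat \<Rightarrow> nat \<Rightarrow> nat list" where
  "taus m 0 = [1]"
| "taus m (Suc n) = taus m n @
     [if Suc n \<le> m - 2 then 1
      else (\<Sum>js\<in>comps m (Suc n - (m - 1)). \<Prod>j\<leftarrow>js. taus m n ! j)]"

definition tau :: "nat \<Rightarrow> nat \<Rightarrow> nat" where
  "tau m n = taus m n ! n"

text \<open>Law of the split vector J for a tree on n keys (n >= m-1).\<close>
definition Jpmf :: "nat \<Rightarrow> nat \<Rightarrow> nat list pmf" where
  "Jpmf m n = embed_pmf (\<lambda>js. if js \<in> comps m (n - (m - 1))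
       then (\<Prod>j\<leftarrow>js. real (tau m j)) / real (tau m n) else 0)"

fun sum_law :: "real pmf list \<Rightarrow> nat list \<Rightarrow> real pmf" where
  "sum_law L [] = return_pmf 0"
| "sum_law L (j # js) =
     bind_pmf (L ! j) (\<lambda>x. bind_pmf (sum_law L js) (\<lambda>y. return_pmf (x + y)))"

fun addf_laws :: "nat \<Rightarrow> (nat \<Rightarrow> real) \<Rightarrow> (nat \<Rightarrow> real) \<Rightarrow> nat \<Rightarrow> real pmf list" where
  "addf_laws m b x 0 = [return_pmf (x 0)]"
| "addf_laws m b x (Suc n) = addf_laws m b x n @
     [if Suc n \<le> m - 2 then return_pmf (x (Suc n))
      else bind_pmf (Jpmf m (Suc n))
             (\<lambda>js. bind_pmf (sum_law (addf_laws m b x n) js)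
                     (\<lambda>s. return_pmf (s + b (Suc n))))]"

definition addf_law :: "nat \<Rightarrow> (nat \<Rightarrow> real) \<Rightarrow> (nat \<Rightarrow> real) \<Rightarrow> nat \<Rightarrow> real pmf" where
  "addf_law m b x n = addf_laws m b x n ! n"

definition rho :: "nat \<Rightarrow> real" where
  "rho m = (THE r. 0 < r \<and> r < 1 \<and>
      real m ^ m * (\<Sum>j=1..m-1. r ^ j) ^ (m - 1) = real (m - 1) ^ (m - 1))"

definition alpha_star :: "nat \<Rightarrow> real" where
  "alpha_star m = real m - (real m powr (real m / real (m - 1)) - 1) / (1 / rho m - 1)"

definition a0 :: "nat \<Rightarrow> real" where
  "a0 m = real m powr (- 1 / real (m - 1)) / rho m"

definition a1 :: "nat \<Rightarrow> real" where
  "a1 m = - sqrt (2 * real m * alpha_star m) * real m powr (- real m / real (m - 1)) / rho m"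

definition d1 :: "nat \<Rightarrow> real" where
  "d1 m = real m * (1 - rho m * real m powr (1 / real (m - 1))) / (real (m - 1) * alpha_star m)"

definition delta1 :: "nat \<Rightarrow> real" where
  "delta1 m = d1 m ^ 2 + (\<Sum>j=1..m-2. (1 - real (j + 1) * d1 m) ^ 2 * rho m ^ j)"

definition B2 :: "nat \<Rightarrow> real" where
  "B2 m = a0 m / (- a1 m * real (m - 1)) * (delta1 m - a0 m / (real m * real (m - 1)))"

definition sigma2 :: "nat \<Rightarrow> real" where
  "sigma2 m = 2 * B2 m / (- a1 m)"

definition space_law :: "nat \<Rightarrow> nat \<Rightarrow> real pmf" where
  "space_law m n = addf_law m (\<lambda>_. 1) (\<lambda>j. if j = 0 then 0 else 1) n"

end

theory Submission
  imports Defs "HOL-Complex_Analysis.Complex_Analysis" "HOL-Real_Asymp.Real_Asymp"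
begin

text \<open>
  Put $d = m - 1$. The generating function $F(z,u) = \sum_n \tau_n E[u^{X_n}] z^n$ satisfies
  $F = P + u z^d F^m$ with $P = 1 + u(z + \dots + z^{d-1})$, hence
  $\tau_n E[u^{X_n}] = \sum_k A_k u^k [z^{n+1}] (zP)^{dk+1}$ with Fuss--Catalan numbers $A_k$.
  After normalising at $z = \rho$ the right-hand side is, up to the slowly varying factor
  $A_k ((d^d)/(m^m))^k$, the probability that a renewal process with steps in $\{1,\dots,d\}$
  visits $n+1$ at a time congruent to 1 modulo $d$. Taking $u = e^t$ with $t$ of order
  $n^{-1/2}$ and rescaling $z$ by $\exp(- d_1 t - \sigma^2 t^2/2)$ keeps the step weights
  summing to $1 + o(1/n)$, so a renewal theorem uniform in the step law, combined with
  exponential tail bounds on the number of steps, gives convergence of the moment generating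
  function of $(X_n - d_1(n+1))/\sqrt n$ on the whole real line. By Montel's theorem this extends
  to locally uniform convergence on the complex plane, which yields both the characteristic
  functions and the first two moments.
\<close>

section \<open>A uniform renewal theorem\<close>

text \<open>The obstacle is that the step law itself moves: the tilt at \<open>n\<close> has size
  n^(-1/2), so time \<open>n\<close> is examined under a law belonging to that \<open>n\<close>, and
  a renewal theorem for one fixed law says nothing. What helps is that the rate of convergence
  depends only on the maximal step and on a lower bound for the weights of two consecutive steps,
  and both are stable along the moving laws. The residue class comes from counting leaves: dk + 1
  steps are one step and k blocks of d steps, so the class is handled by renewing with the d-fold
  convolution. The slowly varying weight is only compared between indices of the same order, so a
  bound on its logarithmic increments is enough, and its value at the typical number of internal
  nodes cancels against the case t = 0. An error o(1/n) in the total mass is the right order because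
  the mass is raised to a power of at most n + 1. Convergence in law alone would not give the second
  claim, whose centring and scaling use the true mean and variance; hence the transforms are
  controlled in a complex neighbourhood and not only on the imaginary axis.\<close>

lemma avg_upper:
  fixes V Q :: "nat \<Rightarrow> real"
  assumes rec: "\<And>n. n \<ge> L \<Longrightarrow> V n = (\<Sum>i=1..L. Q i * V (n - i))"
    and nonneg: "\<And>i. Q i \<ge> 0" and sum1: "(\<Sum>i=1..L. Q i) = 1" and L: "L \<ge> 1"
    and win: "\<And>i. i \<in> {n..<n+L} \<Longrightarrow> V i \<le> M" and i: "i \<ge> n"
  shows "V i \<le> M"
  using i
proof (induction i rule: less_induct)
  case (less i)
  show ?case
  proof (cases "i < n + L")
    case True
    then show ?thesis using less win by simp
  next
    case False
    have "V i = (\<Sum>j=1..L. Q j * V (i - j))" using False by (intro rec) auto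
    also have "\<dots> \<le> (\<Sum>j=1..L. Q j * M)"
      using False by (intro sum_mono mult_left_mono nonneg less.IH) auto
    also have "\<dots> = M" using sum1 by (simp only: sum_distrib_right[symmetric] mult_1)
    finally show ?thesis .
  qed
qed

text \<open>In the average defining \<open>V (j + a)\<close> the value \<open>V j\<close> carries
  weight at least \<open>\<epsilon>\<close>, so a deficit \<open>\<beta>\<close> survives a jump by
  \<open>a\<close> up to the factor \<open>\<epsilon>\<close>. The margin
  \<open>j \<ge> n + L\<close> keeps all \<open>L\<close> averaged values in the range where the
  bound \<open>M\<close> is known.\<close>

lemma avg_deficit_step:
  fixes V Q :: "nat \<Rightarrow> real"
  assumes rec: "\<And>n. n \<ge> L \<Longrightarrow> V n = (\<Sum>i=1..L. Q i * V (n - i))"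
    and nonneg: "\<And>i. Q i \<ge> 0" and sum1: "(\<Sum>i=1..L. Q i) = 1"
    and ub: "\<And>i. i \<ge> n \<Longrightarrow> V i \<le> M" and j: "V j \<le> M - \<beta>" "j \<ge> n + L" and "\<beta> \<ge> 0"
    and a: "1 \<le> a" "a \<le> L" "Q a \<ge> \<epsilon>"
  shows "V (j + a) \<le> M - \<epsilon> * \<beta>"
proof -
  have "V (j + a) = (\<Sum>i=1..L. Q i * V (j + a - i))" using j by (intro rec) auto
  also have "\<dots> \<le> (\<Sum>i=1..L. Q i * (M - (if i = a then \<beta> else 0)))"
    using j by (intro sum_mono mult_left_mono nonneg) (auto intro: ub)
  also have "\<dots> = (\<Sum>i=1..L. Q i * M) - (\<Sum>i=1..L. if i = a then Q i * \<beta> else 0)"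
    by (subst sum_subtractf[symmetric]) (intro sum.cong, auto simp: algebra_simps)
  also have "(\<Sum>i=1..L. Q i * M) = M" using sum1 by (simp only: sum_distrib_right[symmetric] mult_1)
  also have "(\<Sum>i=1..L. if i = a then Q i * \<beta> else 0) = Q a * \<beta>" using a by simp
  finally have "V (j + a) \<le> M - Q a * \<beta>" .
  moreover have "\<epsilon> * \<beta> \<le> Q a * \<beta>" using a \<open>\<beta> \<ge> 0\<close> by (intro mult_right_mono)
  ultimately show ?thesis by linarith
qed

text \<open>Chains the one-step estimate along jumps \<open>a\<close> and \<open>a + 1\<close>. With
  \<open>q\<close> and \<open>r\<close> the quotient and remainder of \<open>s\<close> by
  \<open>a\<close>, one has \<open>s = (q - r) * a + r * (a + 1)\<close>; so \<open>q\<close> jumps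
  suffice, and the factor \<open>\<epsilon> ^ q\<close> they leave is at least
  \<open>\<epsilon> ^ s\<close>.\<close>

lemma avg_deficit:
  fixes V Q :: "nat \<Rightarrow> real"
  assumes rec: "\<And>n. n \<ge> L \<Longrightarrow> V n = (\<Sum>i=1..L. Q i * V (n - i))"
    and nonneg: "\<And>i. Q i \<ge> 0" and sum1: "(\<Sum>i=1..L. Q i) = 1"
    and ub: "\<And>i. i \<ge> n \<Longrightarrow> V i \<le> M" and j: "V j \<le> M - \<beta>" "j \<ge> n + L" and \<beta>: "\<beta> \<ge> 0"
    and a: "1 \<le> a" "a + 1 \<le> L" "Q a \<ge> \<epsilon>" "Q (a + 1) \<ge> \<epsilon>" and \<epsilon>: "\<epsilon> > 0"
    and s: "s \<ge> a * a"
  shows "V (j + s) \<le> M - \<epsilon> ^ s * \<beta>"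
proof -
  have rep: "V (j + (x * a + y * (a + 1))) \<le> M - \<epsilon> ^ (x + y) * \<beta>" for x y
  proof (induction y)
    case 0
    show ?case
    proof (induction x)
      case (Suc x)
      have "V ((j + x * a) + a) \<le> M - \<epsilon> * (\<epsilon> ^ x * \<beta>)"
        using Suc j \<beta> a \<epsilon> by (intro avg_deficit_step[where a = a, OF rec nonneg sum1 ub]) auto
      then show ?case by (simp add: algebra_simps)
    qed (use j in simp)
  next
    case (Suc y)
    have "V ((j + (x * a + y * (a + 1))) + (a + 1)) \<le> M - \<epsilon> * (\<epsilon> ^ (x + y) * \<beta>)"
      using Suc j \<beta> a \<epsilon> by (intro avg_deficit_step[where a = "a + 1", OF rec nonneg sum1 ub]) auto
    then show ?case by (simp add: algebra_simps)
  qed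
  define q r where "q = s div a" and "r = s mod a"
  have r: "r < a" "s = q * a + r" using a by (auto simp: q_def r_def)
  \<comment> \<open>Makes \<open>q - r\<close> a genuine difference, as
    \<open>r < a \<le> q\<close>; this is the reason for the bound \<open>a * a\<close>.\<close>
  have "q \<ge> a" unfolding q_def using s a by (simp add: less_eq_div_iff_mult_less_eq)
  then have s': "s = (q - r) * a + r * (a + 1)" and qr: "q - r + r = q"
    using r by (auto simp: algebra_simps diff_mult_distrib)
  have "Q a \<le> 1"
    using member_le_sum[of a "{1..L}" Q] a nonneg sum1 by auto
  then have "\<epsilon> ^ s \<le> \<epsilon> ^ q"
    using a \<epsilon> r by (intro power_decreasing) (auto simp: q_def)
  then have "\<epsilon> ^ s * \<beta> \<le> \<epsilon> ^ q * \<beta>" using \<beta> by (rule mult_right_mono)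
  with rep[of "q - r" r] show ?thesis unfolding s'[symmetric] qr by linarith
qed

text \<open>At a single index the value lies in one half of the current range; since every
  $s \ge a^2$ is a combination of the steps $a$ and $a+1$, this pushes a whole later window
  away from the opposite end by a fixed proportion.\<close>
lemma avg_contract:
  fixes V Q :: "nat \<Rightarrow> real"
  assumes rec: "\<And>n. n \<ge> L \<Longrightarrow> V n = (\<Sum>i=1..L. Q i * V (n - i))"
    and nonneg: "\<And>i. Q i \<ge> 0" and sum1: "(\<Sum>i=1..L. Q i) = 1"
    and bd: "\<And>i. i \<ge> n \<Longrightarrow> l \<le> V i \<and> V i \<le> M"
    and a: "1 \<le> a" "a + 1 \<le> L" "Q a \<ge> \<epsilon>" "Q (a + 1) \<ge> \<epsilon>" and \<epsilon>: "\<epsilon> > 0"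
  shows "\<exists>l' M'. M' - l' = (1 - \<epsilon> ^ (a * a + L) / 2) * (M - l) \<and>
           (\<forall>i \<ge> n + (L + a * a). l' \<le> V i \<and> V i \<le> M')"
proof -
  define \<beta> where "\<beta> = (M - l) / 2"
  have \<beta>: "\<beta> \<ge> 0" using bd[of n] by (simp add: \<beta>_def)
  have "Q a \<le> 1"
    using member_le_sum[of a "{1..L}" Q] a nonneg sum1 by auto
  then have \<epsilon>1: "\<epsilon> \<le> 1" using a by simp
  have L: "L \<ge> 1" using a by simp
  \<comment> \<open>Offsets in the target window stay below \<open>a * a + L\<close>; as
    \<open>\<epsilon> \<le> 1\<close>, that exponent gives one deficit for the whole window.\<close>
  have pw: "\<epsilon> ^ (a * a + L) * \<beta> \<le> \<epsilon> ^ s * \<beta>" if "s \<le> a * a + L" for s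
    using \<epsilon> \<epsilon>1 \<beta> that by (intro mult_right_mono power_decreasing) auto
  consider "V (n + L) \<le> M - \<beta>" | "- V (n + L) \<le> - l - \<beta>"
    unfolding \<beta>_def by argo
  then show ?thesis
  proof cases
    case 1
    have win: "V i \<le> M - \<epsilon> ^ (a * a + L) * \<beta>" if "i \<in> {n + L + a * a..<n + L + a * a + L}" for i
    proof -
      have "V (n + L + (i - (n + L))) \<le> M - \<epsilon> ^ (i - (n + L)) * \<beta>"
        using 1 \<beta> a \<epsilon> that bd by (intro avg_deficit[OF rec nonneg sum1]) auto
      moreover have "n + L + (i - (n + L)) = i" "i - (n + L) \<le> a * a + L" using that by auto
      ultimately show ?thesis using pw[of "i - (n + L)"] by simp
    qed
    have "V i \<le> M - \<epsilon> ^ (a * a + L) * \<beta>" if "i \<ge> n + L + a * a" for i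
      by (rule avg_upper[OF rec nonneg sum1 L win that])
    then show ?thesis using bd
      by (intro exI[of _ l] exI[of _ "M - \<epsilon> ^ (a * a + L) * \<beta>"])
         (auto simp: \<beta>_def algebra_simps)
  next
    case 2
    \<comment> \<open>The recursion is linear, so a value in the upper half is treated as a value in
      the lower half of the negated sequence.\<close>
    have rec': "- V n = (\<Sum>i=1..L. Q i * - V (n - i))" if "n \<ge> L" for n
      using rec[OF that] by (simp add: sum_negf)
    have win: "- V i \<le> - l - \<epsilon> ^ (a * a + L) * \<beta>" if "i \<in> {n + L + a * a..<n + L + a * a + L}" for i
    proof -
      have "- V (n + L + (i - (n + L))) \<le> - l - \<epsilon> ^ (i - (n + L)) * \<beta>"
        using 2 \<beta> a \<epsilon> that bd by (intro avg_deficit[OF rec' nonneg sum1]) auto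
      moreover have "n + L + (i - (n + L)) = i" "i - (n + L) \<le> a * a + L" using that by auto
      ultimately show ?thesis using pw[of "i - (n + L)"] by simp
    qed
    have "- V i \<le> - l - \<epsilon> ^ (a * a + L) * \<beta>" if "i \<ge> n + L + a * a" for i
      by (rule avg_upper[OF rec' nonneg sum1 L win that])
    then have "l + \<epsilon> ^ (a * a + L) * \<beta> \<le> V i" if "i \<ge> n + L + a * a" for i
      using that by force
    then show ?thesis using bd
      by (intro exI[of _ "l + \<epsilon> ^ (a * a + L) * \<beta>"] exI[of _ M])
         (auto simp: \<beta>_def algebra_simps)
  qed
qed

text \<open>Both the factor \<open>1 - \<epsilon> ^ (a * a + L) / 2\<close> and the waiting time
  \<open>L + a * a\<close> are free of \<open>Q\<close>; the uniformity over step laws originates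
  here.\<close>

lemma avg_iterate:
  fixes V Q :: "nat \<Rightarrow> real"
  assumes rec: "\<And>n. n \<ge> L \<Longrightarrow> V n = (\<Sum>i=1..L. Q i * V (n - i))"
    and nonneg: "\<And>i. Q i \<ge> 0" and sum1: "(\<Sum>i=1..L. Q i) = 1"
    and bd: "\<And>i. 0 \<le> V i \<and> V i \<le> 1"
    and a: "1 \<le> a" "a + 1 \<le> L" "Q a \<ge> \<epsilon>" "Q (a + 1) \<ge> \<epsilon>" and \<epsilon>: "\<epsilon> > 0"
  shows "\<exists>l M. M - l = (1 - \<epsilon> ^ (a * a + L) / 2) ^ j \<and>
           (\<forall>i \<ge> j * (L + a * a). l \<le> V i \<and> V i \<le> M)"
proof (induction j)
  case 0
  then show ?case using bd by (intro exI[of _ 0] exI[of _ 1]) auto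
next
  case (Suc j)
  then obtain l M where lM: "M - l = (1 - \<epsilon> ^ (a * a + L) / 2) ^ j"
    "\<And>i. i \<ge> j * (L + a * a) \<Longrightarrow> l \<le> V i \<and> V i \<le> M" by blast
  obtain l' M' where "M' - l' = (1 - \<epsilon> ^ (a * a + L) / 2) * (M - l)"
     "\<forall>i \<ge> j * (L + a * a) + (L + a * a). l' \<le> V i \<and> V i \<le> M'"
    using avg_contract[OF rec nonneg sum1 lM(2) a \<epsilon>] by blast
  then show ?case by (intro exI[of _ l'] exI[of _ M']) (auto simp: lM add.commute)
qed

section \<open>Renewal sequences of bounded step laws\<close>

text \<open>A step law on {1..L} is encoded by its generating function: powers are then laws of sums
  of independent steps, and the coefficients of \<open>inverse (1 - Q)\<close> are the probabilities
  that the renewal process visits a given integer.\<close>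

definition prob_fps :: "nat \<Rightarrow> real fps \<Rightarrow> bool" where
  "prob_fps L Q \<longleftrightarrow> (\<forall>i. fps_nth Q i \<ge> 0) \<and> fps_nth Q 0 = 0 \<and> (\<forall>i>L. fps_nth Q i = 0)
     \<and> (\<Sum>i=1..L. fps_nth Q i) = 1"

definition fps_mean :: "nat \<Rightarrow> real fps \<Rightarrow> real" where
  "fps_mean L Q = (\<Sum>i=1..L. real i * fps_nth Q i)"

lemma renewal_rec:
  assumes "prob_fps L Q"
  defines "V \<equiv> fps_nth (inverse (1 - Q))"
  shows "V n = (if n = 0 then 1 else (\<Sum>i=1..n. fps_nth Q i * V (n - i)))"
proof -
  have Q0: "fps_nth Q 0 = 0" using assms by (simp add: prob_fps_def)
  have "inverse (1 - Q) * (1 - Q) = 1" by (rule inverse_mult_eq_1) (simp add: Q0)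
  then have "inverse (1 - Q) = 1 + Q * inverse (1 - Q)" by (simp add: algebra_simps)
  then have "V n = fps_nth (1 + Q * inverse (1 - Q)) n"
    unfolding V_def by (rule arg_cong)
  also have "\<dots> = (if n = 0 then 1 else 0) + (\<Sum>i=0..n. fps_nth Q i * V (n - i))"
    unfolding V_def fps_add_nth fps_mult_nth by simp
  also have "(\<Sum>i=0..n. fps_nth Q i * V (n - i)) = (\<Sum>i=1..n. fps_nth Q i * V (n - i))"
    using Q0 by (subst sum.atLeast_Suc_atMost) auto
  finally show ?thesis by auto
qed

lemma renewal_bounds:
  assumes "prob_fps L Q"
  shows "0 \<le> fps_nth (inverse (1 - Q)) n \<and> fps_nth (inverse (1 - Q)) n \<le> 1"
proof (induction n rule: less_induct)
  case (less n)
  have nn: "fps_nth Q i \<ge> 0" and z: "i > L \<Longrightarrow> fps_nth Q i = 0" for i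
    using assms by (auto simp: prob_fps_def)
  show ?case
  proof (cases "n = 0")
    case False
    have le: "(\<Sum>i=1..n. fps_nth Q i) \<le> 1"
    proof -
      have "(\<Sum>i=1..n. fps_nth Q i) \<le> (\<Sum>i=1..max n L. fps_nth Q i)"
        by (rule sum_mono2) (auto simp: nn)
      also have "\<dots> = (\<Sum>i=1..L. fps_nth Q i)"
        by (rule sum.mono_neutral_right) (auto simp: z)
      finally show ?thesis using assms by (simp add: prob_fps_def)
    qed
    have "(\<Sum>i=1..n. fps_nth Q i * fps_nth (inverse (1 - Q)) (n - i)) \<le> (\<Sum>i=1..n. fps_nth Q i * 1)"
      using False less nn by (intro sum_mono mult_left_mono) auto
    moreover have "(\<Sum>i=1..n. fps_nth Q i * fps_nth (inverse (1 - Q)) (n - i)) \<ge> 0"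
      using False less nn by (intro sum_nonneg mult_nonneg_nonneg) auto
    ultimately show ?thesis using False le renewal_rec[OF assms, of n] by simp
  qed (simp add: renewal_rec[OF assms, of 0] del: fps_inverse_nth_0)
qed

lemma renewal_rec':
  assumes Q: "prob_fps L Q" and L: "L \<ge> 1" and n: "n \<ge> L"
  shows "fps_nth (inverse (1 - Q)) n = (\<Sum>i=1..L. fps_nth Q i * fps_nth (inverse (1 - Q)) (n - i))"
proof -
  have "(\<Sum>i=1..n. fps_nth Q i * fps_nth (inverse (1 - Q)) (n - i))
      = (\<Sum>i=1..L. fps_nth Q i * fps_nth (inverse (1 - Q)) (n - i))"
    using Q n by (intro sum.mono_neutral_right) (auto simp: prob_fps_def)
  then show ?thesis using renewal_rec[OF Q, of n] L n by auto
qed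

text \<open>The mean as a sum of tail probabilities. It identifies the total weight in the renewal
  identity below with \<open>fps_mean\<close>.\<close>

lemma sum_tails:
  fixes q :: "nat \<Rightarrow> real"
  shows "(\<Sum>i<L. \<Sum>j\<in>{i<..L}. q j) = (\<Sum>j=1..L. real j * q j)"
proof -
  have "(\<Sum>i<L. \<Sum>j\<in>{i<..L}. q j) = (\<Sum>i<L. \<Sum>j\<in>{1..L}. if i < j then q j else 0)"
    by (intro sum.cong refl sum.mono_neutral_cong_left) auto
  also have "\<dots> = (\<Sum>j\<in>{1..L}. \<Sum>i<L. if i < j then q j else 0)" by (rule sum.swap)
  also have "\<dots> = (\<Sum>j\<in>{1..L}. \<Sum>i<j. q j)"
    by (intro sum.cong refl sum.mono_neutral_cong_right) auto
  finally show ?thesis by simp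
qed

text \<open>Exactly one visit \<open>n - i\<close> is the last one up to time \<open>n\<close>, and
  it is followed by a step longer than \<open>i\<close>. Algebraically, the tail series
  \<open>D\<close> satisfies \<open>D * (1 - fps_X) = 1 - Q\<close>, so
  \<open>inverse (1 - Q) * D\<close> is the all-ones series. This conserved quantity is what
  determines the limit.\<close>

lemma renewal_invariant:
  assumes Q: "prob_fps L Q" and n: "n \<ge> L"
  shows "(\<Sum>i<L. fps_nth (inverse (1 - Q)) (n - i) * (\<Sum>j\<in>{i<..L}. fps_nth Q j)) = 1"
proof -
  define D :: "real fps" where "D = Abs_fps (\<lambda>i. \<Sum>j\<in>{i<..L}. fps_nth Q j)"
  define U :: "real fps" where "U = Abs_fps (\<lambda>_. 1)"
  have Q0: "fps_nth Q 0 = 0" and Qs: "(\<Sum>i=1..L. fps_nth Q i) = 1"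
    and Qz: "\<And>i. i > L \<Longrightarrow> fps_nth Q i = 0" using Q by (auto simp: prob_fps_def)
  have UX: "U * (1 - fps_X) = 1"
    by (rule fps_ext) (simp add: U_def algebra_simps fps_X_mult_nth)
  have DX: "D * (1 - fps_X) = 1 - Q"
  proof (rule fps_ext)
    fix n
    show "fps_nth (D * (1 - fps_X)) n = fps_nth (1 - Q) n"
    proof (cases n)
      case 0
      have "{0<..L} = {1..L}" by auto
      then show ?thesis using 0 Qs Q0 by (simp add: D_def algebra_simps fps_X_mult_nth)
    next
      case (Suc k)
      show ?thesis
      proof (cases "k < L")
        case True
        then have "{k<..L} = insert (Suc k) {Suc k<..L}" by auto
        then show ?thesis by (simp add: Suc D_def algebra_simps fps_X_mult_nth)
      next
        case False
        then show ?thesis using Qz[of n] by (simp add: Suc D_def algebra_simps fps_X_mult_nth)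
      qed
    qed
  qed
  have inv: "inverse (1 - Q) * (1 - Q) = 1" by (rule inverse_mult_eq_1) (simp add: Q0)
  have "inverse (1 - Q) * D = inverse (1 - Q) * (D * (1 - fps_X)) * U"
    by (simp only: mult.assoc UX mult.commute[of "1 - fps_X" U]) simp
  then have "inverse (1 - Q) * D = U" by (simp add: DX inv)
  then have "fps_nth (D * inverse (1 - Q)) n = 1" by (simp add: U_def mult.commute)
  then have "(\<Sum>i=0..n. fps_nth D i * fps_nth (inverse (1 - Q)) (n - i)) = 1"
    by (simp add: fps_mult_nth)
  also have "(\<Sum>i=0..n. fps_nth D i * fps_nth (inverse (1 - Q)) (n - i)) =
     (\<Sum>i<L. fps_nth D i * fps_nth (inverse (1 - Q)) (n - i))"
    using n by (intro sum.mono_neutral_right) (auto simp: D_def)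
  finally show ?thesis by (simp add: D_def mult.commute)
qed

lemma fps_mean_ge_1:
  assumes "prob_fps L Q" shows "fps_mean L Q \<ge> 1"
proof -
  have "(\<Sum>i=1..L. fps_nth Q i) \<le> fps_mean L Q"
    unfolding fps_mean_def
  proof (rule sum_mono)
    fix i assume "i \<in> {1..L}"
    then have "1 * fps_nth Q i \<le> real i * fps_nth Q i"
      using assms by (intro mult_right_mono) (auto simp: prob_fps_def)
    then show "fps_nth Q i \<le> real i * fps_nth Q i" by simp
  qed
  then show ?thesis using assms by (simp add: prob_fps_def)
qed

text \<open>From some index on, all visit probabilities lie in an interval of length
  \<open>\<theta> ^ j\<close>. The conserved sum is a combination of the last \<open>L\<close> of
  them with nonnegative weights of total \<open>fps_mean L Q\<close>, so
  \<open>1 / fps_mean L Q\<close> lies in the same interval. The threshold depends on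
  \<open>L\<close>, \<open>a\<close>, \<open>\<epsilon>\<close> and \<open>\<eta>\<close>
  only.\<close>

lemma renewal_uniform:
  assumes a: "1 \<le> a" "a + 1 \<le> L" and \<epsilon>: "0 < \<epsilon>" and \<eta>: "0 < (\<eta>::real)"
  shows "\<exists>n0. \<forall>n\<ge>n0. \<forall>Q. prob_fps L Q \<longrightarrow> fps_nth Q a \<ge> \<epsilon> \<longrightarrow> fps_nth Q (a + 1) \<ge> \<epsilon> \<longrightarrow>
      \<bar>fps_nth (inverse (1 - Q)) n - 1 / fps_mean L Q\<bar> \<le> \<eta>"
proof (cases "\<epsilon> \<le> 1")
  case False
  have "\<not> (prob_fps L Q \<and> fps_nth Q a \<ge> \<epsilon>)" for Q
    using member_le_sum[of a "{1..L}" "fps_nth Q"] a False by (auto simp: prob_fps_def)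
  then show ?thesis by blast
next
  case True
  define \<theta> where "\<theta> = 1 - \<epsilon> ^ (a * a + L) / 2"
  have "0 < \<epsilon> ^ (a * a + L)" "\<epsilon> ^ (a * a + L) \<le> 1" using \<epsilon> True by (auto simp: power_le_one)
  then have \<theta>: "0 \<le> \<theta>" "\<theta> < 1" unfolding \<theta>_def by linarith+
  then obtain j where j: "\<theta> ^ j < \<eta>" using real_arch_pow_inv[OF \<eta>] by blast
  show ?thesis
  proof (intro exI allI impI)
    fix n Q
    assume n: "n \<ge> j * (L + a * a) + L" and Q: "prob_fps L Q"
      and qa: "fps_nth Q a \<ge> \<epsilon>" "fps_nth Q (a + 1) \<ge> \<epsilon>"
    let ?V = "fps_nth (inverse (1 - Q))" and ?\<mu> = "fps_mean L Q"
    have L: "L \<ge> 1" using a by simp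
    obtain l M where M: "M - l = \<theta> ^ j" and lM: "\<And>i. i \<ge> j * (L + a * a) \<Longrightarrow> l \<le> ?V i \<and> ?V i \<le> M"
      using avg_iterate[where V = ?V and Q = "fps_nth Q" and L = L and j = j, OF renewal_rec'[OF Q L] _ _ renewal_bounds[OF Q] a qa \<epsilon>]
        Q unfolding \<theta>_def prob_fps_def by auto
    have \<mu>: "?\<mu> = (\<Sum>i<L. \<Sum>j\<in>{i<..L}. fps_nth Q j)"
      by (simp add: sum_tails fps_mean_def)
    have \<mu>1: "?\<mu> \<ge> 1" by (rule fps_mean_ge_1[OF Q])
    have nn: "(\<Sum>j\<in>{i<..L}. fps_nth Q j) \<ge> 0" for i
      using Q by (auto simp: prob_fps_def intro: sum_nonneg)
    have inv: "(\<Sum>i<L. ?V (n - i) * (\<Sum>j\<in>{i<..L}. fps_nth Q j)) = 1"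
      using n by (intro renewal_invariant[OF Q]) auto
    have "(\<Sum>i<L. ?V (n - i) * (\<Sum>j\<in>{i<..L}. fps_nth Q j)) \<le> (\<Sum>i<L. M * (\<Sum>j\<in>{i<..L}. fps_nth Q j))"
      using n lM nn by (intro sum_mono mult_right_mono) auto
    then have 1: "1 \<le> M * ?\<mu>" unfolding inv \<mu> by (simp add: sum_distrib_left)
    have "(\<Sum>i<L. ?V (n - i) * (\<Sum>j\<in>{i<..L}. fps_nth Q j)) \<ge> (\<Sum>i<L. l * (\<Sum>j\<in>{i<..L}. fps_nth Q j))"
      using n lM nn by (intro sum_mono mult_right_mono) auto
    then have 2: "l * ?\<mu> \<le> 1" unfolding inv \<mu> by (simp add: sum_distrib_left)
    have "1 / ?\<mu> \<le> M" "l \<le> 1 / ?\<mu>" using 1 2 \<mu>1 by (auto simp: field_simps)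
    moreover have "l \<le> ?V n \<and> ?V n \<le> M" using n by (intro lM) auto
    ultimately show "\<bar>?V n - 1 / ?\<mu>\<bar> \<le> \<eta>" using M j by linarith
  qed
qed

section \<open>Convolution powers and visits in a residue class\<close>

text \<open>The expectation of \<open>h\<close> at a sum of two independent steps. The choice
  \<open>h = 1\<close> yields the total mass of a convolution, the identity yields additivity of the
  mean.\<close>

lemma fps_mult_sum:
  fixes A B :: "real fps" and h :: "nat \<Rightarrow> real"
  assumes A: "\<And>i. i > L1 \<Longrightarrow> fps_nth A i = 0" and B: "\<And>i. i > L2 \<Longrightarrow> fps_nth B i = 0"
  shows "(\<Sum>n\<le>L1 + L2. h n * fps_nth (A * B) n)
       = (\<Sum>i\<le>L1. \<Sum>j\<le>L2. h (i + j) * (fps_nth A i * fps_nth B j))"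
proof -
  have "(\<Sum>n\<le>L1 + L2. h n * fps_nth (A * B) n)
      = (\<Sum>n\<le>L1 + L2. \<Sum>i\<le>n. h (i + (n - i)) * (fps_nth A i * fps_nth B (n - i)))"
    by (simp add: fps_mult_nth sum_distrib_left atLeast0AtMost)
  also have "\<dots> = (\<Sum>(i, j)\<in>{(i, j). i + j \<le> L1 + L2}. h (i + j) * (fps_nth A i * fps_nth B j))"
    by (rule sum.triangle_reindex_eq[symmetric])
  also have "\<dots> = (\<Sum>(i, j)\<in>{..L1} \<times> {..L2}. h (i + j) * (fps_nth A i * fps_nth B j))"
  proof (rule sum.mono_neutral_right)
    show "finite {(i, j). i + j \<le> L1 + L2}"
      by (rule finite_subset[of _ "{..L1 + L2} \<times> {..L1 + L2}"]) auto
    show "\<forall>x\<in>{(i, j). i + j \<le> L1 + L2} - {..L1} \<times> {..L2}.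
       (case x of (i, j) \<Rightarrow> h (i + j) * (fps_nth A i * fps_nth B j)) = 0"
    proof
      fix x assume "x \<in> {(i, j). i + j \<le> L1 + L2} - {..L1} \<times> {..L2}"
      then have "fst x > L1 \<or> snd x > L2" by (cases x) auto
      then show "(case x of (i, j) \<Rightarrow> h (i + j) * (fps_nth A i * fps_nth B j)) = 0"
        using A B by (cases x) auto
    qed
  qed auto
  finally show ?thesis by (simp add: sum.cartesian_product)
qed

lemma prob_fps_sum0: "prob_fps L Q \<Longrightarrow> (\<Sum>i\<le>L. fps_nth Q i) = 1"
  unfolding prob_fps_def atMost_atLeast0 by (subst sum.atLeast_Suc_atMost) auto

lemma fps_mean_sum0: "fps_mean L Q = (\<Sum>i\<le>L. real i * fps_nth Q i)"
  unfolding fps_mean_def atMost_atLeast0 by (subst sum.atLeast_Suc_atMost) auto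

lemma prob_fps_mult:
  assumes A: "prob_fps L1 A" and B: "prob_fps L2 B"
  shows "prob_fps (L1 + L2) (A * B)" "fps_mean (L1 + L2) (A * B) = fps_mean L1 A + fps_mean L2 B"
proof -
  have nn: "fps_nth A i \<ge> 0" "fps_nth B i \<ge> 0" and A0: "fps_nth A 0 = 0"
    and z: "i > L1 \<Longrightarrow> fps_nth A i = 0" "i > L2 \<Longrightarrow> fps_nth B i = 0" for i
    using A B by (auto simp: prob_fps_def)
  have "(\<Sum>n\<le>L1 + L2. 1 * fps_nth (A * B) n) = (\<Sum>i\<le>L1. \<Sum>j\<le>L2. 1 * (fps_nth A i * fps_nth B j))"
    by (rule fps_mult_sum) (use z in auto)
  also have "\<dots> = 1" by (simp add: sum_distrib_left[symmetric] prob_fps_sum0[OF A] prob_fps_sum0[OF B])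
  finally have "(\<Sum>n\<le>L1 + L2. fps_nth (A * B) n) = 1" by simp
  then have s: "(\<Sum>n=1..L1 + L2. fps_nth (A * B) n) = 1"
    unfolding atMost_atLeast0 by (subst (asm) sum.atLeast_Suc_atMost) (auto simp: A0)
  have "fps_nth A i * fps_nth B (n - i) = 0" if "n > L1 + L2" for i n
    using z[of i] z[of "n - i"] that by (cases "i > L1") auto
  then have "fps_nth (A * B) n = 0" if "n > L1 + L2" for n
    unfolding fps_mult_nth using that by (intro sum.neutral) blast
  with s show "prob_fps (L1 + L2) (A * B)"
    unfolding prob_fps_def by (auto simp: fps_mult_nth A0 simp del: sum.cl_ivl_Suc intro!: sum_nonneg mult_nonneg_nonneg nn)
  have "fps_mean (L1 + L2) (A * B) = (\<Sum>i\<le>L1. \<Sum>j\<le>L2. real (i + j) * (fps_nth A i * fps_nth B j))"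
    unfolding fps_mean_sum0 by (rule fps_mult_sum) (use z in auto)
  also have "\<dots> = (\<Sum>i\<le>L1. \<Sum>j\<le>L2. (real i * fps_nth A i) * fps_nth B j) +
     (\<Sum>i\<le>L1. \<Sum>j\<le>L2. fps_nth A i * (real j * fps_nth B j))"
    by (simp add: sum.distrib[symmetric] algebra_simps)
  also have "\<dots> = fps_mean L1 A + fps_mean L2 B"
    unfolding sum_product[symmetric] prob_fps_sum0[OF A] prob_fps_sum0[OF B] fps_mean_sum0 by simp
  finally show "fps_mean (L1 + L2) (A * B) = fps_mean L1 A + fps_mean L2 B" .
qed

lemma prob_fps_power:
  assumes "prob_fps L A" "N \<ge> 1"
  shows "prob_fps (N * L) (A ^ N) \<and> fps_mean (N * L) (A ^ N) = real N * fps_mean L A"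
  using assms(2)
proof (induction N rule: dec_induct)
  case (step N)
  have "Suc N * L = L + N * L" by simp
  then show ?case using step prob_fps_mult[OF assms(1), of "N * L" "A ^ N"]
    by (auto simp: algebra_simps)
qed (use assms in simp)

lemma fps_mult_nth_ge:
  fixes A B :: "real fps"
  assumes "\<And>i. fps_nth A i \<ge> 0" "\<And>i. fps_nth B i \<ge> 0"
  shows "fps_nth A i * fps_nth B j \<le> fps_nth (A * B) (i + j)"
proof -
  have "fps_nth A i * fps_nth B (i + j - i) \<le> (\<Sum>k=0..i + j. fps_nth A k * fps_nth B (i + j - k))"
    using assms by (intro member_le_sum) auto
  then show ?thesis by (simp add: fps_mult_nth)
qed

lemma fps_power_nonneg:
  fixes A :: "real fps"
  assumes "\<And>i. fps_nth A i \<ge> 0"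
  shows "fps_nth (A ^ N) i \<ge> 0"
  by (induction N arbitrary: i) (auto simp: fps_mult_nth intro!: sum_nonneg mult_nonneg_nonneg assms)

text \<open>Keeps only the path whose steps all equal 1, respectively one that has a single step 2.
  Hence the \<open>d\<close>-fold convolution charges the consecutive integers \<open>d\<close> and
  \<open>d + 1\<close>, as the uniform renewal theorem requires.\<close>

lemma fps_power_nth_ge:
  fixes A :: "real fps"
  assumes nn: "\<And>i. fps_nth A i \<ge> 0"
  shows "fps_nth A 1 ^ N \<le> fps_nth (A ^ N) N"
    and "fps_nth A 2 * fps_nth A 1 ^ N \<le> fps_nth (A ^ Suc N) (N + 2)"
proof -
  show 1: "fps_nth A 1 ^ N \<le> fps_nth (A ^ N) N"
  proof (induction N)
    case (Suc N)
    have "fps_nth A 1 * fps_nth A 1 ^ N \<le> fps_nth A 1 * fps_nth (A ^ N) N"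
      using Suc nn by (intro mult_left_mono) auto
    also have "\<dots> \<le> fps_nth (A * A ^ N) (1 + N)"
      by (rule fps_mult_nth_ge) (auto intro: nn fps_power_nonneg)
    finally show ?case by simp
  qed simp
  have "fps_nth A 2 * fps_nth A 1 ^ N \<le> fps_nth A 2 * fps_nth (A ^ N) N"
    using 1 nn by (intro mult_left_mono) auto
  also have "\<dots> \<le> fps_nth (A * A ^ N) (2 + N)"
    by (rule fps_mult_nth_ge) (auto intro: nn fps_power_nonneg)
  finally show "fps_nth A 2 * fps_nth A 1 ^ N \<le> fps_nth (A ^ Suc N) (N + 2)"
    by (simp add: add.commute)
qed

text \<open>A geometric series in \<open>q ^ d\<close>. Cutting it at \<open>k = n\<close> is exact
  at this coefficient, because the remainder contains \<open>q ^ (d * Suc n + 1)\<close>, whose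
  terms all have degree above \<open>n + 1\<close>.\<close>

lemma sum_powers_renewal:
  fixes q :: "real fps"
  assumes q0: "fps_nth q 0 = 0" and d: "d \<ge> 1"
  shows "(\<Sum>k\<le>n. fps_nth (q ^ (d * k + 1)) (n + 1)) = fps_nth (q * inverse (1 - q ^ d)) (n + 1)"
proof -
  define V where "V = inverse (1 - q ^ d)"
  have V: "V * (1 - q ^ d) = 1" unfolding V_def
    by (rule inverse_mult_eq_1) (use q0 d in \<open>simp add: fps_nth_power_0 power_0_left\<close>)
  have "(1 - q ^ d) * (\<Sum>k\<le>n. (q ^ d) ^ k) = 1 - (q ^ d) ^ Suc n"
    by (rule sum_gp_basic)
  then have "V * (1 - q ^ d) * (\<Sum>k\<le>n. (q ^ d) ^ k) = V * (1 - (q ^ d) ^ Suc n)"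
    by (simp only: mult.assoc)
  also have "\<dots> = V - V * (q ^ d) ^ Suc n" by (simp only: right_diff_distrib mult_1_right)
  finally have "(\<Sum>k\<le>n. (q ^ d) ^ k) = V - V * (q ^ d) ^ Suc n" by (simp only: V mult_1)
  then have "q * V = q * ((\<Sum>k\<le>n. (q ^ d) ^ k) + V * (q ^ d) ^ Suc n)"
    by (simp del: power_Suc)
  also have "\<dots> = q * (\<Sum>k\<le>n. (q ^ d) ^ k) + q * (V * (q ^ d) ^ Suc n)"
    by (rule distrib_left)
  also have "\<dots> = (\<Sum>k\<le>n. q ^ (d * k + 1)) + q ^ (d * Suc n + 1) * V"
    by (simp add: sum_distrib_left power_mult[symmetric] algebra_simps power_add)
  finally have "q * V = (\<Sum>k\<le>n. q ^ (d * k + 1)) + q ^ (d * Suc n + 1) * V" .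
  moreover have "fps_nth (q ^ (d * Suc n + 1) * V) (n + 1) = 0"
  proof -
    have "fps_nth (q ^ (d * Suc n + 1)) i = 0" if "i \<le> n + 1" for i
    proof -
      have "Suc n \<le> d * Suc n" using mult_le_mono1[of 1 d "Suc n"] d by (simp only: mult_1)
      then have "i \<le> d * Suc n" using that unfolding Suc_eq_plus1[symmetric] by (rule order_trans[rotated])
      then have "i < d * Suc n + 1" by (simp del: mult_Suc_right)
      then show ?thesis using startsby_zero_power_prefix[OF q0] by blast
    qed
    then show ?thesis by (simp add: fps_mult_nth del: power_Suc mult_Suc_right)
  qed
  ultimately show ?thesis by (simp add: V_def fps_sum_nth)
qed

text \<open>The uniform theorem is applied to \<open>Q = q n ^ d\<close>, which has steps up to
  \<open>d * d\<close> and mean \<open>d\<close> times that of \<open>q n\<close>. The one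
  additional step averages at most \<open>d\<close> neighbouring visit probabilities, all close to
  the same limit. Since the threshold is common to all laws, \<open>q n\<close> may change with
  \<open>n\<close>.\<close>

lemma renewal_class_limit:
  fixes q :: "nat \<Rightarrow> real fps"
  assumes d: "d \<ge> 2" and q: "\<forall>\<^sub>F n in sequentially. prob_fps d (q n)"
    and lim: "\<And>j. (\<lambda>n. fps_nth (q n) j) \<longlonglongrightarrow> fps_nth p j"
    and p: "prob_fps d p" "fps_nth p 1 > 0" "fps_nth p 2 > 0"
  shows "(\<lambda>n. \<Sum>k\<le>n. fps_nth (q n ^ (d * k + 1)) (n + 1)) \<longlonglongrightarrow> 1 / (real d * fps_mean d p)"
proof -
  define \<epsilon>0 where "\<epsilon>0 = min (fps_nth p 1) (fps_nth p 2) / 2"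
  have \<epsilon>0: "\<epsilon>0 > 0" using p by (simp add: \<epsilon>0_def)
  have ev: "\<forall>\<^sub>F n in sequentially. fps_nth (q n) 1 \<ge> \<epsilon>0" "\<forall>\<^sub>F n in sequentially. fps_nth (q n) 2 \<ge> \<epsilon>0"
  proof -
    have "\<epsilon>0 < fps_nth p 1" "\<epsilon>0 < fps_nth p 2" using p by (auto simp: \<epsilon>0_def min_def)
    from order_tendstoD(1)[OF lim this(1)] order_tendstoD(1)[OF lim this(2)]
    show "\<forall>\<^sub>F n in sequentially. fps_nth (q n) 1 \<ge> \<epsilon>0" "\<forall>\<^sub>F n in sequentially. fps_nth (q n) 2 \<ge> \<epsilon>0"
      by (auto elim: eventually_mono)
  qed
  have mean: "(\<lambda>n. fps_mean d (q n)) \<longlonglongrightarrow> fps_mean d p"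
    unfolding fps_mean_def by (intro tendsto_intros lim)
  have \<mu>: "fps_mean d p \<ge> 1" by (rule fps_mean_ge_1[OF p(1)])
  have lim1: "(\<lambda>n. 1 / (real d * fps_mean d (q n))) \<longlonglongrightarrow> 1 / (real d * fps_mean d p)"
    using d \<mu> by (intro tendsto_intros mean) auto
  have "(\<lambda>n. (\<Sum>k\<le>n. fps_nth (q n ^ (d * k + 1)) (n + 1)) - 1 / (real d * fps_mean d (q n))) \<longlonglongrightarrow> 0"
  proof (rule LIMSEQ_I)
    fix e :: real assume e: "e > 0"
    \<comment> \<open>Both consecutive steps \<open>d\<close> and \<open>d + 1\<close> must lie
      within the range of the \<open>d\<close>-fold convolution.\<close>
    have dd: "d + 1 \<le> d * d"
    proof -
      have "2 * d \<le> d * d" using d by (intro mult_right_mono) auto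
      then show ?thesis using d by linarith
    qed
    have "\<exists>n0. \<forall>n\<ge>n0. \<forall>Q. prob_fps (d * d) Q \<longrightarrow> fps_nth Q d \<ge> \<epsilon>0 ^ d \<longrightarrow> fps_nth Q (d + 1) \<ge> \<epsilon>0 ^ d \<longrightarrow>
      \<bar>fps_nth (inverse (1 - Q)) n - 1 / fps_mean (d * d) Q\<bar> \<le> e / 2"
      using d dd \<epsilon>0 e by (intro renewal_uniform) auto
    then obtain n0 where n0: "\<And>n Q. n \<ge> n0 \<Longrightarrow> prob_fps (d * d) Q \<Longrightarrow> fps_nth Q d \<ge> \<epsilon>0 ^ d \<Longrightarrow>
       fps_nth Q (d + 1) \<ge> \<epsilon>0 ^ d \<Longrightarrow> \<bar>fps_nth (inverse (1 - Q)) n - 1 / fps_mean (d * d) Q\<bar> \<le> e / 2"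
      by blast
    have "\<forall>\<^sub>F n in sequentially. \<bar>(\<Sum>k\<le>n. fps_nth (q n ^ (d * k + 1)) (n + 1)) - 1 / (real d * fps_mean d (q n))\<bar> < e"
      using ev q eventually_ge_at_top[of "n0 + d"]
    proof eventually_elim
      case (elim n)
      let ?q = "q n"
      define Q where "Q = ?q ^ d"
      define v where "v = 1 / (real d * fps_mean d ?q)"
      have nn: "fps_nth ?q i \<ge> 0" and q0: "fps_nth ?q 0 = 0" and qz: "i > d \<Longrightarrow> fps_nth ?q i = 0"
        and q1: "(\<Sum>i=1..d. fps_nth ?q i) = 1" for i
        using elim by (auto simp: prob_fps_def)
      have Q: "prob_fps (d * d) Q" "fps_mean (d * d) Q = real d * fps_mean d ?q"
        using prob_fps_power[OF elim(3), of d] d by (auto simp: Q_def)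
      have Qd: "fps_nth Q d \<ge> \<epsilon>0 ^ d"
        using fps_power_nth_ge(1)[OF nn, of d] power_mono[OF elim(1), of d] \<epsilon>0 by (simp add: Q_def)
      have Qd1: "fps_nth Q (d + 1) \<ge> \<epsilon>0 ^ d"
      proof -
        obtain k where k: "d = Suc k" using d by (cases d) auto
        have "\<epsilon>0 * \<epsilon>0 ^ k \<le> fps_nth ?q 2 * fps_nth ?q 1 ^ k"
          using elim \<epsilon>0 by (intro mult_mono power_mono) auto
        then show ?thesis using fps_power_nth_ge(2)[OF nn, of k] by (simp add: Q_def k)
      qed
      have close: "\<bar>fps_nth (inverse (1 - Q)) (n + 1 - i) - v\<bar> \<le> e / 2" if "i \<le> d" for i
        unfolding v_def Q(2)[symmetric] using elim that by (intro n0 Q Qd Qd1) auto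
      have "(\<Sum>k\<le>n. fps_nth (?q ^ (d * k + 1)) (n + 1)) = fps_nth (?q * inverse (1 - Q)) (n + 1)"
        unfolding Q_def by (rule sum_powers_renewal) (use q0 d in auto)
      also have "\<dots> = (\<Sum>i=0..n + 1. fps_nth ?q i * fps_nth (inverse (1 - Q)) (n + 1 - i))"
        by (rule fps_mult_nth)
      also have "\<dots> = (\<Sum>i=1..d. fps_nth ?q i * fps_nth (inverse (1 - Q)) (n + 1 - i))"
      proof (rule sum.mono_neutral_right)
        show "\<forall>i\<in>{0..n + 1} - {1..d}. fps_nth ?q i * fps_nth (inverse (1 - Q)) (n + 1 - i) = 0"
        proof
          fix i assume "i \<in> {0..n + 1} - {1..d}"
          then have "i = 0 \<or> i > d" by auto
          then show "fps_nth ?q i * fps_nth (inverse (1 - Q)) (n + 1 - i) = 0" using q0 qz by auto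
        qed
      qed (use elim in auto)
      finally have "(\<Sum>k\<le>n. fps_nth (?q ^ (d * k + 1)) (n + 1)) - v =
         (\<Sum>i=1..d. fps_nth ?q i * fps_nth (inverse (1 - Q)) (n + 1 - i)) - (\<Sum>i=1..d. fps_nth ?q i) * v"
        by (simp only: q1 mult_1)
      also have "\<dots> = (\<Sum>i=1..d. fps_nth ?q i * (fps_nth (inverse (1 - Q)) (n + 1 - i) - v))"
        by (simp only: sum_distrib_right sum_subtractf[symmetric] right_diff_distrib)
      also have "\<bar>\<dots>\<bar> \<le> (\<Sum>i=1..d. fps_nth ?q i * (e / 2))"
      proof (intro order_trans[OF sum_abs] sum_mono)
        fix i assume "i \<in> {1..d}"
        then have "fps_nth ?q i * \<bar>fps_nth (inverse (1 - Q)) (n + 1 - i) - v\<bar> \<le> fps_nth ?q i * (e / 2)"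
          by (intro mult_left_mono close nn) auto
        then show "\<bar>fps_nth ?q i * (fps_nth (inverse (1 - Q)) (n + 1 - i) - v)\<bar> \<le> fps_nth ?q i * (e / 2)"
          by (simp only: abs_mult abs_of_nonneg[OF nn])
      qed
      also have "\<dots> = e / 2" by (simp only: sum_distrib_right[symmetric] q1 mult_1)
      finally show ?case using e by (simp add: v_def)
    qed
    then show "\<exists>no. \<forall>n\<ge>no. norm ((\<Sum>k\<le>n. fps_nth (q n ^ (d * k + 1)) (n + 1)) - 1 / (real d * fps_mean d (q n)) - 0) < e"
      by (simp add: eventually_sequentially)
  qed
  from tendsto_add[OF this lim1] show ?thesis by simp
qed

section \<open>Exponential tail bounds for the number of steps\<close>

text \<open>Exponential Markov inequality: with nonnegative coefficients, one term of the power is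
  at most its value at \<open>s\<close>.\<close>

lemma fps_power_nth_le:
  fixes f :: "real fps"
  assumes nn: "\<And>i. fps_nth f i \<ge> 0" and z: "\<And>i. i > d \<Longrightarrow> fps_nth f i = 0" and s: "s \<ge> 0"
  shows "fps_nth (f ^ N) n * s ^ n \<le> (\<Sum>i\<le>d. fps_nth f i * s ^ i) ^ N"
proof (induction N arbitrary: n)
  case 0
  then show ?case by simp
next
  case (Suc N)
  let ?S = "\<Sum>i\<le>d. fps_nth f i * s ^ i"
  have S: "?S \<ge> 0" using nn s by (intro sum_nonneg) auto
  have "fps_nth (f ^ Suc N) n * s ^ n = (\<Sum>i=0..n. fps_nth f i * fps_nth (f ^ N) (n - i) * s ^ n)"
    by (simp add: fps_mult_nth sum_distrib_right)
  also have "\<dots> = (\<Sum>i=0..n. fps_nth f i * s ^ i * (fps_nth (f ^ N) (n - i) * s ^ (n - i)))"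
    by (intro sum.cong refl) (simp add: power_add[symmetric])
  also have "\<dots> \<le> (\<Sum>i=0..n. fps_nth f i * s ^ i * ?S ^ N)"
    using nn s by (intro sum_mono mult_left_mono Suc.IH) auto
  also have "\<dots> = (\<Sum>i=0..n. fps_nth f i * s ^ i) * ?S ^ N" by (simp add: sum_distrib_right)
  also have "(\<Sum>i=0..n. fps_nth f i * s ^ i) \<le> ?S"
  proof -
    have "(\<Sum>i=0..n. fps_nth f i * s ^ i) \<le> (\<Sum>i\<le>max n d. fps_nth f i * s ^ i)"
      using nn s by (intro sum_mono2) auto
    also have "\<dots> = ?S" using z by (intro sum.mono_neutral_right) auto
    finally show ?thesis .
  qed
  then have "(\<Sum>i=0..n. fps_nth f i * s ^ i) * ?S ^ N \<le> ?S * ?S ^ N"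
    using S by (intro mult_right_mono) auto
  finally show ?case by simp
qed

text \<open>For negative \<open>x\<close> both sides are multiplied by \<open>1 - x\<close>: the
  left one becomes at most 1, the right one becomes \<open>1 - x ^ 3\<close>, which is at least
  1.\<close>

lemma exp_le_quadratic:
  fixes x :: real
  assumes "\<bar>x\<bar> \<le> 1"
  shows "exp x \<le> 1 + x + x\<^sup>2"
proof (cases "x \<ge> 0")
  case False
  have "exp x * (1 - x) \<le> exp x * exp (- x)"
    using exp_ge_add_one_self[of "- x"] by (intro mult_left_mono) auto
  then have 1: "exp x * (1 - x) \<le> 1" by (simp add: exp_minus)
  have "x ^ 3 \<le> 0" using False by (simp add: power3_eq_cube mult_nonneg_nonpos mult_nonpos_nonpos)
  then have "1 \<le> (1 + x + x\<^sup>2) * (1 - x)" by (simp add: algebra_simps power2_eq_square power3_eq_cube)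
  with 1 have "exp x * (1 - x) \<le> (1 + x + x\<^sup>2) * (1 - x)" by linarith
  then show ?thesis using False by (simp add: mult_le_cancel_right)
qed (use assms exp_bound in auto)

text \<open>A Chernoff bound: \<open>N\<close> steps rarely add up to \<open>n\<close> if
  \<open>N\<close> times the mean is far from \<open>n\<close>. Since \<open>N \<le> n\<close>, the
  decay is exponential in \<open>n\<close> whatever \<open>N\<close> is.\<close>

lemma prob_fps_tail:
  assumes q: "prob_fps d q" and d: "d \<ge> 1" and \<delta>: "0 < \<delta>" "\<delta> \<le> 1" and N: "N \<le> n"
    and dev: "\<bar>real N * fps_mean d q - real n\<bar> \<ge> \<delta> * real n"
  shows "fps_nth (q ^ N) n \<le> exp (- (real n * \<delta>\<^sup>2 / (4 * (real d)\<^sup>2)))"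
proof -
  let ?\<mu> = "fps_mean d q"
  \<comment> \<open>Minimises \<open>- (c * \<delta>) + c * c * d * d\<close>, the exponent per unit
    of \<open>n\<close>.\<close>
  define c where "c = \<delta> / (2 * (real d)\<^sup>2)"
  have c: "c \<ge> 0" using \<delta> by (simp add: c_def)
  \<comment> \<open>The tilt points against the deviation, so that
    \<open>h * (real N * ?\<mu> - real n)\<close> is negative in either case.\<close>
  define h where "h = (if real N * ?\<mu> \<ge> real n then - c else c)"
  have hc: "\<bar>h\<bar> = c" using c by (simp add: h_def)
  then have habs: "\<bar>h\<bar> = \<delta> / (2 * (real d)\<^sup>2)" by (simp add: c_def)
  have hd: "\<bar>h\<bar> * real d \<le> 1"
  proof -
    have "\<bar>h\<bar> * real d = \<delta> / (2 * real d)" using d by (simp add: habs power2_eq_square)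
    also have "\<dots> \<le> 1" using d \<delta> by (simp add: field_simps)
    finally show ?thesis .
  qed
  have nn: "fps_nth q i \<ge> 0" and qz: "i > d \<Longrightarrow> fps_nth q i = 0" for i
    using q by (auto simp: prob_fps_def)
  have "(\<Sum>i\<le>d. fps_nth q i * exp h ^ i) \<le> (\<Sum>i\<le>d. fps_nth q i * (1 + h * real i + h\<^sup>2 * (real d)\<^sup>2))"
  proof (intro sum_mono mult_left_mono nn)
    fix i assume "i \<in> {..d}"
    then have i: "real i \<le> real d" by simp
    have "\<bar>h * real i\<bar> \<le> \<bar>h\<bar> * real d" using i by (simp add: abs_mult mult_left_mono)
    then have "exp (h * real i) \<le> 1 + h * real i + (h * real i)\<^sup>2"
      using hd by (intro exp_le_quadratic) linarith
    also have "(h * real i)\<^sup>2 \<le> h\<^sup>2 * (real d)\<^sup>2"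
      using i by (simp add: power_mult_distrib mult_left_mono power_mono)
    finally show "exp h ^ i \<le> 1 + h * real i + h\<^sup>2 * (real d)\<^sup>2"
      by (simp add: exp_of_nat_mult[symmetric] mult.commute)
  qed
  also have "\<dots> = (\<Sum>i\<le>d. fps_nth q i) * (1 + h\<^sup>2 * (real d)\<^sup>2) + h * (\<Sum>i\<le>d. real i * fps_nth q i)"
    by (simp add: algebra_simps sum.distrib sum_distrib_left sum_distrib_right)
  also have "\<dots> = 1 + (h * ?\<mu> + h\<^sup>2 * (real d)\<^sup>2)"
    by (simp add: prob_fps_sum0[OF q] fps_mean_sum0)
  also have "\<dots> \<le> exp (h * ?\<mu> + h\<^sup>2 * (real d)\<^sup>2)" by (rule exp_ge_add_one_self)
  finally have S: "(\<Sum>i\<le>d. fps_nth q i * exp h ^ i) \<le> exp (h * ?\<mu> + h\<^sup>2 * (real d)\<^sup>2)" .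
  have "fps_nth (q ^ N) n * exp h ^ n \<le> (\<Sum>i\<le>d. fps_nth q i * exp h ^ i) ^ N"
    by (rule fps_power_nth_le) (use nn qz in auto)
  also have "\<dots> \<le> exp (h * ?\<mu> + h\<^sup>2 * (real d)\<^sup>2) ^ N"
    by (intro power_mono S sum_nonneg mult_nonneg_nonneg nn) auto
  also have "\<dots> = exp (real N * (h * ?\<mu> + h\<^sup>2 * (real d)\<^sup>2))" by (simp add: exp_of_nat_mult)
  finally have "fps_nth (q ^ N) n * exp (real n * h) \<le> exp (real N * (h * ?\<mu> + h\<^sup>2 * (real d)\<^sup>2))"
    by (simp add: exp_of_nat_mult)
  then have "fps_nth (q ^ N) n \<le> exp (real N * (h * ?\<mu> + h\<^sup>2 * (real d)\<^sup>2)) / exp (real n * h)"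
    by (simp add: pos_le_divide_eq)
  also have "\<dots> = exp (h * (real N * ?\<mu> - real n) + real N * (h\<^sup>2 * (real d)\<^sup>2))"
    by (simp add: exp_diff[symmetric] algebra_simps)
  also have "h * (real N * ?\<mu> - real n) = - (\<bar>h\<bar> * \<bar>real N * ?\<mu> - real n\<bar>)"
    unfolding hc by (cases "real N * ?\<mu> \<ge> real n") (simp_all add: h_def algebra_simps)
  also have "exp (- (\<bar>h\<bar> * \<bar>real N * ?\<mu> - real n\<bar>) + real N * (h\<^sup>2 * (real d)\<^sup>2))
      \<le> exp (- (\<bar>h\<bar> * (\<delta> * real n)) + real n * (h\<^sup>2 * (real d)\<^sup>2))"
  proof -
    have "\<bar>h\<bar> * (\<delta> * real n) \<le> \<bar>h\<bar> * \<bar>real N * ?\<mu> - real n\<bar>"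
      using dev by (intro mult_left_mono) auto
    moreover have "real N * (h\<^sup>2 * (real d)\<^sup>2) \<le> real n * (h\<^sup>2 * (real d)\<^sup>2)"
      using N by (intro mult_right_mono) auto
    ultimately show ?thesis by simp
  qed
  also have "- (\<bar>h\<bar> * (\<delta> * real n)) + real n * (h\<^sup>2 * (real d)\<^sup>2) = - (real n * \<delta>\<^sup>2 / (4 * (real d)\<^sup>2))"
  proof -
    have "h\<^sup>2 = (\<delta> / (2 * (real d)\<^sup>2))\<^sup>2" by (simp only: habs[symmetric] power2_abs)
    then show ?thesis unfolding habs using d by (simp add: field_simps power2_eq_square)
  qed
  finally show ?thesis .
qed

section \<open>Renewal sums with slowly varying weights\<close>

text \<open>Turns logarithmic estimates of a weight into relative errors. Below 1 the claim is
  \<open>1 - g \<le> 1 / g - 1\<close>, that is \<open>g + 1 / g \<ge> 2\<close>.\<close>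

lemma abs_minus_1_le_exp_abs_ln:
  fixes g :: real
  assumes "g > 0"
  shows "\<bar>g - 1\<bar> \<le> exp \<bar>ln g\<bar> - 1"
proof (cases "g \<ge> 1")
  case False
  have "exp \<bar>ln g\<bar> = 1 / g" using assms False by (simp add: exp_minus inverse_eq_divide)
  moreover have "2 \<le> g + 1 / g"
  proof -
    have "0 \<le> (g - 1)\<^sup>2 / g" using assms by simp
    also have "(g - 1)\<^sup>2 / g = g + 1 / g - 2" using assms by (simp add: field_simps power2_eq_square)
    finally show ?thesis by simp
  qed
  ultimately show ?thesis using False by simp
qed (use assms in simp)

lemma abs_ln_le:
  fixes x :: real
  assumes "x \<ge> 1 / 2"
  shows "\<bar>ln x\<bar> \<le> 2 * \<bar>x - 1\<bar>"
proof (cases "x \<ge> 1")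
  case True
  then show ?thesis using ln_le_minus_one[of x] by simp
next
  case False
  have "- ln x \<le> 1 / x - 1" using ln_le_minus_one[of "1 / x"] assms by (simp add: ln_div)
  also have "\<dots> \<le> 2 * (1 - x)"
  proof -
    have "0 \<le> (1 - x) * (2 * x - 1)" using False assms by (intro mult_nonneg_nonneg) auto
    then show ?thesis using assms by (simp add: field_simps)
  qed
  finally show ?thesis using False assms by simp
qed

lemma fps_scale_power:
  fixes f :: "real fps"
  shows "fps_nth ((fps_const c * f) ^ N) n = c ^ N * fps_nth (f ^ N) n"
  by (simp add: power_mult_distrib fps_const_power)

lemma fps_power_nth_eq_0:
  fixes f :: "real fps"
  assumes z: "\<And>i. i > d \<Longrightarrow> fps_nth f i = 0" and n: "n > N * d"
  shows "fps_nth (f ^ N) n = 0"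
  using n
proof (induction N arbitrary: n)
  case (Suc N)
  have "fps_nth f i * fps_nth (f ^ N) (n - i) = 0" for i
    using z[of i] Suc.IH[of "n - i"] Suc.prems by (cases "i > d") auto
  then show ?case unfolding power_Suc fps_mult_nth by (intro sum.neutral ballI)
qed simp

text \<open>After normalising \<open>W n\<close> to a probability law \<open>q n\<close>, each
  summand is the unweighted renewal term \<open>x n k\<close> times a correction
  \<open>g n k\<close>. For typical \<open>k\<close>, those near \<open>\<kappa> n\<close>, the
  correction is close to 1: the mass contributes \<open>H n ^ (d * k + 1)\<close> with an exponent
  of at most \<open>n + 1\<close>, and \<open>c\<close> varies slowly. For the other
  \<open>k\<close> the correction stays bounded while \<open>x n k\<close> is exponentially
  small.\<close>

lemma weighted_renewal_limit:
  fixes W :: "nat \<Rightarrow> real fps" and c :: "nat \<Rightarrow> real"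
  assumes d: "d \<ge> 2"
    and nn: "\<And>n j. fps_nth (W n) j \<ge> 0" and W0: "\<And>n. fps_nth (W n) 0 = 0"
    and Wz: "\<And>n j. j > d \<Longrightarrow> fps_nth (W n) j = 0"
    and lim: "\<And>j. (\<lambda>n. fps_nth (W n) j) \<longlonglongrightarrow> fps_nth p j"
    and mass: "(\<lambda>n. real (n + 1) * ((\<Sum>j=1..d. fps_nth (W n) j) - 1)) \<longlonglongrightarrow> 0"
    and p: "prob_fps d p" "fps_nth p 1 > 0" "fps_nth p 2 > 0"
    and c_pos: "\<And>k. c k > 0" and K: "K > 0"
    and c_ratio: "\<And>a b. 1 \<le> a \<Longrightarrow> a \<le> b \<Longrightarrow> \<bar>ln (c b) - ln (c a)\<bar> \<le> K * (real b - real a) / real a"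
  shows "(\<lambda>n. \<Sum>k\<le>n. c k / c (nat \<lfloor>real (n + 1) / (real d * fps_mean d p)\<rfloor>) *
            fps_nth (W n ^ (d * k + 1)) (n + 1)) \<longlonglongrightarrow> 1 / (real d * fps_mean d p)"
proof -
  let ?\<mu> = "fps_mean d p"
  define H where "H n = (\<Sum>j=1..d. fps_nth (W n) j)" for n
  define q where "q n = fps_const (1 / H n) * W n" for n
  \<comment> \<open>About \<open>(n + 1) / ?\<mu>\<close> steps are needed to reach
    \<open>n + 1\<close>, and \<open>d * k + 1\<close> steps belong to the index
    \<open>k\<close>.\<close>
  define \<kappa> where "\<kappa> n = nat \<lfloor>real (n + 1) / (real d * ?\<mu>)\<rfloor>" for n
  define x where "x n k = fps_nth (q n ^ (d * k + 1)) (n + 1)" for n k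
  define g where "g n k = c k / c (\<kappa> n) * H n ^ (d * k + 1)" for n k
  have \<mu>1: "?\<mu> \<ge> 1" by (rule fps_mean_ge_1[OF p(1)])
  have \<mu>d: "?\<mu> \<le> real d"
  proof -
    have "?\<mu> \<le> (\<Sum>i=1..d. real d * fps_nth p i)"
      unfolding fps_mean_def using p(1) by (intro sum_mono mult_right_mono) (auto simp: prob_fps_def)
    also have "\<dots> = real d" using p(1) by (simp add: sum_distrib_left[symmetric] prob_fps_def)
    finally show ?thesis .
  qed
  have Hlim: "H \<longlonglongrightarrow> 1"
  proof -
    have "(\<lambda>n. real (n + 1) * (H n - 1) * (1 / real (n + 1))) \<longlonglongrightarrow> 0 * 0"
      unfolding H_def by (intro tendsto_mult mass) real_asymp
    then have "(\<lambda>n. H n - 1) \<longlonglongrightarrow> 0" by (simp del: of_nat_Suc)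
    then show ?thesis by (simp add: LIM_zero_iff)
  qed
  have evH: "\<forall>\<^sub>F n in sequentially. H n > 1 / 2"
    by (rule order_tendstoD(1)[OF Hlim]) simp
  have q: "prob_fps d (q n)" if "H n > 1 / 2" for n
    unfolding prob_fps_def q_def using that nn W0 Wz
    by (auto simp: sum_divide_distrib[symmetric] H_def)
  have evq: "\<forall>\<^sub>F n in sequentially. prob_fps d (q n)"
    using evH by eventually_elim (rule q)
  have qlim: "(\<lambda>n. fps_nth (q n) j) \<longlonglongrightarrow> fps_nth p j" for j
  proof -
    have "(\<lambda>n. 1 / H n * fps_nth (W n) j) \<longlonglongrightarrow> 1 / 1 * fps_nth p j"
      by (intro tendsto_intros Hlim lim) simp
    then show ?thesis by (simp add: q_def)
  qed
  have xlim: "(\<lambda>n. \<Sum>k\<le>n. x n k) \<longlonglongrightarrow> 1 / (real d * ?\<mu>)"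
    unfolding x_def by (rule renewal_class_limit[OF d evq qlim p])
  have meanlim: "(\<lambda>n. fps_mean d (q n)) \<longlonglongrightarrow> ?\<mu>"
    unfolding fps_mean_def by (intro tendsto_intros qlim)
  have Wx: "c k / c (\<kappa> n) * fps_nth (W n ^ (d * k + 1)) (n + 1) = g n k * x n k" if "H n > 1 / 2" for n k
  proof -
    have "W n = fps_const (H n) * q n"
      using that by (simp add: q_def mult.assoc[symmetric])
    then have "fps_nth (W n ^ (d * k + 1)) (n + 1) = H n ^ (d * k + 1) * x n k"
      unfolding x_def by (simp only: fps_scale_power)
    then show ?thesis by (simp only: g_def mult.assoc)
  qed
  have "(\<lambda>n. (\<Sum>k\<le>n. g n k * x n k) - (\<Sum>k\<le>n. x n k)) \<longlonglongrightarrow> 0"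
  proof (rule tendstoI)
    fix e :: real assume e: "e > 0"
    \<comment> \<open>Only indices \<open>k \<ge> (n + 1) / A\<close> contribute:
      \<open>d * k + 1\<close> steps of length at most \<open>d\<close> must reach
      \<open>n + 1\<close>. The factor 2 absorbs the additive constants for large
      \<open>n\<close>.\<close>
    define A where "A = 2 * (real d)\<^sup>2"
    have A: "A > 0" using d by (simp add: A_def)
    \<comment> \<open>The logarithm of a typical correction will be at most
      \<open>4 * (K * A) * \<delta>\<close>: three parts from the displacement of \<open>k\<close>,
      one from the mass. The minimum with 1 serves the tail bound.\<close>
    define \<delta> where "\<delta> = min 1 (ln (1 + e / 4) / (4 * (K * A)))"
    have \<delta>: "\<delta> > 0" "\<delta> \<le> 1" using e A K by (auto simp: \<delta>_def)
    have "4 * (K * A) * \<delta> \<le> ln (1 + e / 4)"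
    proof -
      have "\<delta> \<le> ln (1 + e / 4) / (4 * (K * A))" by (simp add: \<delta>_def)
      then show ?thesis using A K by (simp add: pos_le_divide_eq mult.commute)
    qed
    then have expd: "exp (4 * (K * A) * \<delta>) \<le> 1 + e / 4"
      using e by (simp add: ln_ge_iff)
    \<comment> \<open>Bounds all atypical terms together: \<open>n + 1\<close> summands, the worst
      correction, and the tail probability.\<close>
    define t where "t n = real (n + 1) * (exp (K * A + 1) * exp (- (real (n + 1) * \<delta>\<^sup>2 / (4 * (real d)\<^sup>2))))" for n
    have t0: "t \<longlonglongrightarrow> 0"
    proof -
      define a where "a = \<delta>\<^sup>2 / (4 * (real d)\<^sup>2)"
      have "a > 0" using \<delta> d by (simp add: a_def)
      then have "(\<lambda>n. real (n + 1) * (exp (K * A + 1) * exp (- (real (n + 1) * a)))) \<longlonglongrightarrow> 0"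
        by real_asymp
      then show ?thesis unfolding t_def[abs_def] a_def by simp
    qed
    have evt: "\<forall>\<^sub>F n in sequentially. t n < e / 4"
      using e by (intro order_tendstoD(2)[OF t0]) auto
    have "1 / (real d * ?\<mu>) < 2"
    proof -
      have "1 * 1 \<le> real d * ?\<mu>" using d \<mu>1 by (intro mult_mono) auto
      then have "1 / (real d * ?\<mu>) \<le> 1" by (simp add: divide_le_eq)
      then show ?thesis by simp
    qed
    then have evx: "\<forall>\<^sub>F n in sequentially. (\<Sum>k\<le>n. x n k) < 2"
      by (intro order_tendstoD(2)[OF xlim])
    have evmean: "\<forall>\<^sub>F n in sequentially. \<bar>fps_mean d (q n) - ?\<mu>\<bar> < \<delta>"
      using tendstoD[OF meanlim \<delta>(1)] by (simp add: dist_real_def)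
    have evmass: "\<forall>\<^sub>F n in sequentially. \<bar>real (n + 1) * (H n - 1)\<bar> < min 1 (K * A * \<delta>) / 2"
      using tendstoD[OF mass, of "min 1 (K * A * \<delta>) / 2"] \<delta> K A by (simp add: dist_real_def H_def)
    have evn: "\<forall>\<^sub>F n in sequentially. real (n + 1) \<ge> A + 2 / \<delta>"
      by real_asymp
    from evH evt evx evmean evmass evn
    have "\<forall>\<^sub>F n in sequentially. \<bar>(\<Sum>k\<le>n. g n k * x n k) - (\<Sum>k\<le>n. x n k)\<bar> < e"
    proof eventually_elim
      case (elim n)
      define \<nu> where "\<nu> = real (n + 1)"
      define \<tau> where "\<tau> = exp (- (\<nu> * \<delta>\<^sup>2 / (4 * (real d)\<^sup>2)))"
      have qn: "prob_fps d (q n)" by (rule q) (rule elim)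
      have \<nu>: "\<nu> \<ge> A + 2 / \<delta>" "\<nu> \<ge> 1" using elim by (auto simp: \<nu>_def)
      have \<nu>\<delta>: "2 \<le> \<delta> * \<nu>"
      proof -
        have "2 / \<delta> \<le> \<nu>" using \<nu> A by linarith
        then show ?thesis using \<delta> by (simp add: field_simps)
      qed
      have \<nu>A: "\<nu> \<ge> A" using \<nu> \<delta> by (smt (verit) divide_pos_pos)
      have Hpos: "H n > 0" using elim by linarith
      have gpos: "g n k > 0" for k
        unfolding g_def using c_pos Hpos by (intro mult_pos_pos divide_pos_pos zero_less_power) auto
      have xnn: "x n k \<ge> 0" for k
        unfolding x_def using qn by (intro fps_power_nonneg) (auto simp: prob_fps_def)
      define \<xi> where "\<xi> = \<nu> / (real d * ?\<mu>)"
      have d\<mu>: "1 \<le> real d * ?\<mu>" "real d * ?\<mu> \<le> (real d)\<^sup>2"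
      proof -
        have "1 * 1 \<le> real d * ?\<mu>" using d \<mu>1 by (intro mult_mono) auto
        then show "1 \<le> real d * ?\<mu>" by simp
        show "real d * ?\<mu> \<le> (real d)\<^sup>2" using \<mu>d by (simp add: power2_eq_square mult_left_mono)
      qed
      have \<kappa>b: "real (\<kappa> n) \<le> \<xi>" "real (\<kappa> n) > \<xi> - 1"
      proof -
        have "\<xi> \<ge> 0" using \<nu> d\<mu> by (simp add: \<xi>_def)
        then show "real (\<kappa> n) \<le> \<xi>" "real (\<kappa> n) > \<xi> - 1"
          unfolding \<kappa>_def \<xi>_def[symmetric] \<nu>_def[symmetric] by linarith+
      qed
      have \<xi>: "\<xi> \<le> \<nu>" "\<nu> / (real d)\<^sup>2 \<le> \<xi>"
      proof -
        show "\<xi> \<le> \<nu>" using d\<mu> \<nu> by (simp add: \<xi>_def divide_le_eq mult_ge1_I)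
        have "0 < real d * ?\<mu>" "0 < (real d)\<^sup>2" using d\<mu> d by auto
        then have "0 < (real d)\<^sup>2 * (real d * ?\<mu>)" by (rule mult_pos_pos[rotated])
        then show "\<nu> / (real d)\<^sup>2 \<le> \<xi>" unfolding \<xi>_def using d\<mu> \<nu> by (intro divide_left_mono) auto
      qed
      have half: "\<nu> / (real d)\<^sup>2 - 1 \<ge> \<nu> / A"
      proof -
        have "\<nu> / (real d)\<^sup>2 = 2 * (\<nu> / A)" by (simp add: A_def)
        moreover have "\<nu> / A \<ge> 1" using \<nu>A A by simp
        ultimately show ?thesis by linarith
      qed
      have \<kappa>low: "real (\<kappa> n) \<ge> \<nu> / A" using half \<xi> \<kappa>b by linarith
      have \<nu>Apos: "\<nu> / A \<ge> 1" using \<nu>A A by simp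
      \<comment> \<open>The ratio bound divides by the smaller index; both \<open>k\<close> and
        \<open>\<kappa> n\<close> are at least \<open>\<nu> / A\<close>, which puts
        \<open>\<nu>\<close> in the denominator.\<close>
      have lnc: "\<bar>ln (c k) - ln (c (\<kappa> n))\<bar> \<le> K * A * (\<bar>real k - real (\<kappa> n)\<bar> / \<nu>)"
        if k: "real k \<ge> \<nu> / A" for k
      proof -
        have *: "\<bar>ln (c b) - ln (c a)\<bar> \<le> K * A * ((real b - real a) / \<nu>)"
          if "real a \<ge> \<nu> / A" "a \<le> b" for a b
        proof -
          have "\<bar>ln (c b) - ln (c a)\<bar> \<le> K * (real b - real a) / real a"
            using that \<nu>Apos by (intro c_ratio) (linarith | simp)+
          also have "\<dots> \<le> K * (real b - real a) / (\<nu> / A)"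
            using that \<nu>Apos K by (intro divide_left_mono mult_nonneg_nonneg mult_pos_pos) (linarith | simp)+
          also have "\<dots> = K * A * ((real b - real a) / \<nu>)" by simp
          finally show ?thesis .
        qed
        show ?thesis
        proof (cases "k \<le> \<kappa> n")
          case True
          then show ?thesis using *[OF k True] by (simp add: abs_minus_commute)
        next
          case False
          then show ?thesis using *[OF \<kappa>low, of k] by simp
        qed
      qed
      have lng: "\<bar>ln (g n k)\<bar> \<le> K * A * (\<bar>real k - real (\<kappa> n)\<bar> / \<nu>) + min 1 (K * A * \<delta>)"
        if k: "real k \<ge> \<nu> / A" and N: "d * k + 1 \<le> n + 1" for k
      proof -
        have "ln (g n k) = ln (c k) - ln (c (\<kappa> n)) + real (d * k + 1) * ln (H n)"
          unfolding g_def using c_pos[of k] c_pos[of "\<kappa> n"] Hpos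
          by (subst ln_mult) (simp_all add: ln_div ln_realpow less_imp_neq[symmetric] del: power_Suc)
        moreover have "\<bar>real (d * k + 1) * ln (H n)\<bar> \<le> min 1 (K * A * \<delta>)"
        proof -
          have "real (d * k + 1) \<le> real (n + 1)" using N by (simp only: of_nat_le_iff)
          then have "\<bar>real (d * k + 1) * ln (H n)\<bar> \<le> \<nu> * (2 * \<bar>H n - 1\<bar>)"
            unfolding abs_mult \<nu>_def using elim by (intro mult_mono abs_ln_le) auto
          also have "\<dots> = 2 * \<bar>real (n + 1) * (H n - 1)\<bar>" by (simp add: \<nu>_def abs_mult)
          also have "\<dots> \<le> min 1 (K * A * \<delta>)" using elim by linarith
          finally show ?thesis .
        qed
        ultimately show ?thesis using lnc[OF k] by linarith
      qed
      have summand: "\<bar>g n k - 1\<bar> * x n k \<le> (exp (4 * (K * A) * \<delta>) - 1) * x n k + exp (K * A + 1) * \<tau>" for k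
      proof (cases "x n k = 0")
        case False
        have N: "d * k + 1 \<le> n + 1"
        proof (rule ccontr)
          assume "\<not> ?thesis"
          then have "x n k = 0" unfolding x_def using qn
            by (intro startsby_zero_power_prefix[rule_format]) (auto simp: prob_fps_def)
          then show False using False by simp
        qed
        have "n + 1 \<le> (d * k + 1) * d"
        proof (rule ccontr)
          assume "\<not> ?thesis"
          then have "x n k = 0" unfolding x_def using qn
            by (intro fps_power_nth_eq_0) (auto simp: prob_fps_def)
          then show False using False by simp
        qed
        then have "\<nu> \<le> real ((d * k + 1) * d)" unfolding \<nu>_def by (simp only: of_nat_le_iff)
        then have "\<nu> \<le> (real d)\<^sup>2 * real k + real d" by (simp add: algebra_simps power2_eq_square)
        also have "\<dots> \<le> (real d)\<^sup>2 * real k + (real d)\<^sup>2"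
          using d by (simp add: power2_eq_square)
        finally have "\<nu> / (real d)\<^sup>2 \<le> real k + 1" using d by (simp add: divide_le_eq algebra_simps)
        then have klow: "real k \<ge> \<nu> / A" using half by linarith
        have kup: "real k \<le> \<nu>"
        proof -
          have "k \<le> d * k" using d by simp
          then have "k \<le> n" using N by linarith
          then show ?thesis by (simp add: \<nu>_def)
        qed
        note gb = abs_minus_1_le_exp_abs_ln[OF gpos, of k]
        \<comment> \<open>Atypical numbers of steps are handled by the tail bound, typical ones by
          the closeness of \<open>k\<close> to \<open>\<kappa> n\<close>.\<close>
        show ?thesis
        proof (cases "\<bar>real (d * k + 1) * fps_mean d (q n) - \<nu>\<bar> \<ge> \<delta> * \<nu>")
          case True
          have x\<tau>: "x n k \<le> \<tau>"
            unfolding x_def \<tau>_def \<nu>_def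
            by (rule prob_fps_tail[OF qn _ \<delta> N]) (use True d in \<open>auto simp: \<nu>_def\<close>)
          have "\<bar>real k - real (\<kappa> n)\<bar> / \<nu> \<le> 1"
            using kup \<kappa>b \<xi> \<nu> by (simp add: divide_le_eq)
          then have "K * A * (\<bar>real k - real (\<kappa> n)\<bar> / \<nu>) \<le> K * A * 1"
            using K A by (intro mult_left_mono) auto
          then have "\<bar>ln (g n k)\<bar> \<le> K * A + 1" using lng[OF klow N] by linarith
          then have "exp \<bar>ln (g n k)\<bar> \<le> exp (K * A + 1)" by simp
          then have "\<bar>g n k - 1\<bar> \<le> exp (K * A + 1)" using gb by linarith
          then have "\<bar>g n k - 1\<bar> * x n k \<le> exp (K * A + 1) * \<tau>"
            using x\<tau> xnn by (intro mult_mono) auto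
          moreover have "(exp (4 * (K * A) * \<delta>) - 1) * x n k \<ge> 0"
            using xnn K A \<delta> by (intro mult_nonneg_nonneg) auto
          ultimately show ?thesis by linarith
        next
          case False
          let ?N = "real (d * k + 1)"
          have "?N \<le> real (n + 1)" using N by (simp only: of_nat_le_iff)
          then have "\<bar>?N * (?\<mu> - fps_mean d (q n))\<bar> \<le> \<nu> * \<delta>"
            unfolding abs_mult using elim by (intro mult_mono) (auto simp: \<nu>_def abs_minus_commute)
          then have dev: "\<bar>?N * ?\<mu> - \<nu>\<bar> \<le> 2 * (\<delta> * \<nu>)"
            using False unfolding right_diff_distrib by (simp only: mult.commute[of \<nu> \<delta>])
          \<comment> \<open>The additive 1 pays for the extra step in \<open>d * k + 1\<close>,
            which shifts the position by one mean.\<close>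
          have "\<bar>real k - \<xi>\<bar> \<le> 2 * (\<delta> * \<nu>) + 1"
          proof -
            have nz: "real d * ?\<mu> \<noteq> 0" using d\<mu> by linarith
            have "real k - \<xi> = (real k * (real d * ?\<mu>) - \<nu>) / (real d * ?\<mu>)"
              unfolding \<xi>_def diff_divide_distrib by (simp only: nonzero_mult_div_cancel_right[OF nz])
            also have "real k * (real d * ?\<mu>) - \<nu> = ?N * ?\<mu> - \<nu> - ?\<mu>" by (simp add: algebra_simps)
            finally have "\<bar>real k - \<xi>\<bar> \<le> (2 * (\<delta> * \<nu>) + ?\<mu>) / (real d * ?\<mu>)"
              using dev \<mu>1 d\<mu> by (simp add: abs_divide divide_right_mono)
            also have "\<dots> = 2 * (\<delta> * \<nu>) / (real d * ?\<mu>) + 1 / real d"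
              using \<mu>1 by (simp add: add_divide_distrib)
            also have "\<dots> \<le> 2 * (\<delta> * \<nu>) / 1 + 1 / 1"
              using d\<mu> d \<delta> \<nu> by (intro add_mono divide_left_mono) auto
            finally show ?thesis by simp
          qed
          \<comment> \<open>Rounding in \<open>\<kappa> n\<close> costs another 1; both units are
            absorbed by \<open>\<nu>\<delta>\<close>.\<close>
          then have "\<bar>real k - real (\<kappa> n)\<bar> \<le> 3 * (\<delta> * \<nu>)" using \<kappa>b \<nu>\<delta> by linarith
          then have "\<bar>real k - real (\<kappa> n)\<bar> / \<nu> \<le> 3 * \<delta>" using \<nu> by (simp add: divide_le_eq)
          then have "K * A * (\<bar>real k - real (\<kappa> n)\<bar> / \<nu>) \<le> K * A * (3 * \<delta>)"
            using K A by (intro mult_left_mono) auto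
          then have "\<bar>ln (g n k)\<bar> \<le> 4 * (K * A) * \<delta>" using lng[OF klow N] by linarith
          then have "exp \<bar>ln (g n k)\<bar> \<le> exp (4 * (K * A) * \<delta>)" by simp
          then have "\<bar>g n k - 1\<bar> \<le> exp (4 * (K * A) * \<delta>) - 1" using gb by linarith
          then have "\<bar>g n k - 1\<bar> * x n k \<le> (exp (4 * (K * A) * \<delta>) - 1) * x n k"
            using xnn by (intro mult_right_mono) auto
          moreover have "exp (K * A + 1) * \<tau> \<ge> 0" by (simp add: \<tau>_def)
          ultimately show ?thesis by linarith
        qed
      qed (simp add: \<tau>_def)
      have "\<bar>(\<Sum>k\<le>n. g n k * x n k) - (\<Sum>k\<le>n. x n k)\<bar> = \<bar>\<Sum>k\<le>n. (g n k - 1) * x n k\<bar>"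
        by (simp add: sum_subtractf left_diff_distrib)
      also have "\<dots> \<le> (\<Sum>k\<le>n. \<bar>g n k - 1\<bar> * x n k)"
        using xnn by (intro order_trans[OF sum_abs] sum_mono) (simp add: abs_mult)
      also have "\<dots> \<le> (\<Sum>k\<le>n. (exp (4 * (K * A) * \<delta>) - 1) * x n k + exp (K * A + 1) * \<tau>)"
        by (intro sum_mono summand)
      also have "\<dots> = (exp (4 * (K * A) * \<delta>) - 1) * (\<Sum>k\<le>n. x n k) + t n"
        by (simp add: sum.distrib sum_distrib_left t_def \<tau>_def \<nu>_def)
      also have "\<dots> \<le> e / 4 * 2 + t n"
        using expd elim xnn e by (intro add_right_mono mult_mono) (auto intro!: sum_nonneg)
      also have "\<dots> < e" using elim e by linarith
      finally show ?case .
    qed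
    then show "\<forall>\<^sub>F n in sequentially. dist ((\<Sum>k\<le>n. g n k * x n k) - (\<Sum>k\<le>n. x n k)) 0 < e"
      by (simp add: dist_real_def)
  qed
  from tendsto_add[OF this xlim] have "(\<lambda>n. \<Sum>k\<le>n. g n k * x n k) \<longlonglongrightarrow> 1 / (real d * ?\<mu>)" by simp
  moreover have "\<forall>\<^sub>F n in sequentially. (\<Sum>k\<le>n. g n k * x n k) =
     (\<Sum>k\<le>n. c k / c (\<kappa> n) * fps_nth (W n ^ (d * k + 1)) (n + 1))"
    using evH by eventually_elim (simp only: Wx)
  ultimately show ?thesis unfolding \<kappa>_def by (rule Lim_transform_eventually)
qed

section \<open>Fuss--Catalan numbers and the tree equation\<close>

text \<open>\<open>fuss m n x\<close> is the coefficient of $w^n$ in $B^x$, where $B = 1 + w B^m$.\<close>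
fun fuss :: "nat \<Rightarrow> nat \<Rightarrow> nat \<Rightarrow> nat" where
  "fuss m 0 x = 1"
| "fuss m (Suc n) 0 = 0"
| "fuss m (Suc n) (Suc x) = fuss m (Suc n) x + fuss m n (x + m)"

lemma fuss_0 [simp]: "fuss m n 0 = (if n = 0 then 1 else 0)"
  by (cases n) auto

text \<open>The law of exponents for \<open>B ^ x * B ^ y\<close>. The inner induction on
  \<open>x\<close> follows \<open>B ^ (x + 1) = B ^ x + w * B ^ (x + m)\<close>, whose second term
  lowers \<open>n\<close> and is covered by the outer induction.\<close>

lemma fuss_convolution: "(\<Sum>k\<le>n. fuss m k x * fuss m (n - k) y) = fuss m n (x + y)"
proof (induction n arbitrary: x y)
  case (Suc n)
  show ?case
  proof (induction x)
    case 0
    have "(\<Sum>k\<le>Suc n. fuss m k 0 * fuss m (Suc n - k) y) = (\<Sum>k\<in>{0}. fuss m k 0 * fuss m (Suc n - k) y)"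
      by (rule sum.mono_neutral_right) auto
    then show ?case by simp
  next
    case (Suc x)
    have "(\<Sum>k\<le>Suc n. fuss m k (Suc x) * fuss m (Suc n - k) y)
        = fuss m (Suc n) y + (\<Sum>k\<le>n. (fuss m (Suc k) x + fuss m k (x + m)) * fuss m (n - k) y)"
      by (subst sum.atMost_Suc_shift) simp
    also have "\<dots> = (fuss m (Suc n) y + (\<Sum>k\<le>n. fuss m (Suc k) x * fuss m (n - k) y))
        + (\<Sum>k\<le>n. fuss m k (x + m) * fuss m (n - k) y)"
      by (simp add: distrib_right sum.distrib)
    also have "fuss m (Suc n) y + (\<Sum>k\<le>n. fuss m (Suc k) x * fuss m (n - k) y)
        = (\<Sum>k\<le>Suc n. fuss m k x * fuss m (Suc n - k) y)"
      by (subst sum.atMost_Suc_shift) simp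
    finally show ?case by (simp only: Suc.IH \<open>\<And>x y. _ x y = fuss m n (x + y)\<close>) (simp add: ac_simps)
  qed
qed simp

section \<open>Closed form and growth of the Fuss--Catalan numbers\<close>

lemma fuss_closed:
  assumes "m \<ge> 1"
  shows "fuss m n x * (x + m * n) = x * ((x + m * n) choose n)"
  using assms
proof (induction m n x rule: fuss.induct)
  case (3 m n x)
  \<comment> \<open>Both terms of the recursion have the same upper binomial index \<open>N\<close>,
    so Pascal's rule applies after multiplying by it.\<close>
  define N where "N = x + m + m * n"
  have N: "N \<ge> 1" using 3 by (simp add: N_def)
  have IH1: "fuss m (Suc n) x * N = x * (N choose Suc n)"
    and IH2: "fuss m n (x + m) * N = (x + m) * (N choose n)"
    using 3 by (simp_all add: N_def algebra_simps)
  have e1: "(Suc N choose Suc n) * Suc n = Suc N * (N choose n)"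
    by (metis Suc_times_binomial mult.commute)
  have e2: "Suc N choose Suc n = (N choose n) + (N choose Suc n)" by simp
  have "N * (fuss m (Suc n) (Suc x) * Suc N) = Suc N * (fuss m (Suc n) x * N + fuss m n (x + m) * N)"
    by (simp add: algebra_simps)
  also have "\<dots> = Suc N * (x * (N choose Suc n) + (x + m) * (N choose n))" by (simp only: IH1 IH2)
  also have "\<dots> = Suc N * (x * (Suc N choose Suc n) + m * (N choose n))" by (simp add: algebra_simps)
  also have "\<dots> = x * (Suc N choose Suc n) * Suc N + m * (Suc N * (N choose n))"
    by (simp add: algebra_simps del: binomial_Suc_Suc)
  also have "\<dots> = x * (Suc N choose Suc n) * Suc N + m * ((Suc N choose Suc n) * Suc n)" by (simp only: e1)
  also have "\<dots> = (Suc N choose Suc n) * (x * Suc N + m * Suc n)"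
    by (simp add: algebra_simps del: binomial_Suc_Suc)
  also have "x * Suc N + m * Suc n = N * Suc x" by (simp add: N_def algebra_simps)
  finally have "N * (fuss m (Suc n) (Suc x) * Suc N) = N * (Suc x * (Suc N choose Suc n))"
    by (simp only: ac_simps)
  then have "fuss m (Suc n) (Suc x) * Suc N = Suc x * (Suc N choose Suc n)"
    using N by (simp only: mult_cancel1) (elim disjE; linarith)
  moreover have "Suc x + m * Suc n = Suc N" by (simp add: N_def)
  ultimately show ?case by (simp only:)
qed auto

lemma fuss_1_fact:
  assumes "m \<ge> 1"
  shows "real (fuss m n 1) = fact (m * n) / (fact n * fact ((m - 1) * n + 1))"
proof -
  have le: "n \<le> 1 + m * n" using assms by (cases m) auto
  have diff: "1 + m * n - n = (m - 1) * n + 1" using assms by (cases m) auto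
  have "fuss m n 1 * (1 + m * n) = (1 + m * n) choose n"
    using fuss_closed[OF assms, of n 1] by simp
  then have "real (fuss m n 1) * real (1 + m * n) = real ((1 + m * n) choose n)"
    by (metis of_nat_mult)
  also have "\<dots> = fact (1 + m * n) / (fact n * fact ((m - 1) * n + 1))"
    by (simp only: binomial_fact[OF le] diff)
  also have "fact (1 + m * n) = (real (1 + m * n)) * (fact (m * n) :: real)" by simp
  finally have "real (1 + m * n) * real (fuss m n 1) = real (1 + m * n) * (fact (m * n) / (fact n * fact ((m - 1) * n + 1)))"
    by (simp add: field_simps)
  moreover have "real (1 + m * n) \<noteq> 0" by linarith
  ultimately show ?thesis using mult_left_cancel by blast
qed

lemma fact_add_prod: "(fact (a + b) :: real) = fact a * (\<Prod>i=1..b. real (a + i))"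
  by (induction b) (simp_all add: algebra_simps)

text \<open>In the quotient of factorials the last of the \<open>Suc d\<close> new factors on top
  cancels against \<open>n + 1\<close>. Pulling \<open>Suc d\<close> and \<open>d\<close> out of the
  remaining factors isolates the growth rate and leaves \<open>d\<close> quotients tending to
  1.\<close>

lemma fuss_ratio:
  assumes d: "d \<ge> 1"
  shows "real (fuss (Suc d) (Suc n) 1) * real d ^ d =
      real (fuss (Suc d) n 1) * real (Suc d) ^ Suc d *
        (\<Prod>i=1..d. (real n + real i / real (Suc d)) / (real n + real (Suc i) / real d))"
proof -
  let ?m = "Suc d"
  define S where "S = (\<Prod>i=1..d. real n + real i / real ?m)"
  define U where "U = (\<Prod>i=1..d. real n + real (Suc i) / real d)"
  have Upos: "U > 0" using d unfolding U_def by (intro prod_pos) (auto simp: add_nonneg_pos)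
  have num: "(\<Prod>i=1..?m. real (?m * n + i)) = real ?m ^ ?m * S * (real n + 1)"
  proof -
    have "(\<Prod>i=1..?m. real (?m * n + i)) = (\<Prod>i=1..?m. real ?m * (real n + real i / real ?m))"
      by (intro prod.cong refl) (simp add: field_simps)
    also have "\<dots> = real ?m ^ ?m * (\<Prod>i=1..?m. real n + real i / real ?m)"
      by (simp add: prod.distrib del: prod.cl_ivl_Suc of_nat_Suc)
    finally show ?thesis by (simp add: S_def)
  qed
  have den: "(\<Prod>i=1..d. real (d * n + 1 + i)) = real d ^ d * U"
  proof -
    have "(\<Prod>i=1..d. real (d * n + 1 + i)) = (\<Prod>i=1..d. real d * (real n + real (Suc i) / real d))"
      using d by (intro prod.cong refl) (simp add: field_simps)
    also have "\<dots> = real d ^ d * U" by (simp add: prod.distrib U_def del: of_nat_Suc)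
    finally show ?thesis .
  qed
  have f1: "(fact (?m * Suc n) :: real) = fact (?m * n) * (real ?m ^ ?m * S * (real n + 1))"
    using fact_add_prod[of "?m * n" ?m] unfolding num by (simp only: mult_Suc_right add.commute)
  have f2: "(fact (d * Suc n + 1) :: real) = fact (d * n + 1) * (real d ^ d * U)"
    using fact_add_prod[of "d * n + 1" d] unfolding den by (simp only: mult_Suc_right ac_simps)
  have "real (fuss ?m (Suc n) 1) * real d ^ d = fact (?m * Suc n) / (fact (Suc n) * fact (d * Suc n + 1)) * real d ^ d"
    using fuss_1_fact[of ?m "Suc n"] by simp
  also have "\<dots> = fact (?m * n) * (real ?m ^ ?m * S * (real n + 1)) /
      ((real n + 1) * fact n * (fact (d * n + 1) * (real d ^ d * U))) * real d ^ d"
    by (simp only: f1 f2) (simp add: algebra_simps)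
  also have "\<dots> = fact (?m * n) / (fact n * fact (d * n + 1)) * real ?m ^ ?m * (S / U)"
    using d Upos by (simp add: divide_simps)
  also have "S / U = (\<Prod>i=1..d. (real n + real i / real ?m) / (real n + real (Suc i) / real d))"
    by (simp add: S_def U_def prod_dividef)
  also have "fact (?m * n) / (fact n * fact (d * n + 1)) = real (fuss ?m n 1)"
    using fuss_1_fact[of ?m n] by simp
  finally show ?thesis .
qed

text \<open>Fuss--Catalan numbers divided by their exponential growth; what remains varies
  polynomially in \<open>k\<close>.\<close>

definition fuss_wt :: "nat \<Rightarrow> nat \<Rightarrow> real" where
  "fuss_wt d k = real (fuss (Suc d) k 1) * (real d ^ d / real (Suc d) ^ Suc d) ^ k"

lemma fuss_wt_Suc:
  assumes "d \<ge> 1"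
  shows "fuss_wt d (Suc k) = fuss_wt d k *
    (\<Prod>i=1..d. (real k + real i / real (Suc d)) / (real k + real (Suc i) / real d))"
proof -
  have "fuss_wt d (Suc k) = (real (fuss (Suc d) (Suc k) 1) * real d ^ d) / real (Suc d) ^ Suc d
      * (real d ^ d / real (Suc d) ^ Suc d) ^ k"
    by (simp add: fuss_wt_def del: of_nat_Suc fuss.simps)
  also have "\<dots> = fuss_wt d k *
    (\<Prod>i=1..d. (real k + real i / real (Suc d)) / (real k + real (Suc i) / real d))"
    unfolding fuss_ratio[OF assms] fuss_wt_def by (simp del: of_nat_Suc power_Suc)
  finally show ?thesis .
qed

lemma fuss_wt_pos: "d \<ge> 1 \<Longrightarrow> fuss_wt d k > 0"
proof (induction k)
  case (Suc k)
  then show ?case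
    by (subst fuss_wt_Suc) (auto intro!: mult_pos_pos prod_pos divide_pos_pos add_nonneg_pos)
qed (simp add: fuss_wt_def)

text \<open>The inequality \<open>ln x \<le> x - 1\<close> bounds one side, exchanging
  \<open>x\<close> and \<open>y\<close> the other. The range up to 2 covers the shifts
  \<open>Suc i / d\<close> with \<open>i \<le> d\<close>.\<close>

lemma ln_quotient_bound:
  fixes k x y :: real
  assumes "k \<ge> 1" "0 \<le> x" "x \<le> 2" "0 \<le> y" "y \<le> 2"
  shows "\<bar>ln ((k + x) / (k + y))\<bar> \<le> 2 / k"
proof -
  have b: "ln ((k + x) / (k + y)) \<le> 2 / k" if "0 \<le> x" "x \<le> 2" "0 \<le> y" "y \<le> 2" for x y :: real
  proof -
    have "ln ((k + x) / (k + y)) \<le> (k + x) / (k + y) - 1"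
      using that assms by (intro ln_le_minus_one) auto
    also have "\<dots> = (x - y) / (k + y)" using that assms by (simp add: field_simps)
    also have "\<dots> \<le> 2 / k" using that assms by (intro frac_le) auto
    finally show ?thesis .
  qed
  have "ln ((k + x) / (k + y)) = - ln ((k + y) / (k + x))"
    using assms by (simp add: ln_div)
  then show ?thesis using b[of x y] b[of y x] assms by linarith
qed

lemma fuss_wt_ln_Suc:
  assumes "d \<ge> 1" "k \<ge> 1"
  shows "\<bar>ln (fuss_wt d (Suc k)) - ln (fuss_wt d k)\<bar> \<le> 2 * real d / real k"
proof -
  define r where "r i = (real k + real i / real (Suc d)) / (real k + real (Suc i) / real d)" for i
  have r: "r i > 0" for i
    unfolding r_def using assms by (intro divide_pos_pos add_pos_nonneg) auto
  have "ln (fuss_wt d (Suc k)) = ln (fuss_wt d k) + (\<Sum>i=1..d. ln (r i))"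
    unfolding fuss_wt_Suc[OF assms(1)] r_def[symmetric]
    using r fuss_wt_pos[OF assms(1)] by (subst ln_mult) (auto intro: prod_pos simp: ln_prod less_imp_neq[symmetric])
  then have "\<bar>ln (fuss_wt d (Suc k)) - ln (fuss_wt d k)\<bar> \<le> (\<Sum>i=1..d. \<bar>ln (r i)\<bar>)" by simp
  also have "\<dots> \<le> (\<Sum>i=1..d. 2 / real k)"
    unfolding r_def using assms by (intro sum_mono ln_quotient_bound) (auto simp: field_simps)
  finally show ?thesis by (simp add: mult.commute)
qed

text \<open>Telescopes the one-step bound, with every denominator replaced by \<open>a\<close>. This
  is the slow variation required by the weighted renewal theorem, with constant
  \<open>2 * d\<close>.\<close>

lemma fuss_wt_ln_diff:
  assumes d: "d \<ge> 1" and a: "1 \<le> a" "a \<le> b"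
  shows "\<bar>ln (fuss_wt d b) - ln (fuss_wt d a)\<bar> \<le> 2 * real d * (real b - real a) / real a"
  using a(2)
proof (induction b rule: dec_induct)
  case (step b)
  have "\<bar>ln (fuss_wt d (Suc b)) - ln (fuss_wt d b)\<bar> \<le> 2 * real d / real b"
    using step a by (intro fuss_wt_ln_Suc[OF d]) auto
  also have "\<dots> \<le> 2 * real d / real a" using step a by (intro divide_left_mono) auto
  finally have "\<bar>ln (fuss_wt d (Suc b)) - ln (fuss_wt d a)\<bar> \<le>
      2 * real d / real a + 2 * real d * (real b - real a) / real a" using step by linarith
  also have "\<dots> = 2 * real d * (real (Suc b) - real a) / real a" using a by (simp add: field_simps)
  finally show ?case .
qed simp

section \<open>Solving the tree equation by composition\<close>

lemma fps_power_nth_comps: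
  fixes a :: "'a::comm_ring_1 fps"
  shows "fps_nth (a ^ m) s = (\<Sum>js\<in>comps m s. \<Prod>j\<leftarrow>js. fps_nth a j)"
proof (cases m)
  case 0
  have "comps 0 s = (if s = 0 then {[]} else {})" by (auto simp: comps_def)
  then show ?thesis using 0 by simp
next
  case (Suc k)
  have "natpermute s (k + 1) = comps m s" by (auto simp: natpermute_def comps_def Suc)
  then have "fps_nth (a ^ m) s = (\<Sum>v\<in>comps m s. \<Prod>j=0..k. fps_nth a (v ! j))"
    by (simp only: Suc fps_power_nth_Suc)
  also have "\<dots> = (\<Sum>js\<in>comps m s. \<Prod>j\<leftarrow>js. fps_nth a j)"
    by (intro sum.cong refl)
      (auto simp: comps_def Suc prod.list_conv_set_nth atLeastLessThanSuc_atLeastAtMost intro!: prod.cong)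
  finally show ?thesis .
qed

text \<open>Trees with fewer than \<open>d\<close> keys are single nodes marked by \<open>u\<close>,
  except that the empty tree has no node; hence the constant term 1.\<close>

definition leaf_fps :: "nat \<Rightarrow> real \<Rightarrow> real fps" where
  "leaf_fps d u = Abs_fps (\<lambda>j. if j = 0 then 1 else if j < d then u else 0)"

text \<open>With \<open>w\<close> equal to u z^d P^d, the series T = P B(w) satisfies T = P + P w
  B(w)^m = P + u z^d T^m, because \<open>d + 1\<close> is the arity. This recursion determines the
  coefficients, so \<open>f\<close> and \<open>T\<close> agree. In the expansion, \<open>k\<close>
  counts internal nodes and \<open>d * k + 1\<close> leaves.\<close>

lemma tree_gf_coeff:
  fixes f :: "nat \<Rightarrow> real"
  assumes d: "d \<ge> 1"
    and f0: "\<And>n. n < d \<Longrightarrow> f n = (if n = 0 then 1 else u)"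
    and frec: "\<And>n. n \<ge> d \<Longrightarrow> f n = u * (\<Sum>js\<in>comps (Suc d) (n - d). \<Prod>j\<leftarrow>js. f j)"
  shows "f n = (\<Sum>k\<le>n. real (fuss (Suc d) k 1) * u ^ k *
              fps_nth ((fps_X * leaf_fps d u) ^ (d * k + 1)) (n + 1))"
proof -
  define P where "P = leaf_fps d u"
  define B where "B = Abs_fps (\<lambda>k. real (fuss (Suc d) k 1))"
  define w where "w = fps_const u * fps_X ^ d * P ^ d"
  define T where "T = P * (B oo w)"
  have w0: "fps_nth w 0 = 0" using d by (simp add: w_def fps_mult_nth)
  have Bpow: "B ^ j = Abs_fps (\<lambda>k. real (fuss (Suc d) k j))" for j
  proof (induction j)
    case 0
    show ?case by (rule fps_ext) simp
  next
    case (Suc j)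
    show ?case
    proof (rule fps_ext)
      fix n
      have "fps_nth (B ^ Suc j) n = real (\<Sum>k\<le>n. fuss (Suc d) k 1 * fuss (Suc d) (n - k) j)"
        by (simp add: Suc fps_mult_nth atLeast0AtMost) (simp add: B_def)
      then show "fps_nth (B ^ Suc j) n = fps_nth (Abs_fps (\<lambda>k. real (fuss (Suc d) k (Suc j)))) n"
        by (simp add: fuss_convolution del: fuss.simps)
    qed
  qed
  have "B = 1 + fps_X * B ^ Suc d"
  proof (rule fps_ext)
    fix n
    show "fps_nth B n = fps_nth (1 + fps_X * B ^ Suc d) n"
      unfolding Bpow by (cases n) (simp_all add: B_def fps_X_mult_nth)
  qed
  then have "B oo w = (1 + fps_X * B ^ Suc d) oo w" by (rule arg_cong)
  also have "\<dots> = 1 + w * (B ^ Suc d oo w)"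
    using w0 by (simp add: fps_compose_add_distrib fps_compose_mult_distrib del: power_Suc)
  also have "B ^ Suc d oo w = (B oo w) ^ Suc d" by (rule fps_compose_power[OF w0, symmetric])
  finally have Bw: "B oo w = 1 + w * (B oo w) ^ Suc d" .
  have "T = P + fps_const u * fps_X ^ d * T ^ Suc d"
    unfolding T_def by (subst Bw) (simp add: w_def power_mult_distrib algebra_simps)
  then have "fps_nth T n = fps_nth (P + fps_const u * fps_X ^ d * T ^ Suc d) n" for n by (rule arg_cong)
  then have Tn: "fps_nth T n = fps_nth P n + (if n < d then 0 else u * fps_nth (T ^ Suc d) (n - d))" for n
    by (simp add: mult.assoc fps_X_power_mult_nth del: power_Suc)
  have "f n = fps_nth T n"
  proof (induction n rule: less_induct)
    case (less n)
    show ?case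
    proof (cases "n < d")
      case True
      then show ?thesis using f0[of n] Tn[of n] by (simp add: P_def leaf_fps_def)
    next
      case False
      have "(\<Prod>j\<leftarrow>js. f j) = (\<Prod>j\<leftarrow>js. fps_nth T j)" if "js \<in> comps (Suc d) (n - d)" for js
      proof -
        have "j < n" if "j \<in> set js" for j
          using member_le_sum_list[OF that] \<open>js \<in> _\<close> d False by (auto simp: comps_def)
        then have "map f js = map (fps_nth T) js" by (simp add: less.IH)
        then show ?thesis by (rule arg_cong)
      qed
      then show ?thesis using False frec[of n] Tn[of n] d
        by (simp add: fps_power_nth_comps P_def leaf_fps_def del: power_Suc)
    qed
  qed
  also have "fps_nth T n = (\<Sum>i=0..n. fps_nth P i * (\<Sum>k=0..n - i. fps_nth B k * fps_nth (w ^ k) (n - i)))"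
    unfolding T_def fps_mult_nth fps_compose_nth ..
  also have "\<dots> = (\<Sum>i=0..n. fps_nth P i * (\<Sum>k=0..n. fps_nth B k * fps_nth (w ^ k) (n - i)))"
    by (intro sum.cong refl arg_cong[where f = "\<lambda>x. _ * x"] sum.mono_neutral_left)
       (auto simp: startsby_zero_power_prefix[OF w0])
  also have "\<dots> = (\<Sum>k=0..n. fps_nth B k * (\<Sum>i=0..n. fps_nth P i * fps_nth (w ^ k) (n - i)))"
    unfolding sum_distrib_left by (subst sum.swap) (simp add: mult_ac)
  also have "\<dots> = (\<Sum>k\<le>n. fps_nth B k * fps_nth (P * w ^ k) n)"
    by (simp add: fps_mult_nth atLeast0AtMost)
  also have "\<dots> = (\<Sum>k\<le>n. real (fuss (Suc d) k 1) * u ^ k * fps_nth ((fps_X * P) ^ (d * k + 1)) (n + 1))"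
  proof (intro sum.cong refl)
    fix k
    \<comment> \<open>One more factor z completes z^(dk) to the power \<open>d * k + 1\<close> of
      \<open>fps_X * P\<close>; this is why the coefficient is taken at
      \<open>n + 1\<close>.\<close>
    have "fps_X * (P * w ^ k) = fps_const (u ^ k) * (fps_X * P) ^ (d * k + 1)"
      by (simp add: w_def power_mult_distrib power_mult[symmetric] fps_const_power power_add mult_ac)
    then have "fps_nth (fps_X * (P * w ^ k)) (n + 1) = fps_nth (fps_const (u ^ k) * (fps_X * P) ^ (d * k + 1)) (n + 1)"
      by (rule arg_cong)
    then have "fps_nth (P * w ^ k) n = u ^ k * fps_nth ((fps_X * P) ^ (d * k + 1)) (n + 1)"
      by (simp only: fps_mult_left_const_nth fps_X_mult_nth) simp
    then show "fps_nth B k * fps_nth (P * w ^ k) n =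
      real (fuss (Suc d) k 1) * u ^ k * fps_nth ((fps_X * P) ^ (d * k + 1)) (n + 1)"
      by (simp add: B_def)
  qed
  finally show ?thesis unfolding P_def .
qed

section \<open>Laws of additive functionals\<close>

lemma finite_comps: "finite (comps m s)"
proof -
  have "comps m s = natpermute s m" by (auto simp: comps_def natpermute_def)
  then show ?thesis by (simp add: natpermute_finite)
qed

lemma comps_le: "js \<in> comps m s \<Longrightarrow> j \<in> set js \<Longrightarrow> j \<le> s"
  using member_le_sum_list by (fastforce simp: comps_def)

lemma length_taus [simp]: "length (taus m n) = Suc n"
  by (induction n) auto

lemma taus_nth: "j \<le> n \<Longrightarrow> taus m n ! j = tau m j"
proof (induction n)
  case (Suc n)
  show ?case
  proof (cases "j = Suc n")
    case False
    then have "taus m (Suc n) ! j = taus m n ! j" using Suc.prems by (simp add: nth_append)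
    then show ?thesis using Suc False by simp
  qed (simp add: tau_def)
qed (simp add: tau_def)

lemma tau_small: "n \<le> m - 2 \<Longrightarrow> tau m n = 1"
  by (cases n) (auto simp: tau_def nth_append)

lemma tau_rec:
  assumes "m \<ge> 2" "n \<ge> m - 1"
  shows "tau m n = (\<Sum>js\<in>comps m (n - (m - 1)). \<Prod>j\<leftarrow>js. tau m j)"
proof (cases n)
  case (Suc k)
  have "(\<Prod>j\<leftarrow>js. taus m k ! j) = (\<Prod>j\<leftarrow>js. tau m j)" if "js \<in> comps m (n - (m - 1))" for js
  proof -
    have "j \<le> k" if "j \<in> set js" for j
      using comps_le[OF \<open>js \<in> _\<close> that] assms Suc by linarith
    then have "map ((!) (taus m k)) js = map (tau m) js" by (simp add: taus_nth)
    then show ?thesis by (rule arg_cong)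
  qed
  moreover have "tau m n = (\<Sum>js\<in>comps m (n - (m - 1)). \<Prod>j\<leftarrow>js. taus m k ! j)"
    using Suc assms by (simp add: tau_def nth_append)
  ultimately show ?thesis by simp
qed (use assms in simp)

lemma tau_pos:
  assumes "m \<ge> 2"
  shows "tau m n > 0"
proof (induction n rule: less_induct)
  case (less n)
  show ?case
  proof (cases "n \<le> m - 2")
    case False
    \<comment> \<open>A composition that always exists: all remaining keys go to the first
      subtree.\<close>
    define js where "js = (n - (m - 1)) # replicate (m - 1) 0"
    have js: "js \<in> comps m (n - (m - 1))" using assms by (simp add: js_def comps_def sum_list_replicate)
    have pos: "\<forall>j\<in>set js. tau m j > 0" if "js \<in> comps m (n - (m - 1))" for js
    proof
      fix j assume "j \<in> set js"
      then have "j < n" using comps_le[OF that] assms False by fastforce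
      then show "tau m j > 0" by (rule less.IH)
    qed
    have "(\<Prod>j\<leftarrow>js. tau m j) > 0" using pos[OF js] by (induction js) auto
    then have "0 < (\<Sum>js\<in>comps m (n - (m - 1)). \<Prod>j\<leftarrow>js. tau m j)"
      using sum_pos2[OF finite_comps js, of "\<lambda>js. \<Prod>j\<leftarrow>js. tau m j"] by auto
    then show ?thesis using tau_rec[OF assms, of n] False by simp
  qed (simp add: tau_small)
qed

text \<open>\<open>embed_pmf\<close> gives the intended law only for a nonnegative function of total
  mass 1; that mass is the recursion for \<open>tau\<close> divided by
  \<open>tau m n\<close>.\<close>

lemma pmf_Jpmf:
  assumes "m \<ge> 2" "n \<ge> m - 1"
  shows "pmf (Jpmf m n) js = (if js \<in> comps m (n - (m - 1))
       then (\<Prod>j\<leftarrow>js. real (tau m j)) / real (tau m n) else 0)"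
  unfolding Jpmf_def
proof (rule pmf_embed_pmf)
  let ?f = "\<lambda>js. if js \<in> comps m (n - (m - 1)) then (\<Prod>j\<leftarrow>js. real (tau m j)) / real (tau m n) else 0"
  have nn: "(\<Prod>j\<leftarrow>js. real (tau m j)) \<ge> 0" for js by (induction js) auto
  then show "0 \<le> ?f js" for js by simp
  have "(\<integral>\<^sup>+ js. ennreal (?f js) \<partial>count_space UNIV) = (\<Sum>js\<in>comps m (n - (m - 1)). ennreal (?f js))"
    by (rule nn_integral_count_space') (auto intro: finite_comps)
  also have "\<dots> = ennreal (\<Sum>js\<in>comps m (n - (m - 1)). ?f js)"
    using nn by (intro sum_ennreal) auto
  also have "(\<Sum>js\<in>comps m (n - (m - 1)). ?f js) =
      (\<Sum>js\<in>comps m (n - (m - 1)). (\<Prod>j\<leftarrow>js. real (tau m j))) / real (tau m n)"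
    by (simp add: sum_divide_distrib)
  also have "(\<Sum>js\<in>comps m (n - (m - 1)). (\<Prod>j\<leftarrow>js. real (tau m j))) = real (tau m n)"
  proof -
    have "(\<Prod>j\<leftarrow>js. real (tau m j)) = real (\<Prod>j\<leftarrow>js. tau m j)" for js by (induction js) auto
    then show ?thesis by (simp add: tau_rec[OF assms])
  qed
  finally show "(\<integral>\<^sup>+ js. ennreal (?f js) \<partial>count_space UNIV) = 1"
    using tau_pos[OF assms(1), of n] by simp
qed

lemma set_Jpmf:
  assumes "m \<ge> 2" "n \<ge> m - 1"
  shows "set_pmf (Jpmf m n) \<subseteq> comps m (n - (m - 1))"
  by (auto simp: set_pmf_eq pmf_Jpmf[OF assms])

lemma length_addf_laws [simp]: "length (addf_laws m b x n) = Suc n"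
  by (induction n) auto

lemma addf_laws_nth: "j \<le> n \<Longrightarrow> addf_laws m b x n ! j = addf_law m b x j"
proof (induction n)
  case (Suc n)
  show ?case
  proof (cases "j = Suc n")
    case False
    then have "addf_laws m b x (Suc n) ! j = addf_laws m b x n ! j" using Suc.prems by (simp add: nth_append)
    then show ?thesis using Suc False by simp
  qed (simp add: addf_law_def)
qed (simp add: addf_law_def)

lemma addf_law_small: "n \<le> m - 2 \<Longrightarrow> addf_law m b x n = return_pmf (x n)"
  by (cases n) (auto simp: addf_law_def nth_append)

lemma addf_law_Suc:
  assumes "m \<ge> 2" "Suc k \<ge> m - 1"
  shows "addf_law m b x (Suc k) = bind_pmf (Jpmf m (Suc k))
             (\<lambda>js. map_pmf (\<lambda>s. s + b (Suc k)) (sum_law (addf_laws m b x k) js))"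
  using assms by (auto simp: addf_law_def nth_append map_pmf_def)

section \<open>Moment generating functions and their recursion\<close>

definition mgf :: "real pmf \<Rightarrow> real \<Rightarrow> real" where
  "mgf p t = measure_pmf.expectation p (\<lambda>x. exp (t * x))"

lemma mgf_return [simp]: "mgf (return_pmf x) t = exp (t * x)"
  by (simp add: mgf_def)

lemma mgf_map_affine: "mgf (map_pmf (\<lambda>s. s + b) p) t = mgf p t * exp (t * b)"
  by (simp add: mgf_def distrib_left exp_add)

lemma sum_law_finite:
  "(\<And>j. j \<in> set js \<Longrightarrow> finite (set_pmf (L ! j))) \<Longrightarrow> finite (set_pmf (sum_law L js))"
  by (induction js) auto

lemma mgf_sum_law:
  "(\<And>j. j \<in> set js \<Longrightarrow> finite (set_pmf (L ! j))) \<Longrightarrow> mgf (sum_law L js) t = (\<Prod>j\<leftarrow>js. mgf (L ! j) t)"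
proof (induction js)
  case (Cons j js)
  have fin: "finite (set_pmf (L ! j))" "finite (set_pmf (sum_law L js))"
    using Cons.prems by (auto intro: sum_law_finite)
  have "sum_law L (j # js) = bind_pmf (L ! j) (\<lambda>x. map_pmf (\<lambda>s. s + x) (sum_law L js))"
    by (simp add: map_pmf_def add.commute)
  then have "mgf (sum_law L (j # js)) t =
      (\<Sum>x\<in>set_pmf (L ! j). pmf (L ! j) x *\<^sub>R mgf (map_pmf (\<lambda>s. s + x) (sum_law L js)) t)"
    unfolding mgf_def by (simp only:) (rule pmf_expectation_bind, use fin in auto)
  also have "\<dots> = mgf (sum_law L js) t * (\<Sum>x\<in>set_pmf (L ! j). pmf (L ! j) x *\<^sub>R exp (t * x))"
    by (simp add: mgf_map_affine sum_distrib_left mult_ac)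
  also have "(\<Sum>x\<in>set_pmf (L ! j). pmf (L ! j) x *\<^sub>R exp (t * x)) = mgf (L ! j) t"
    unfolding mgf_def by (rule integral_measure_pmf[symmetric]) (use fin in auto)
  finally show ?case using Cons by simp
qed simp

text \<open>Finite support makes every exponential moment a finite sum, so that expectations can be
  split over \<open>bind_pmf\<close> and transforms are entire.\<close>

lemma addf_law_finite:
  assumes "m \<ge> 2"
  shows "finite (set_pmf (addf_law m b x n))"
proof (induction n rule: less_induct)
  case (less n)
  show ?case
  proof (cases "n \<le> m - 2")
    case False
    then obtain k where k: "n = Suc k" by (cases n) auto
    have n: "Suc k \<ge> m - 1" using False k assms by simp
    have "finite (set_pmf (sum_law (addf_laws m b x k) js))" if "js \<in> set_pmf (Jpmf m (Suc k))" for js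
    proof (rule sum_law_finite)
      fix j assume "j \<in> set js"
      with that set_Jpmf[OF assms n] have "j \<le> Suc k - (m - 1)" by (auto dest: comps_le)
      then have "j \<le> k" using assms by linarith
      then show "finite (set_pmf (addf_laws m b x k ! j))"
        using less.IH[of j] by (simp add: addf_laws_nth k)
    qed
    moreover have "finite (set_pmf (Jpmf m (Suc k)))"
      using set_Jpmf[OF assms n] finite_comps finite_subset by blast
    ultimately show ?thesis unfolding k addf_law_Suc[OF assms n] by simp
  qed (simp add: addf_law_small)
qed

lemma prod_list_mult_map:
  fixes f g :: "'a \<Rightarrow> 'b::comm_monoid_mult"
  shows "(\<Prod>x\<leftarrow>xs. f x * g x) = (\<Prod>x\<leftarrow>xs. f x) * (\<Prod>x\<leftarrow>xs. g x)"
  by (induction xs) (auto simp: mult_ac)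

text \<open>The factor \<open>tau m n\<close> cancels the normalisation of the split law, and
  independence of the subtrees turns the transform into a product. The weighted transforms thus obey
  a recursion of the same shape as the tree numbers, ready for \<open>tree_gf_coeff\<close>.\<close>

lemma tau_mgf_addf_law_rec:
  assumes "m \<ge> 2" "n \<ge> m - 1"
  shows "real (tau m n) * mgf (addf_law m b x n) t = exp (t * b n) *
     (\<Sum>js\<in>comps m (n - (m - 1)). \<Prod>j\<leftarrow>js. real (tau m j) * mgf (addf_law m b x j) t)"
proof -
  obtain k where k: "n = Suc k" using assms by (cases n) auto
  have n: "Suc k \<ge> m - 1" using assms k by simp
  let ?C = "comps m (n - (m - 1))"
  have jk: "j \<le> k" if "js \<in> ?C" "j \<in> set js" for js j
    using comps_le[OF that] assms k by linarith
  have fin: "finite (set_pmf (addf_laws m b x k ! j))" if "js \<in> ?C" "j \<in> set js" for js j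
    using jk[OF that] by (simp add: addf_laws_nth addf_law_finite[OF assms(1)])
  have "mgf (addf_law m b x n) t =
     (\<Sum>js\<in>?C. pmf (Jpmf m n) js *\<^sub>R mgf (map_pmf (\<lambda>s. s + b n) (sum_law (addf_laws m b x k) js)) t)"
    unfolding k addf_law_Suc[OF assms(1) n] mgf_def
    by (rule pmf_expectation_bind)
       (use set_Jpmf[OF assms(1) n] fin in \<open>auto simp: finite_comps k intro!: sum_law_finite\<close>)
  also have "\<dots> = (\<Sum>js\<in>?C. (\<Prod>j\<leftarrow>js. real (tau m j)) / real (tau m n) *
      ((\<Prod>j\<leftarrow>js. mgf (addf_law m b x j) t) * exp (t * b n)))"
  proof (intro sum.cong refl)
    fix js assume js: "js \<in> ?C"
    have "map (\<lambda>j. mgf (addf_laws m b x k ! j) t) js = map (\<lambda>j. mgf (addf_law m b x j) t) js"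
      using jk[OF js] by (simp add: addf_laws_nth)
    then have "(\<Prod>j\<leftarrow>js. mgf (addf_laws m b x k ! j) t) = (\<Prod>j\<leftarrow>js. mgf (addf_law m b x j) t)"
      by (rule arg_cong)
    then show "pmf (Jpmf m n) js *\<^sub>R mgf (map_pmf (\<lambda>s. s + b n) (sum_law (addf_laws m b x k) js)) t =
       (\<Prod>j\<leftarrow>js. real (tau m j)) / real (tau m n) * ((\<Prod>j\<leftarrow>js. mgf (addf_law m b x j) t) * exp (t * b n))"
      using js mgf_sum_law[of js "addf_laws m b x k" t] fin[OF js]
      by (simp add: mgf_map_affine pmf_Jpmf[OF assms])
  qed
  also have "\<dots> = exp (t * b n) * (\<Sum>js\<in>?C. (\<Prod>j\<leftarrow>js. real (tau m j) * mgf (addf_law m b x j) t)) / real (tau m n)"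
    by (simp add: sum_distrib_left sum_divide_distrib prod_list_mult_map mult_ac)
  finally show ?thesis using tau_pos[OF assms(1), of n] by simp
qed

section \<open>From moment generating functions to the central limit theorem\<close>

text \<open>Defined as a finite sum over the support, which makes it visibly entire; it is applied
  to laws of finite support only.\<close>

definition cmgf :: "real pmf \<Rightarrow> complex \<Rightarrow> complex" where
  "cmgf p z = (\<Sum>x\<in>set_pmf p. of_real (pmf p x) * exp (z * of_real x))"

lemma cmgf_of_real:
  assumes "finite (set_pmf p)"
  shows "cmgf p (of_real t) = of_real (measure_pmf.expectation p (\<lambda>x. exp (t * x)))"
  using assms
  by (subst integral_measure_pmf[of "set_pmf p"])
     (auto simp: cmgf_def exp_of_real[symmetric])

lemma cmgf_holomorphic: "cmgf p holomorphic_on A"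
  unfolding cmgf_def by (intro holomorphic_intros)

text \<open>On a vertical strip the transform is controlled by its values at the two real points
  \<open>R\<close> and \<open>- R\<close>. Convergence on the real axis therefore already gives the
  local boundedness that Montel's theorem asks for.\<close>

lemma norm_cmgf_le:
  assumes fin: "finite (set_pmf p)" and R: "\<bar>Re z\<bar> \<le> R"
  shows "norm (cmgf p z) \<le> norm (cmgf p (of_real R)) + norm (cmgf p (of_real (- R)))"
proof -
  have exp_le: "exp (Re z * x) \<le> exp (R * x) + exp (- R * x)" for x
  proof -
    have "\<bar>Re z * x\<bar> \<le> R * \<bar>x\<bar>" using R by (simp add: abs_mult mult_right_mono)
    then have "Re z * x \<le> R * x \<or> Re z * x \<le> - R * x" by (cases "x \<ge> 0") auto
    then show ?thesis
      by (smt (verit, best) exp_gt_zero exp_le_cancel_iff)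
  qed
  have pos: "measure_pmf.expectation p (\<lambda>x. exp (t * x)) \<ge> 0" for t
    by (rule integral_nonneg_AE) auto
  have E: "measure_pmf.expectation p (\<lambda>x. exp (t * x)) = (\<Sum>x\<in>set_pmf p. pmf p x * exp (t * x))" for t
    by (subst integral_measure_pmf[of "set_pmf p"]) (auto simp: fin)
  have "norm (cmgf p z) \<le> (\<Sum>x\<in>set_pmf p. norm (of_real (pmf p x) * exp (z * of_real x)))"
    unfolding cmgf_def by (rule norm_sum)
  also have "\<dots> = (\<Sum>x\<in>set_pmf p. pmf p x * exp (Re z * x))"
    by (simp add: norm_mult)
  also have "\<dots> \<le> (\<Sum>x\<in>set_pmf p. pmf p x * (exp (R * x) + exp (- R * x)))"
    by (intro sum_mono mult_left_mono exp_le) auto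
  also have "\<dots> = (\<Sum>x\<in>set_pmf p. pmf p x * exp (R * x)) + (\<Sum>x\<in>set_pmf p. pmf p x * exp (- R * x))"
    by (simp add: distrib_left sum.distrib)
  also have "\<dots> = norm (cmgf p (of_real R)) + norm (cmgf p (of_real (- R)))"
    unfolding cmgf_of_real[OF fin] norm_of_real E[symmetric] using pos by simp
  finally show ?thesis .
qed

text \<open>A Vitali argument: a subsequence staying away from \<open>g\<close> on \<open>K\<close>
  would have a locally uniformly convergent further subsequence. Its limit agrees with
  \<open>g\<close> on the real axis, hence everywhere by the identity theorem, a
  contradiction.\<close>

lemma mgf_conv_imp_uniform_cmgf:
  fixes p :: "nat \<Rightarrow> real pmf" and g :: "complex \<Rightarrow> complex"
  assumes fin: "\<And>n. finite (set_pmf (p n))"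
    and lim: "\<And>t::real. (\<lambda>n. cmgf (p n) (of_real t)) \<longlonglongrightarrow> g (of_real t)"
    and g: "g holomorphic_on UNIV" and K: "compact K"
  shows "uniform_limit K (\<lambda>n. cmgf (p n)) g sequentially"
proof (rule ccontr)
  assume "\<not> ?thesis"
  then obtain e where e: "e > 0" and "\<not> (\<forall>\<^sub>F n in sequentially. \<forall>x\<in>K. dist (cmgf (p n) x) (g x) < e)"
    unfolding uniform_limit_iff by blast
  then have "\<exists>\<^sub>F n in sequentially. \<not> (\<forall>x\<in>K. dist (cmgf (p n) x) (g x) < e)"
    by (simp add: frequently_def)
  then have "infinite {n. \<not> (\<forall>x\<in>K. dist (cmgf (p n) x) (g x) < e)}"
    by (simp add: cofinite_eq_sequentially[symmetric] frequently_cofinite)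
  from infinite_enumerate[OF this] obtain s :: "nat \<Rightarrow> nat" where s: "strict_mono s"
    and bad: "\<And>n. \<not> (\<forall>x\<in>K. dist (cmgf (p (s n)) x) (g x) < e)" by auto
  have bdd: "\<exists>B. \<forall>h \<in> range (\<lambda>n. cmgf (p (s n))). \<forall>z\<in>C. norm (h z) \<le> B" if "compact C" for C :: "complex set"
  proof -
    obtain R where R: "\<And>z. z \<in> C \<Longrightarrow> norm z \<le> R"
      using compact_imp_bounded[OF \<open>compact C\<close>] by (auto simp: bounded_iff)
    obtain B1 where B1: "\<And>n. norm (cmgf (p n) (of_real R)) \<le> B1"
      using convergent_imp_Bseq[OF convergentI[OF lim[of R]]] by (auto simp: Bseq_def)
    obtain B2 where B2: "\<And>n. norm (cmgf (p n) (of_real (- R))) \<le> B2"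
      using convergent_imp_Bseq[OF convergentI[OF lim[of "- R"]]] by (auto simp: Bseq_def)
    have "norm (cmgf (p n) z) \<le> B1 + B2" if "z \<in> C" for n z
    proof -
      have "\<bar>Re z\<bar> \<le> R" using R[OF that] abs_Re_le_cmod[of z] by linarith
      from norm_cmgf_le[OF fin this] show ?thesis using B1 B2 by (smt (verit, best))
    qed
    then show ?thesis by blast
  qed
  obtain G r where G: "G holomorphic_on UNIV" and r: "strict_mono (r :: nat \<Rightarrow> nat)"
    and ptw: "\<And>x. x \<in> UNIV \<Longrightarrow> ((\<lambda>n. cmgf (p (s (r n))) x) \<longlongrightarrow> G x) sequentially"
    and unif: "\<And>K. \<lbrakk>compact K; K \<subseteq> UNIV\<rbrakk> \<Longrightarrow> uniform_limit K ((\<lambda>n. cmgf (p (s n))) \<circ> r) G sequentially"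
  proof (rule Montel[where S = UNIV and \<F> = "\<lambda>n. cmgf (p (s n))" and \<H> = "range (\<lambda>n. cmgf (p (s n)))"])
    show "h holomorphic_on UNIV" if "h \<in> range (\<lambda>n. cmgf (p (s n)))" for h
      using that by (auto simp: cmgf_holomorphic)
    show "\<exists>B. \<forall>h\<in>range (\<lambda>n. cmgf (p (s n))). \<forall>z\<in>K. norm (h z) \<le> B" if "compact K" for K
      by (rule bdd[OF that])
  qed auto
  have real: "G (of_real t) = g (of_real t)" for t :: real
  proof (rule LIMSEQ_unique)
    show "(\<lambda>n. cmgf (p (s (r n))) (of_real t)) \<longlonglongrightarrow> G (of_real t)" by (rule ptw) simp
    show "(\<lambda>n. cmgf (p (s (r n))) (of_real t)) \<longlonglongrightarrow> g (of_real t)"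
      using LIMSEQ_subseq_LIMSEQ[OF LIMSEQ_subseq_LIMSEQ[OF lim s] r] by (simp add: comp_def)
  qed
  have "G z - g z = 0" for z
  proof (rule analytic_continuation[of "\<lambda>z. G z - g z" UNIV "range of_real" 0])
    show "(\<lambda>z. G z - g z) holomorphic_on UNIV" using G g by (intro holomorphic_intros)
    show "0 islimpt (range of_real :: complex set)"
      unfolding islimpt_approachable
    proof (intro allI impI)
      fix e :: real assume "e > 0"
      then show "\<exists>x'\<in>range complex_of_real. x' \<noteq> 0 \<and> dist x' 0 < e"
        by (intro bexI[of _ "of_real (e / 2)"]) (auto simp del: of_real_divide)
    qed
  qed (auto simp: real)
  then have "G = g" by auto
  with unif[OF K] have "\<forall>\<^sub>F n in sequentially. \<forall>x\<in>K. dist (cmgf (p (s (r n))) x) (g x) < e"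
    using e by (auto simp: uniform_limit_iff)
  with bad show False by (auto simp: eventually_sequentially)
qed

lemma char_distr_pmf:
  assumes "finite (set_pmf p)"
  shows "char (distr (measure_pmf p) borel (\<lambda>x. (x - a) / b)) t
       = exp (- (\<i> * of_real (t * a / b))) * cmgf p (\<i> * of_real (t / b))"
proof -
  have "char (distr (measure_pmf p) borel (\<lambda>x. (x - a) / b)) t
      = measure_pmf.expectation p (\<lambda>x. iexp (t * ((x - a) / b)))"
    unfolding char_def by (subst integral_distr) auto
  also have "\<dots> = (\<Sum>x\<in>set_pmf p. pmf p x *\<^sub>R iexp (t * ((x - a) / b)))"
    by (rule integral_measure_pmf) (use assms in auto)
  also have "\<dots> = (\<Sum>x\<in>set_pmf p. exp (- (\<i> * of_real (t * a / b))) *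
       (of_real (pmf p x) * exp (\<i> * of_real (t / b) * of_real x)))"
  proof (intro sum.cong refl)
    fix x
    have "\<i> * complex_of_real (t * ((x - a) / b)) =
        - (\<i> * of_real (t * a / b)) + \<i> * of_real (t / b) * of_real x"
      by (simp add: field_simps diff_divide_distrib)
    then show "pmf p x *\<^sub>R iexp (t * ((x - a) / b)) = exp (- (\<i> * of_real (t * a / b))) *
       (of_real (pmf p x) * exp (\<i> * of_real (t / b) * of_real x))"
      by (simp only: exp_add scaleR_conv_of_real mult_ac)
  qed
  finally show ?thesis by (simp add: cmgf_def sum_distrib_left)
qed

lemma char_normal_density:
  assumes "\<sigma> > 0"
  shows "char (density lborel (normal_density 0 \<sigma>)) t = of_real (exp (- (\<sigma> * t)\<^sup>2 / 2))"
proof -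
  interpret prob_space std_normal_distribution
    by (rule prob_space_normal_density) simp
  have "distributed std_normal_distribution lborel (\<lambda>x. x) (normal_density 0 1)"
    unfolding distributed_def by (auto simp: distr_id2)
  from normal_density_affine[OF this, of \<sigma> 0] assms
  have "distributed std_normal_distribution lborel (\<lambda>x. \<sigma> * x) (normal_density 0 \<sigma>)" by simp
  then have "density lborel (normal_density 0 \<sigma>) = distr std_normal_distribution lborel (\<lambda>x. \<sigma> * x)"
    by (simp add: distributed_def)
  also have "\<dots> = distr std_normal_distribution borel (\<lambda>x. \<sigma> * x)"
    by (intro distr_cong) auto
  also have "char \<dots> t = char std_normal_distribution (\<sigma> * t)"
    unfolding char_def by (subst integral_distr) (auto simp: ac_simps)
  finally show ?thesis by (simp add: char_std_normal_distribution)
qed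

lemma real_distribution_normal: "\<sigma> > 0 \<Longrightarrow> real_distribution (density lborel (normal_density 0 \<sigma>))"
  unfolding real_distribution_def real_distribution_axioms_def
  by (auto intro: prob_space_normal_density)

lemma real_distribution_distr_pmf: "real_distribution (distr (measure_pmf p) borel f)"
  unfolding real_distribution_def real_distribution_axioms_def
  by (auto intro!: measure_pmf.prob_space_distr)

text \<open>The first claim is Levy continuity on the imaginary axis. For the second, convergence of
  derivatives at 0 gives mean tending to 0 and standard deviation tending to
  \<open>\<sigma>\<close>; the characteristic function of the standardised law is then the transform
  at a moving point, where local uniformity is essential.\<close>

lemma clt_from_mgf:
  fixes p :: "nat \<Rightarrow> real pmf"
  assumes fin: "\<And>n. finite (set_pmf (p n))" and \<sigma>: "\<sigma> > 0"
    and lim: "\<And>t. (\<lambda>n. measure_pmf.expectation (p n) (\<lambda>x. exp (t * x))) \<longlonglongrightarrow> exp (\<sigma>\<^sup>2 * t\<^sup>2 / 2)"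
  shows "weak_conv_m (\<lambda>n. distr (measure_pmf (p n)) borel (\<lambda>x. x)) (density lborel (normal_density 0 \<sigma>))"
    and "weak_conv_m (\<lambda>n. distr (measure_pmf (p n)) borel
            (\<lambda>x. (x - measure_pmf.expectation (p n) (\<lambda>y. y)) / sqrt (measure_pmf.variance (p n) (\<lambda>y. y))))
           std_normal_distribution"
proof -
  define g :: "complex \<Rightarrow> complex" where "g z = exp (of_real (\<sigma>\<^sup>2 / 2) * z\<^sup>2)" for z
  have g: "g holomorphic_on UNIV" unfolding g_def by (intro holomorphic_intros)
  have glim: "(\<lambda>n. cmgf (p n) (of_real t)) \<longlonglongrightarrow> g (of_real t)" for t
  proof -
    have "g (of_real t) = of_real (exp (\<sigma>\<^sup>2 * t\<^sup>2 / 2))"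
      by (simp add: g_def exp_of_real[symmetric])
    then show ?thesis using tendsto_of_real[OF lim[of t], where ?'a = complex]
      by (simp only: cmgf_of_real[OF fin])
  qed
  note unif = mgf_conv_imp_uniform_cmgf[OF fin glim g]
  have gi: "g (\<i> * of_real t) = of_real (exp (- (\<sigma> * t)\<^sup>2 / 2))" for t
    by (simp add: g_def exp_of_real[symmetric] power_mult_distrib)
  have ptw: "(\<lambda>n. cmgf (p n) z) \<longlonglongrightarrow> g z" for z
    using tendsto_uniform_limitI[OF unif[of "{z}"]] by simp
  show "weak_conv_m (\<lambda>n. distr (measure_pmf (p n)) borel (\<lambda>x. x)) (density lborel (normal_density 0 \<sigma>))"
  proof (rule levy_continuity)
    fix t
    have "char (distr (measure_pmf (p n)) borel (\<lambda>x. x)) t = cmgf (p n) (\<i> * of_real t)" for n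
      using char_distr_pmf[OF fin, of n 0 1 t] by simp
    then show "(\<lambda>n. char (distr (measure_pmf (p n)) borel (\<lambda>x. x)) t)
        \<longlonglongrightarrow> char (density lborel (normal_density 0 \<sigma>)) t"
      using ptw[of "\<i> * of_real t"] by (simp add: char_normal_density[OF \<sigma>] gi)
  qed (auto intro: real_distribution_normal[OF \<sigma>] real_distribution_distr_pmf)
  define E where "E n = measure_pmf.expectation (p n) (\<lambda>y. y)" for n
  define E2 where "E2 n = measure_pmf.expectation (p n) (\<lambda>y. y\<^sup>2)" for n
  define S where "S n = sqrt (measure_pmf.variance (p n) (\<lambda>y. y))" for n
  \<comment> \<open>\<open>f1\<close> and \<open>f2\<close> are the first two derivatives of the
    transform; at 0 they are the first two moments.\<close>
  define f1 where "f1 n z = (\<Sum>x\<in>set_pmf (p n). of_real (pmf (p n) x * x) * exp (z * of_real x))" for n and z :: complex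
  define f2 where "f2 n z = (\<Sum>x\<in>set_pmf (p n). of_real (pmf (p n) x * x\<^sup>2) * exp (z * of_real x))" for n and z :: complex
  have D1: "(cmgf (p n) has_field_derivative f1 n z) (at z)" for n z
    unfolding cmgf_def f1_def by (auto intro!: derivative_eq_intros sum.cong)
  have D2: "(f1 n has_field_derivative f2 n z) (at z)" for n z
    unfolding f1_def f2_def by (auto intro!: derivative_eq_intros sum.cong simp: power2_eq_square)
  have g': "(g has_field_derivative of_real (\<sigma>\<^sup>2) * z * g z) (at z)" for z
    unfolding g_def by (auto intro!: derivative_eq_intros)
  have g'': "((\<lambda>z. of_real (\<sigma>\<^sup>2) * z * g z) has_field_derivative of_real (\<sigma>\<^sup>2) * g z + (of_real (\<sigma>\<^sup>2) * z)\<^sup>2 * g z) (at z)" for z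
    by (auto intro!: derivative_eq_intros g' simp: power2_eq_square algebra_simps)
  have unif1: "uniform_limit (ball 0 1) (\<lambda>n. cmgf (p n)) g sequentially"
    by (rule uniform_limit_on_subset[OF unif[OF compact_cball]]) (rule ball_subset_cball)
  have conv: "(\<lambda>n. (deriv ^^ k) (cmgf (p n)) 0) \<longlonglongrightarrow> (deriv ^^ k) g 0" for k
    by (rule higher_deriv_complex_uniform_limit[OF unif1]) (auto simp: cmgf_holomorphic)
  have d1: "deriv (cmgf (p n)) = f1 n" "deriv (f1 n) = f2 n" for n
    using DERIV_imp_deriv[OF D1] DERIV_imp_deriv[OF D2] by auto
  have d2: "deriv g = (\<lambda>z. of_real (\<sigma>\<^sup>2) * z * g z)"
    "deriv (\<lambda>z. of_real (\<sigma>\<^sup>2) * z * g z) = (\<lambda>z. of_real (\<sigma>\<^sup>2) * g z + (of_real (\<sigma>\<^sup>2) * z)\<^sup>2 * g z)"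
    using DERIV_imp_deriv[OF g'] DERIV_imp_deriv[OF g''] by auto
  have conv1: "(\<lambda>n. f1 n 0) \<longlonglongrightarrow> 0"
    using conv[of 1] by (simp add: d1 d2)
  have conv2: "(\<lambda>n. f2 n 0) \<longlonglongrightarrow> of_real (\<sigma>\<^sup>2)"
    using conv[of "Suc (Suc 0)"] unfolding funpow.simps comp_def id_apply d1 d2 by (simp add: g_def)
  have f0: "f1 n 0 = of_real (E n)" "f2 n 0 = of_real (E2 n)" for n
  proof -
    have "E n = (\<Sum>x\<in>set_pmf (p n). pmf (p n) x *\<^sub>R x)"
      unfolding E_def by (rule integral_measure_pmf) (auto simp: fin)
    moreover have "E2 n = (\<Sum>x\<in>set_pmf (p n). pmf (p n) x *\<^sub>R x\<^sup>2)"
      unfolding E2_def by (rule integral_measure_pmf) (auto simp: fin)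
    ultimately show "f1 n 0 = of_real (E n)" "f2 n 0 = of_real (E2 n)"
      by (simp_all add: f1_def f2_def)
  qed
  have "(\<lambda>n. complex_of_real (E n)) \<longlonglongrightarrow> of_real 0" using conv1 by (simp add: f0)
  then have lims: "E \<longlonglongrightarrow> 0" "E2 \<longlonglongrightarrow> \<sigma>\<^sup>2"
    using conv2 by (simp_all only: tendsto_of_real_iff f0)
  have "measure_pmf.variance (p n) (\<lambda>y. y) = E2 n - (E n)\<^sup>2" for n
    unfolding E_def E2_def by (rule measure_pmf.variance_eq) (auto intro!: integrable_measure_pmf_finite fin)
  then have "S = (\<lambda>n. sqrt (E2 n - (E n)\<^sup>2))" by (auto simp: S_def)
  moreover have "(\<lambda>n. sqrt (E2 n - (E n)\<^sup>2)) \<longlonglongrightarrow> sqrt (\<sigma>\<^sup>2 - 0\<^sup>2)"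
    by (intro tendsto_intros lims)
  ultimately have S: "S \<longlonglongrightarrow> \<sigma>" using \<sigma> by simp
  have "weak_conv_m (\<lambda>n. distr (measure_pmf (p n)) borel (\<lambda>x. (x - E n) / S n)) std_normal_distribution"
  proof (rule levy_continuity)
    fix t
    have arg: "(\<lambda>n. \<i> * complex_of_real (t / S n)) \<longlonglongrightarrow> \<i> * complex_of_real (t / \<sigma>)"
      using \<sigma> by (intro tendsto_intros S) auto
    \<comment> \<open>All evaluation points lie in one disc, on which the convergence is
      uniform.\<close>
    obtain R where R: "\<And>n. norm (\<i> * complex_of_real (t / S n)) \<le> R"
      using convergent_imp_Bseq[OF convergentI[OF arg]] unfolding Bseq_def by blast
    have "(\<lambda>n. g (\<i> * of_real (t / S n))) \<longlonglongrightarrow> g (\<i> * of_real (t / \<sigma>))"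
      unfolding g_def by (intro tendsto_intros arg)
    moreover have "(\<lambda>n. cmgf (p n) (\<i> * of_real (t / S n)) - g (\<i> * of_real (t / S n))) \<longlonglongrightarrow> 0"
    proof (rule tendstoI)
      fix e :: real assume "e > 0"
      with unif[of "cball 0 R"]
      have "\<forall>\<^sub>F n in sequentially. \<forall>x\<in>cball 0 R. dist (cmgf (p n) x) (g x) < e"
        by (simp add: uniform_limit_iff)
      then show "\<forall>\<^sub>F n in sequentially.
          dist (cmgf (p n) (\<i> * of_real (t / S n)) - g (\<i> * of_real (t / S n))) 0 < e"
        by eventually_elim (use R in \<open>auto simp: dist_norm simp del: of_real_divide\<close>)
    qed
    ultimately have "(\<lambda>n. cmgf (p n) (\<i> * of_real (t / S n))) \<longlonglongrightarrow> g (\<i> * of_real (t / \<sigma>))"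
      by (rule Lim_transform)
    then have "(\<lambda>n. exp (- (\<i> * of_real (t * E n / S n))) * cmgf (p n) (\<i> * of_real (t / S n)))
        \<longlonglongrightarrow> exp (- (\<i> * of_real (t * 0 / \<sigma>))) * g (\<i> * of_real (t / \<sigma>))"
      using \<sigma> by (intro tendsto_intros S lims) auto
    then show "(\<lambda>n. char (distr (measure_pmf (p n)) borel (\<lambda>x. (x - E n) / S n)) t)
        \<longlonglongrightarrow> char std_normal_distribution t"
      using \<sigma> unfolding gi by (simp add: char_distr_pmf[OF fin] char_std_normal_distribution)
  qed (auto intro: real_distribution_normal[of 1, simplified] real_distribution_distr_pmf)
  then show "weak_conv_m (\<lambda>n. distr (measure_pmf (p n)) borel
            (\<lambda>x. (x - measure_pmf.expectation (p n) (\<lambda>y. y)) / sqrt (measure_pmf.variance (p n) (\<lambda>y. y))))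
           std_normal_distribution" unfolding E_def S_def .
qed

section \<open>Space requirement of search trees\<close>

text \<open>The value of z + ... + z^d at the dominant singularity \<open>rho (Suc d)\<close> of the
  tree series. Its \<open>d\<close>-th power is the reciprocal of the growth rate of the
  Fuss--Catalan numbers.\<close>

definition crit :: "nat \<Rightarrow> real" where
  "crit d = real d / real (Suc d) powr (real (Suc d) / real d)"

lemma crit_pos: "d \<ge> 1 \<Longrightarrow> crit d > 0"
  by (simp add: crit_def)

lemma crit_less:
  assumes "d \<ge> 1" shows "crit d < real d"
proof -
  have "1 < real (Suc d) powr (real (Suc d) / real d)"
    using assms by (intro gr_one_powr) auto
  then show ?thesis using assms by (simp add: crit_def divide_less_eq)
qed

lemma crit_power: 
  assumes "d \<ge> 1" shows "crit d ^ d = real d ^ d / real (Suc d) ^ Suc d"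
proof -
  have "(real (Suc d) powr (real (Suc d) / real d)) ^ d = real (Suc d) powr (real (Suc d) / real d * real d)"
    by (subst powr_powr[symmetric], subst powr_realpow) (simp_all del: of_nat_Suc)
  also have "\<dots> = real (Suc d) powr real (Suc d)" using assms by simp
  also have "\<dots> = real (Suc d) ^ Suc d" by (rule powr_realpow) simp
  finally show ?thesis by (simp add: crit_def power_divide del: of_nat_Suc power_Suc)
qed

text \<open>Every real power of the arity occurring in the constants becomes rational in
  \<open>crit d\<close>, which reduces later identities to field arithmetic.\<close>

lemma powr_crit:
  assumes "d \<ge> 1"
  shows "real (Suc d) powr (real (Suc d) / real d) = real d / crit d"
    and "real (Suc d) powr (1 / real d) = real d / (crit d * real (Suc d))"
    and "real (Suc d) powr (- 1 / real d) = crit d * real (Suc d) / real d"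
    and "real (Suc d) powr (- real (Suc d) / real d) = crit d / real d"
proof -
  let ?P = "real (Suc d) powr (real (Suc d) / real d)"
  show 1: "?P = real d / crit d" using assms by (simp add: crit_def)
  have "real (Suc d) / real d = 1 + 1 / real d" using assms by (simp add: field_simps)
  then have "?P = real (Suc d) * real (Suc d) powr (1 / real d)" by (simp add: powr_add)
  then show 2: "real (Suc d) powr (1 / real d) = real d / (crit d * real (Suc d))"
    unfolding 1 using crit_pos[OF assms] by (simp add: field_simps del: of_nat_Suc)
  have "real (Suc d) powr (- 1 / real d) = 1 / real (Suc d) powr (1 / real d)"
    by (simp add: powr_minus_divide)
  then show "real (Suc d) powr (- 1 / real d) = crit d * real (Suc d) / real d" unfolding 2 by simp
  have "real (Suc d) powr (- real (Suc d) / real d) = 1 / ?P"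
    by (simp only: minus_divide_left[symmetric] powr_minus_divide)
  then show "real (Suc d) powr (- real (Suc d) / real d) = crit d / real d" unfolding 1 by simp
qed

text \<open>Taking \<open>d\<close>-th roots turns the defining equation into
  \<open>S r = crit d\<close>. As \<open>S\<close> increases strictly from 0 to
  \<open>d > crit d\<close> on the unit interval, the solution exists and is unique, so the
  description operator in \<open>rho\<close> is justified.\<close>

lemma rho_props:
  assumes d: "d \<ge> 1"
  shows "0 < rho (Suc d)" "rho (Suc d) < 1" "(\<Sum>j=1..d. rho (Suc d) ^ j) = crit d"
proof -
  define S where "S r = (\<Sum>j=1..d. r ^ j)" for r :: real
  let ?P = "\<lambda>r. 0 < r \<and> r < 1 \<and> real (Suc d) ^ Suc d * S r ^ d = real d ^ d"
  have Smono: "S r < S r'" if "0 \<le> r" "r < r'" for r r'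
    unfolding S_def using that d by (intro sum_strict_mono power_strict_mono) auto
  have S01: "S 0 = 0" "S 1 = real d" by (auto simp: S_def power_0_left)
  have "\<exists>r\<ge>0. r \<le> 1 \<and> S r = crit d"
  proof (rule IVT')
    show "S 0 \<le> crit d" "crit d \<le> S 1" using crit_pos[OF d] crit_less[OF d] by (simp_all add: S01)
    show "continuous_on {0..1} S" unfolding S_def by (intro continuous_intros)
  qed simp
  then obtain r where r: "0 \<le> r" "r \<le> 1" "S r = crit d" by blast
  have eq: "real (Suc d) ^ Suc d * S r ^ d = real d ^ d \<longleftrightarrow> S r = crit d" if "0 < r" for r
  proof -
    have "real (Suc d) ^ Suc d * S r ^ d = real d ^ d \<longleftrightarrow> S r ^ d = crit d ^ d"
      unfolding crit_power[OF d] by (auto simp: field_simps simp del: of_nat_Suc power_Suc)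
    also have "\<dots> \<longleftrightarrow> S r = crit d"
    proof (rule power_eq_iff_eq_base)
      show "0 \<le> S r" using that by (auto simp: S_def intro!: sum_nonneg)
    qed (use d crit_pos[OF d] in auto)
    finally show ?thesis .
  qed
  have "r \<noteq> 0" "r \<noteq> 1" using r S01 crit_pos[OF d] crit_less[OF d] by auto
  then have r': "0 < r" "r < 1" using r by auto
  have "rho (Suc d) = (THE r. ?P r)" by (simp add: rho_def S_def del: of_nat_Suc power_Suc)
  also have "(THE r. ?P r) = r"
  proof (rule the_equality)
    show "?P r" using r r' eq[OF r'(1)] by blast
    fix r2 assume "?P r2"
    then have "S r2 = S r" "0 < r2" using eq[of r2] r by auto
    then show "r2 = r" using Smono[of r r2] Smono[of r2 r] r' by (cases r r2 rule: linorder_cases) auto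
  qed
  finally have "rho (Suc d) = r" .
  then show "0 < rho (Suc d)" "rho (Suc d) < 1" "(\<Sum>j=1..d. rho (Suc d) ^ j) = crit d"
    using r r' by (simp_all add: S_def)
qed

section \<open>Mean and variance of a single step\<close>

lemma sum_arith_geom:
  fixes r :: real
  shows "(\<Sum>j=1..d. real j * r ^ j) * (1 - r)\<^sup>2 = r - real (Suc d) * r ^ Suc d + real d * r ^ (d + 2)"
  by (induction d) (simp_all add: algebra_simps power2_eq_square)

lemma sum_geom:
  fixes r :: real
  shows "(\<Sum>j=1..d. r ^ j) * (1 - r) = r - r ^ Suc d"
proof (induction d)
  case (Suc d)
  then show ?case by (simp add: distrib_right) (simp add: algebra_simps)
qed simp

text \<open>A step of length $j$ stands for a leaf holding $j - 1$ keys.\<close>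
definition leaf_law :: "nat \<Rightarrow> real fps" where
  "leaf_law d = Abs_fps (\<lambda>j. if 1 \<le> j \<and> j \<le> d then rho (Suc d) ^ j / crit d else 0)"

text \<open>An internal node is shared equally among $d$ leaves, since $k$ internal nodes come
  with $dk + 1$ leaves; whence the summand $1/d$.\<close>
definition score :: "nat \<Rightarrow> nat \<Rightarrow> real" where
  "score d j = 1 / real d + (if j \<ge> 2 then 1 else 0) - real j * d1 (Suc d)"

lemma prob_leaf_law: "d \<ge> 1 \<Longrightarrow> prob_fps d (leaf_law d)"
  using rho_props[of d] crit_pos[of d]
  by (auto simp: prob_fps_def leaf_law_def sum_divide_distrib[symmetric])

lemma mean_leaf_law:
  assumes d: "d \<ge> 1"
  shows "fps_mean d (leaf_law d) = alpha_star (Suc d)"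
proof -
  let ?\<rho> = "rho (Suc d)" and ?\<gamma> = "crit d"
  have \<rho>: "0 < ?\<rho>" "?\<rho> < 1" and \<gamma>: "?\<gamma> > 0" using rho_props[OF d] crit_pos[OF d] by auto
  define M where "M = (\<Sum>j=1..d. real j * ?\<rho> ^ j)"
  \<comment> \<open>The geometric sum eliminates the high power of \<open>?\<rho>\<close>, leaving
    an expression in \<open>?\<rho>\<close> and \<open>?\<gamma>\<close> alone.\<close>
  have pw: "?\<rho> ^ Suc d = ?\<rho> - ?\<gamma> * (1 - ?\<rho>)"
    using sum_geom[of ?\<rho> d] rho_props(3)[OF d] by simp
  have "M * (1 - ?\<rho>)\<^sup>2 = ?\<rho> - real (Suc d) * ?\<rho> ^ Suc d + real d * (?\<rho> * ?\<rho> ^ Suc d)"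
    unfolding M_def sum_arith_geom by simp
  also have "\<dots> = (1 - ?\<rho>) * (?\<gamma> * (real (Suc d) - real d * ?\<rho>) - real d * ?\<rho>)"
    unfolding pw by (simp add: algebra_simps)
  finally have "(1 - ?\<rho>) * (M * (1 - ?\<rho>)) = (1 - ?\<rho>) * (?\<gamma> * (real (Suc d) - real d * ?\<rho>) - real d * ?\<rho>)"
    by (simp add: power2_eq_square mult_ac)
  then have M: "M * (1 - ?\<rho>) = ?\<gamma> * (real (Suc d) - real d * ?\<rho>) - real d * ?\<rho>"
    using \<rho> by simp
  have "fps_mean d (leaf_law d) = M / ?\<gamma>"
    by (simp add: fps_mean_def leaf_law_def M_def sum_divide_distrib)
  also have "M / ?\<gamma> = real (Suc d) - (real d / ?\<gamma> - 1) / (1 / ?\<rho> - 1)"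
  proof -
    have "1 / ?\<rho> - 1 = (1 - ?\<rho>) / ?\<rho>" using \<rho> by (simp add: field_simps)
    moreover have "M = (?\<gamma> * (real (Suc d) - real d * ?\<rho>) - real d * ?\<rho>) / (1 - ?\<rho>)"
      using M \<rho> by (simp add: field_simps)
    ultimately show ?thesis using \<rho> \<gamma> by (simp add: divide_simps) (simp add: algebra_simps)
  qed
  also have "\<dots> = alpha_star (Suc d)" using powr_crit(1)[OF d] by (simp add: alpha_star_def)
  finally show ?thesis .
qed

text \<open>\<open>d1\<close> is the centring that makes this hold: a step is at least 2 with
  probability \<open>1 - ?\<rho> / ?\<gamma>\<close>, and \<open>d1\<close> times the mean step
  equals \<open>1 / d\<close> plus this probability.\<close>

lemma score_mean:
  assumes d: "d \<ge> 2"
  shows "(\<Sum>j=1..d. fps_nth (leaf_law d) j * score d j) = 0"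
proof -
  let ?\<rho> = "rho (Suc d)" and ?\<gamma> = "crit d" and ?\<alpha> = "alpha_star (Suc d)"
  have d1': "d \<ge> 1" using d by simp
  have \<gamma>: "?\<gamma> > 0" using crit_pos[OF d1'] .
  have \<alpha>: "?\<alpha> \<ge> 1" using fps_mean_ge_1[OF prob_leaf_law[OF d1']] mean_leaf_law[OF d1'] by simp
  have tot: "(\<Sum>j=1..d. fps_nth (leaf_law d) j) = 1" using prob_leaf_law[OF d1'] by (simp add: prob_fps_def)
  have "(\<Sum>j=1..d. fps_nth (leaf_law d) j * score d j) =
     (\<Sum>j=1..d. fps_nth (leaf_law d) j) * (1 / real d) + (\<Sum>j=1..d. fps_nth (leaf_law d) j * (if j \<ge> 2 then 1 else 0))
      - fps_mean d (leaf_law d) * d1 (Suc d)"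
    by (simp add: score_def fps_mean_def sum_distrib_right sum_distrib_left sum.distrib sum_subtractf algebra_simps)
  also have "(\<Sum>j=1..d. fps_nth (leaf_law d) j * (if j \<ge> 2 then 1 else 0)) = 1 - fps_nth (leaf_law d) 1"
  proof -
    have "(\<Sum>j=1..d. fps_nth (leaf_law d) j * (if j \<ge> 2 then 1 else 0)) = (\<Sum>j=2..d. fps_nth (leaf_law d) j)"
      by (intro sum.mono_neutral_cong_right) auto
    moreover have "(\<Sum>j=1..d. fps_nth (leaf_law d) j) = fps_nth (leaf_law d) 1 + (\<Sum>j=2..d. fps_nth (leaf_law d) j)"
      using d by (subst sum.atLeast_Suc_atMost) (auto simp: numeral_2_eq_2)
    ultimately show ?thesis using tot by simp
  qed
  also have "fps_nth (leaf_law d) 1 = ?\<rho> / ?\<gamma>" using d by (simp add: leaf_law_def)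
  also have "fps_mean d (leaf_law d) * d1 (Suc d) = 1 / real d + (1 - ?\<rho> / ?\<gamma>)"
  proof -
    have "fps_mean d (leaf_law d) * d1 (Suc d) = real (Suc d) * (1 - ?\<rho> * (real d / (?\<gamma> * real (Suc d)))) / real d"
      unfolding mean_leaf_law[OF d1'] d1_def using \<alpha> powr_crit(2)[OF d1'] by (simp del: of_nat_Suc)
    also have "\<dots> = real (Suc d) / real d - ?\<rho> / ?\<gamma>"
      using d \<gamma> by (simp add: divide_simps del: of_nat_Suc)
    also have "real (Suc d) / real d = 1 / real d + 1" using d by (simp add: field_simps)
    finally show ?thesis by simp
  qed
  finally show ?thesis unfolding tot by simp
qed

text \<open>\<open>delta1\<close> is, up to the factor \<open>?\<rho> / ?\<gamma>\<close>, the
  second moment of the score without its share \<open>1 / d\<close> of an internal node. Since the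
  score is centred, restoring that share lowers the second moment by its square, which is the term
  subtracted from \<open>delta1\<close> in \<open>B2\<close>.\<close>

lemma score_variance:
  assumes d: "d \<ge> 2"
  shows "(\<Sum>j=1..d. fps_nth (leaf_law d) j * (score d j)\<^sup>2) = sigma2 (Suc d) * alpha_star (Suc d)"
proof -
  let ?\<rho> = "rho (Suc d)" and ?\<gamma> = "crit d" and ?\<alpha> = "alpha_star (Suc d)"
  have d1': "d \<ge> 1" using d by simp
  have \<gamma>: "?\<gamma> > 0" and \<rho>: "?\<rho> > 0" using crit_pos[OF d1'] rho_props[OF d1'] by auto
  have \<alpha>: "?\<alpha> \<ge> 1" using fps_mean_ge_1[OF prob_leaf_law[OF d1']] mean_leaf_law[OF d1'] by simp
  have tot: "(\<Sum>j=1..d. fps_nth (leaf_law d) j) = 1" using prob_leaf_law[OF d1'] by (simp add: prob_fps_def)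
  have a0: "a0 (Suc d) = ?\<gamma> * real (Suc d) / (real d * ?\<rho>)"
    using powr_crit(3)[OF d1'] by (simp add: a0_def)
  have a1: "a1 (Suc d) = - sqrt (2 * real (Suc d) * ?\<alpha>) * ?\<gamma> / (real d * ?\<rho>)"
    using powr_crit(4)[OF d1'] by (simp add: a1_def)
  have a1sq: "a1 (Suc d) * a1 (Suc d) = 2 * real (Suc d) * ?\<alpha> * ?\<gamma>\<^sup>2 / (real d * ?\<rho>)\<^sup>2"
    using \<alpha> by (simp add: a1 power2_eq_square)
  have "sigma2 (Suc d) = 2 * (a0 (Suc d) / real d * (delta1 (Suc d) - a0 (Suc d) / (real (Suc d) * real d))) / (a1 (Suc d) * a1 (Suc d))"
    by (simp add: sigma2_def B2_def)
  also have "\<dots> * ?\<alpha> = ?\<rho> * delta1 (Suc d) / ?\<gamma> - 1 / (real d)\<^sup>2"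
    unfolding a1sq a0 using \<alpha> \<gamma> \<rho> d
    by (simp add: field_simps power2_eq_square del: of_nat_Suc)
  finally have s: "sigma2 (Suc d) * ?\<alpha> = ?\<rho> * delta1 (Suc d) / ?\<gamma> - 1 / (real d)\<^sup>2" .
  define z where "z j = score d j - 1 / real d" for j
  have "?\<rho> * delta1 (Suc d) / ?\<gamma> = (\<Sum>j=1..d. fps_nth (leaf_law d) j * (z j)\<^sup>2)"
  proof -
    have "(\<Sum>j=1..d. fps_nth (leaf_law d) j * (z j)\<^sup>2) = (\<Sum>j=1..d. ?\<rho> ^ j * (z j)\<^sup>2) / ?\<gamma>"
      by (simp add: leaf_law_def sum_divide_distrib)
    also have "(\<Sum>j=1..d. ?\<rho> ^ j * (z j)\<^sup>2) = ?\<rho> * (z 1)\<^sup>2 + (\<Sum>j=Suc 1..Suc (d - 1). ?\<rho> ^ j * (z j)\<^sup>2)"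
      using d by (subst sum.atLeast_Suc_atMost) auto
    also have "(\<Sum>j=Suc 1..Suc (d - 1). ?\<rho> ^ j * (z j)\<^sup>2) = (\<Sum>j=1..d - 1. ?\<rho> ^ Suc j * (z (Suc j))\<^sup>2)"
      by (rule sum.shift_bounds_cl_Suc_ivl)
    also have "\<dots> = ?\<rho> * (\<Sum>j=1..d - 1. (1 - real (j + 1) * d1 (Suc d))\<^sup>2 * ?\<rho> ^ j)"
      unfolding sum_distrib_left by (intro sum.cong refl) (auto simp: z_def score_def)
    also have "?\<rho> * (z 1)\<^sup>2 + \<dots> = ?\<rho> * delta1 (Suc d)"
      by (simp add: delta1_def z_def score_def algebra_simps numeral_2_eq_2)
    finally show ?thesis by simp
  qed
  also have "\<dots> = (\<Sum>j=1..d. fps_nth (leaf_law d) j * (score d j)\<^sup>2)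
     - 2 / real d * (\<Sum>j=1..d. fps_nth (leaf_law d) j * score d j) + (\<Sum>j=1..d. fps_nth (leaf_law d) j) * (1 / (real d)\<^sup>2)"
    by (simp add: z_def power2_diff sum_distrib_left sum_distrib_right sum.distrib sum_subtractf algebra_simps power_divide)
      (simp add: sum_divide_distrib)
  finally show ?thesis using s unfolding score_mean[OF d] tot by simp
qed

text \<open>A vanishing variance would force the scores at 1 and at 2 to vanish. Then
  \<open>d1 = 1 / d\<close> and \<open>2 * d1 = 1 / d + 1\<close>, so \<open>1 / d = 1\<close>,
  against \<open>d \<ge> 2\<close>.\<close>

lemma sigma2_pos:
  assumes d: "d \<ge> 2"
  shows "sigma2 (Suc d) > 0"
proof -
  have d1': "d \<ge> 1" using d by simp
  have \<alpha>: "alpha_star (Suc d) \<ge> 1" using fps_mean_ge_1[OF prob_leaf_law[OF d1']] mean_leaf_law[OF d1'] by simp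
  have pos: "fps_nth (leaf_law d) j > 0" if "1 \<le> j" "j \<le> d" for j
    using that crit_pos[OF d1'] rho_props(1)[OF d1'] by (simp add: leaf_law_def)
  have "score d 1 \<noteq> 0 \<or> score d 2 \<noteq> 0"
  proof (rule ccontr)
    assume "\<not> ?thesis"
    then have "1 / real d = 1" by (simp add: score_def)
    then show False using d by simp
  qed
  then have "\<exists>i\<in>{1..d}. score d i \<noteq> 0"
  proof
    show "score d 1 \<noteq> 0 \<Longrightarrow> ?thesis" by (intro bexI[of _ 1]) (use d in auto)
    show "score d 2 \<noteq> 0 \<Longrightarrow> ?thesis" by (intro bexI[of _ 2]) (use d in auto)
  qed
  then obtain i where i: "i \<in> {1..d}" "score d i \<noteq> 0" by blast
  have "0 < (\<Sum>j=1..d. fps_nth (leaf_law d) j * (score d j)\<^sup>2)"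
  proof (rule sum_pos2[of _ i])
    show "0 < fps_nth (leaf_law d) i * (score d i)\<^sup>2" using i pos[of i] by simp
    show "0 \<le> fps_nth (leaf_law d) j * (score d j)\<^sup>2" if "j \<in> {1..d}" for j
      using pos[of j] that by simp
  qed (use i in auto)
  then have "sigma2 (Suc d) * alpha_star (Suc d) > 0" unfolding score_variance[OF d] .
  then show ?thesis using \<alpha> by (simp add: zero_less_mult_iff)
qed

text \<open>The quadratic term replaces the exact singularity of the tilted step weights by its
  second-order expansion.\<close>
definition tilted_law :: "nat \<Rightarrow> real \<Rightarrow> real fps" where
  "tilted_law d t = Abs_fps (\<lambda>j. fps_nth (leaf_law d) j * exp (t * score d j - real j * sigma2 (Suc d) / 2 * t\<^sup>2))"

section \<open>Exact formula and limit of the moment generating function\<close>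

lemma fps_geometric_scale_power:
  fixes A G :: "real fps"
  assumes "\<And>j. fps_nth A j = c * r ^ j * fps_nth G j"
  shows "fps_nth (A ^ N) n = c ^ N * r ^ n * fps_nth (G ^ N) n"
proof (induction N arbitrary: n)
  case (Suc N)
  have "fps_nth (A ^ Suc N) n = (\<Sum>i=0..n. (c * r ^ i * fps_nth G i) * (c ^ N * r ^ (n - i) * fps_nth (G ^ N) (n - i)))"
    by (simp add: fps_mult_nth assms Suc)
  also have "\<dots> = (\<Sum>i=0..n. c ^ Suc N * r ^ n * (fps_nth G i * fps_nth (G ^ N) (n - i)))"
  proof (intro sum.cong refl)
    fix i assume "i \<in> {0..n}"
    then have "r ^ n = r ^ i * r ^ (n - i)" by (simp add: power_add[symmetric])
    then show "(c * r ^ i * fps_nth G i) * (c ^ N * r ^ (n - i) * fps_nth (G ^ N) (n - i)) =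
      c ^ Suc N * r ^ n * (fps_nth G i * fps_nth (G ^ N) (n - i))" by simp
  qed
  finally show ?case by (simp add: fps_mult_nth sum_distrib_left)
qed simp

definition renewal_sum :: "nat \<Rightarrow> nat \<Rightarrow> real \<Rightarrow> real" where
  "renewal_sum d n t = (\<Sum>k\<le>n. fuss_wt d k * fps_nth (tilted_law d t ^ (d * k + 1)) (n + 1))"

lemma mgf_space_law:
  assumes d: "d \<ge> 2"
  shows "real (tau (Suc d) n) * mgf (space_law (Suc d) n) t =
     crit d / rho (Suc d) ^ (n + 1) *
     exp (real (n + 1) * (d1 (Suc d) * t + sigma2 (Suc d) / 2 * t\<^sup>2) - t / real d) * renewal_sum d n t"
proof -
  let ?\<rho> = "rho (Suc d)" and ?\<gamma> = "crit d" and ?m = "Suc d"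
  define u where "u = exp t"
  define G where "G = fps_X * leaf_fps d u"
  have d1': "d \<ge> 1" using d by simp
  have \<gamma>: "?\<gamma> > 0" and \<rho>: "?\<rho> > 0" using crit_pos[OF d1'] rho_props[OF d1'] by auto
  have m2: "?m \<ge> 2" using d by simp
  define f where "f n = real (tau ?m n) * mgf (space_law ?m n) t" for n
  have f: "f n = (\<Sum>k\<le>n. real (fuss ?m k 1) * u ^ k * fps_nth (G ^ (d * k + 1)) (n + 1))"
    unfolding G_def
  proof (rule tree_gf_coeff[OF d1'])
    fix n assume "n < d"
    then have "n \<le> ?m - 2" by simp
    then show "f n = (if n = 0 then 1 else u)"
      by (simp add: f_def tau_small space_law_def addf_law_small u_def)
  next
    fix n assume "n \<ge> d"
    then have "n \<ge> ?m - 1" by simp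
    from tau_mgf_addf_law_rec[OF m2 this]
    show "f n = u * (\<Sum>js\<in>comps ?m (n - d). \<Prod>j\<leftarrow>js. f j)"
      by (simp add: f_def space_law_def u_def)
  qed
  define r where "r = ?\<rho> * exp (- d1 ?m * t - sigma2 ?m / 2 * t\<^sup>2)"
  \<comment> \<open>Spreads the mark \<open>u\<close> of an internal node over \<open>d\<close>
    leaves: c^(dk) supplies \<open>u ^ k\<close> and cancels the scaling inside
    \<open>fuss_wt\<close>. The one surplus leaf leaves the factor
    \<open>?\<gamma> * exp (- t / real d)\<close>.\<close>
  define c where "c = exp (t / real d) / ?\<gamma>"
  have G: "fps_nth G j = (if j = 1 then 1 else if 2 \<le> j \<and> j \<le> d then u else 0)" for j
    using d by (auto simp: G_def fps_X_mult_nth leaf_fps_def)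
  have W: "fps_nth (tilted_law d t) j = c * r ^ j * fps_nth G j" for j
  proof (cases "1 \<le> j \<and> j \<le> d")
    case True
    have "exp (t * score d j - real j * sigma2 ?m / 2 * t\<^sup>2) =
       exp (t / real d) * exp (- d1 ?m * t - sigma2 ?m / 2 * t\<^sup>2) ^ j * (if j \<ge> 2 then u else 1)"
      unfolding u_def exp_of_nat_mult[symmetric] score_def
      by (simp add: exp_add[symmetric] algebra_simps)
    then show ?thesis using True
      by (auto simp: tilted_law_def leaf_law_def G c_def r_def power_mult_distrib)
  next
    case False
    then show ?thesis using d by (auto simp: tilted_law_def leaf_law_def G)
  qed
  have rpos: "r > 0" using \<rho> by (simp add: r_def)
  have "real (fuss ?m k 1) * u ^ k * fps_nth (G ^ (d * k + 1)) (n + 1) =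
      ?\<gamma> * exp (- t / real d) / r ^ (n + 1) * (fuss_wt d k * fps_nth (tilted_law d t ^ (d * k + 1)) (n + 1))" for k
  proof -
    have cp: "c ^ (d * k + 1) = exp (t / real d) * u ^ k / (?\<gamma> * (?\<gamma> ^ d) ^ k)"
    proof -
      have "exp (t / real d) ^ (d * k) = u ^ k"
        using d by (simp add: u_def exp_of_nat_mult[symmetric])
      then show ?thesis by (simp add: c_def power_divide power_mult)
    qed
    have "fuss_wt d k * fps_nth (tilted_law d t ^ (d * k + 1)) (n + 1)
       = real (fuss ?m k 1) * (?\<gamma> ^ d) ^ k * (c ^ (d * k + 1) * r ^ (n + 1) * fps_nth (G ^ (d * k + 1)) (n + 1))"
      unfolding fps_geometric_scale_power[OF W] fuss_wt_def crit_power[OF d1'] by simp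
    also have "\<dots> = r ^ (n + 1) * exp (t / real d) / ?\<gamma> * (real (fuss ?m k 1) * u ^ k * fps_nth (G ^ (d * k + 1)) (n + 1))"
      unfolding cp using \<gamma> by (simp add: field_simps del: power_Suc fuss.simps)
    finally show ?thesis using rpos \<gamma> by (simp add: exp_minus field_simps del: power_Suc fuss.simps)
  qed
  then have "f n = ?\<gamma> * exp (- t / real d) / r ^ (n + 1) * renewal_sum d n t"
    unfolding f renewal_sum_def sum_distrib_left by simp
  also have "?\<gamma> * exp (- t / real d) / r ^ (n + 1) = ?\<gamma> / ?\<rho> ^ (n + 1) *
     exp (real (n + 1) * (d1 ?m * t + sigma2 ?m / 2 * t\<^sup>2) - t / real d)"
  proof -
    define x where "x = real (n + 1) * (d1 ?m * t + sigma2 ?m / 2 * t\<^sup>2)"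
    have rn: "r ^ (n + 1) = ?\<rho> ^ (n + 1) * exp (- x)"
      unfolding r_def x_def power_mult_distrib exp_of_nat_mult[symmetric] by (simp add: algebra_simps)
    define y where "y = exp (- t / real d)"
    have xy: "exp (x - t / real d) = exp x * y" by (simp add: y_def exp_add[symmetric])
    show ?thesis unfolding x_def[symmetric] y_def[symmetric] rn xy
      by (simp add: exp_minus divide_inverse mult_ac del: power_Suc)
  qed
  finally show ?thesis by (simp add: f_def)
qed

text \<open>The linear term, of order n^(1/2) after multiplication, must be removed here; it cancels
  only in the sum over steps, by centring of the score.\<close>

lemma exp_second_order_limit:
  fixes a b :: real
  shows "(\<lambda>n. real (n + 1) * (exp (a / sqrt (real n) - b / real n) - 1 - a / sqrt (real n))) \<longlonglongrightarrow> a\<^sup>2 / 2 - b"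
  unfolding power2_eq_square by real_asymp

text \<open>Numerator and denominator, each divided by the same weight at \<open>\<kappa> n\<close>,
  converge to the same positive limit. The mass condition holds because the second-order terms sum
  to variance minus \<open>sigma2\<close> times mean step, which is 0.\<close>

lemma renewal_sum_ratio:
  assumes d: "d \<ge> 2"
  shows "(\<lambda>n. renewal_sum d n (t / sqrt (real n)) / renewal_sum d n 0) \<longlonglongrightarrow> 1"
proof -
  let ?\<alpha> = "alpha_star (Suc d)" and ?s = "sigma2 (Suc d)" and ?p = "leaf_law d"
  define \<kappa> where "\<kappa> n = nat \<lfloor>real (n + 1) / (real d * fps_mean d ?p)\<rfloor>" for n
  have d1': "d \<ge> 1" using d by simp
  have p: "prob_fps d ?p" by (rule prob_leaf_law[OF d1'])
  have tot: "(\<Sum>j=1..d. fps_nth ?p j) = 1" using p by (simp add: prob_fps_def)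
  have pos: "fps_nth ?p j > 0" if "1 \<le> j" "j \<le> d" for j
    using that crit_pos[OF d1'] rho_props(1)[OF d1'] by (simp add: leaf_law_def)
  have main: "(\<lambda>n. renewal_sum d n (t / sqrt (real n)) / fuss_wt d (\<kappa> n)) \<longlonglongrightarrow> 1 / (real d * ?\<alpha>)" for t
  proof -
    have "(\<lambda>n. \<Sum>k\<le>n. fuss_wt d k / fuss_wt d (\<kappa> n) *
            fps_nth (tilted_law d (t / sqrt (real n)) ^ (d * k + 1)) (n + 1)) \<longlonglongrightarrow> 1 / (real d * fps_mean d ?p)"
      unfolding \<kappa>_def
    proof (rule weighted_renewal_limit[OF d])
      show "fps_nth (tilted_law d (t / sqrt (real n))) j \<ge> 0" for n j
        using p by (simp add: tilted_law_def prob_fps_def)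
      show "fps_nth (tilted_law d (t / sqrt (real n))) 0 = 0" for n
        by (simp add: tilted_law_def leaf_law_def)
      show "fps_nth (tilted_law d (t / sqrt (real n))) j = 0" if "j > d" for n j
        using that by (simp add: tilted_law_def leaf_law_def)
      show "(\<lambda>n. fps_nth (tilted_law d (t / sqrt (real n))) j) \<longlonglongrightarrow> fps_nth ?p j" for j
      proof -
        have t0: "(\<lambda>n. t / sqrt (real n)) \<longlonglongrightarrow> 0" by real_asymp
        have "(\<lambda>n. fps_nth ?p j * exp (t / sqrt (real n) * score d j - real j * ?s / 2 * (t / sqrt (real n))\<^sup>2))
           \<longlonglongrightarrow> fps_nth ?p j * exp (0 * score d j - real j * ?s / 2 * 0\<^sup>2)"
          by (intro tendsto_intros t0)
        then show ?thesis by (simp add: tilted_law_def)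
      qed
      show "prob_fps d ?p" by (rule p)
      show "fps_nth ?p 1 > 0" "fps_nth ?p 2 > 0" using d by (auto intro!: pos)
      show "fuss_wt d k > 0" for k by (rule fuss_wt_pos[OF d1'])
      show "2 * real d > 0" using d by simp
      show "\<bar>ln (fuss_wt d b) - ln (fuss_wt d a)\<bar> \<le> 2 * real d * (real b - real a) / real a"
        if "1 \<le> a" "a \<le> b" for a b by (rule fuss_wt_ln_diff[OF d1' that])
      define Y where "Y n j = real (n + 1) * (exp (t * score d j / sqrt (real n) - (real j * ?s / 2 * t\<^sup>2) / real n) - 1
          - t * score d j / sqrt (real n))" for n j
      have "(\<lambda>n. \<Sum>j=1..d. fps_nth ?p j * Y n j) \<longlonglongrightarrow>
         (\<Sum>j=1..d. fps_nth ?p j * ((t * score d j)\<^sup>2 / 2 - real j * ?s / 2 * t\<^sup>2))"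
        unfolding Y_def by (intro tendsto_sum tendsto_mult tendsto_const exp_second_order_limit)
      also have "(\<Sum>j=1..d. fps_nth ?p j * ((t * score d j)\<^sup>2 / 2 - real j * ?s / 2 * t\<^sup>2)) =
          t\<^sup>2 / 2 * ((\<Sum>j=1..d. fps_nth ?p j * (score d j)\<^sup>2) - ?s * fps_mean d ?p)"
        by (simp add: fps_mean_def sum_distrib_left sum_subtractf right_diff_distrib power_mult_distrib algebra_simps)
      also have "\<dots> = 0" unfolding score_variance[OF d] mean_leaf_law[OF d1'] by simp
      finally have lim0: "(\<lambda>n. \<Sum>j=1..d. fps_nth ?p j * Y n j) \<longlonglongrightarrow> 0" .
      have "(\<Sum>j=1..d. fps_nth ?p j * Y n j) =
         real (n + 1) * ((\<Sum>j=1..d. fps_nth (tilted_law d (t / sqrt (real n))) j) - 1)" for n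
      proof -
        have "(\<Sum>j=1..d. fps_nth ?p j * Y n j) = (\<Sum>j=1..d. real (n + 1) * (fps_nth (tilted_law d (t / sqrt (real n))) j
           - fps_nth ?p j - t / sqrt (real n) * (fps_nth ?p j * score d j)))"
          by (intro sum.cong refl) (simp add: Y_def tilted_law_def power_divide algebra_simps)
        also have "\<dots> = real (n + 1) * ((\<Sum>j=1..d. fps_nth (tilted_law d (t / sqrt (real n))) j)
           - (\<Sum>j=1..d. fps_nth ?p j) - t / sqrt (real n) * (\<Sum>j=1..d. fps_nth ?p j * score d j))"
          by (simp only: sum_distrib_left[symmetric] sum_subtractf)
        also have "\<dots> = real (n + 1) * ((\<Sum>j=1..d. fps_nth (tilted_law d (t / sqrt (real n))) j) - 1)"
          unfolding score_mean[OF d] tot by simp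
        finally show ?thesis .
      qed
      with lim0 show "(\<lambda>n. real (n + 1) * ((\<Sum>j=1..d. fps_nth (tilted_law d (t / sqrt (real n))) j) - 1)) \<longlonglongrightarrow> 0"
        by simp
    qed
    then show ?thesis unfolding mean_leaf_law[OF d1'] renewal_sum_def sum_divide_distrib by simp
  qed
  have \<alpha>: "?\<alpha> \<ge> 1" using fps_mean_ge_1[OF p] mean_leaf_law[OF d1'] by simp
  have main0: "(\<lambda>n. renewal_sum d n 0 / fuss_wt d (\<kappa> n)) \<longlonglongrightarrow> 1 / (real d * ?\<alpha>)"
    using main[of 0] by simp
  have "(\<lambda>n. (renewal_sum d n (t / sqrt (real n)) / fuss_wt d (\<kappa> n)) / (renewal_sum d n 0 / fuss_wt d (\<kappa> n)))
     \<longlonglongrightarrow> (1 / (real d * ?\<alpha>)) / (1 / (real d * ?\<alpha>))"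
    using \<alpha> d by (intro tendsto_divide main main0) auto
  moreover have "(renewal_sum d n (t / sqrt (real n)) / fuss_wt d (\<kappa> n)) / (renewal_sum d n 0 / fuss_wt d (\<kappa> n))
     = renewal_sum d n (t / sqrt (real n)) / renewal_sum d n 0" for n
    using fuss_wt_pos[OF d1', of "\<kappa> n"] by simp
  moreover have "(1 / (real d * ?\<alpha>)) / (1 / (real d * ?\<alpha>)) = 1" using \<alpha> d by simp
  ultimately show ?thesis by (simp only:)
qed

text \<open>Dividing the exact formula at the tilted argument by its instance at 0, where the
  transform is 1, removes the tree number and the powers of \<open>rho\<close>. The linear term in
  \<open>d1\<close> cancels the centring.\<close>

lemma mgf_space_law_limit:
  assumes d: "d \<ge> 2"
  shows "(\<lambda>n. mgf (map_pmf (\<lambda>x. (x - d1 (Suc d) * (real n + 1)) / sqrt (real n)) (space_law (Suc d) n)) t)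
     \<longlonglongrightarrow> exp (sigma2 (Suc d) * t\<^sup>2 / 2)"
proof -
  let ?s = "sigma2 (Suc d)" and ?D = "d1 (Suc d)"
  have eq: "mgf (map_pmf (\<lambda>x. (x - ?D * (real n + 1)) / sqrt (real n)) (space_law (Suc d) n)) t =
     exp (real (n + 1) * (?s / 2 * (t / sqrt (real n))\<^sup>2) - t / sqrt (real n) / real d) *
       (renewal_sum d n (t / sqrt (real n)) / renewal_sum d n 0)" for n
  proof -
    define v where "v = t / sqrt (real n)"
    have "mgf (map_pmf (\<lambda>x. (x - ?D * (real n + 1)) / sqrt (real n)) (space_law (Suc d) n)) t
       = measure_pmf.expectation (space_law (Suc d) n) (\<lambda>x. exp (- (v * (?D * real (n + 1)))) * exp (v * x))"
      by (simp add: mgf_def v_def exp_add[symmetric] diff_divide_distrib add_divide_distrib algebra_simps)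
    also have "\<dots> = exp (- (v * (?D * real (n + 1)))) * mgf (space_law (Suc d) n) v"
      by (simp add: mgf_def)
    finally have 1: "mgf (map_pmf (\<lambda>x. (x - ?D * (real n + 1)) / sqrt (real n)) (space_law (Suc d) n)) t =
       exp (- (v * (?D * real (n + 1)))) * mgf (space_law (Suc d) n) v" .
    define B where "B = crit d / rho (Suc d) ^ (n + 1)"
    have T: "real (tau (Suc d) n) > 0" using tau_pos[of "Suc d" n] d by simp
    have "mgf (space_law (Suc d) n) 0 = 1" by (simp add: mgf_def)
    then have T0: "real (tau (Suc d) n) = B * renewal_sum d n 0"
      using mgf_space_law[OF d, of n 0] by (simp add: B_def)
    then have "B \<noteq> 0" "renewal_sum d n 0 \<noteq> 0" using T by auto
    moreover have "B * renewal_sum d n 0 * mgf (space_law (Suc d) n) v =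
      B * exp (real (n + 1) * (?D * v + ?s / 2 * v\<^sup>2) - v / real d) * renewal_sum d n v"
      using mgf_space_law[OF d, of n v] by (simp add: B_def T0[unfolded B_def])
    ultimately have "mgf (space_law (Suc d) n) v =
       exp (real (n + 1) * (?D * v + ?s / 2 * v\<^sup>2) - v / real d) * (renewal_sum d n v / renewal_sum d n 0)"
      by (simp add: field_simps)
    moreover have "exp (- (v * (?D * real (n + 1)))) * exp (real (n + 1) * (?D * v + ?s / 2 * v\<^sup>2) - v / real d)
       = exp (real (n + 1) * (?s / 2 * v\<^sup>2) - v / real d)"
      by (simp add: exp_add[symmetric] algebra_simps)
    ultimately show ?thesis unfolding 1 v_def[symmetric] by (simp only: mult.assoc[symmetric])
  qed
  have "(\<lambda>n. real (n + 1) * (s / 2 * (t / sqrt (real n))\<^sup>2) - t / sqrt (real n) * e) \<longlonglongrightarrow> s * t\<^sup>2 / 2" for s e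
    unfolding power2_eq_square by real_asymp
  from this[of ?s "1 / real d"]
  have "(\<lambda>n. real (n + 1) * (?s / 2 * (t / sqrt (real n))\<^sup>2) - t / sqrt (real n) / real d) \<longlonglongrightarrow> ?s * t\<^sup>2 / 2"
    by (simp only: times_divide_eq_right mult_1_right)
  then have "(\<lambda>n. exp (real (n + 1) * (?s / 2 * (t / sqrt (real n))\<^sup>2) - t / sqrt (real n) / real d) *
       (renewal_sum d n (t / sqrt (real n)) / renewal_sum d n 0)) \<longlonglongrightarrow> exp (?s * t\<^sup>2 / 2) * 1"
    by (intro tendsto_mult tendsto_exp renewal_sum_ratio[OF d])
  then show ?thesis unfolding eq by simp
qed

lemma distr_map_pmf_borel:
  fixes f g :: "real \<Rightarrow> real"
  shows "distr (measure_pmf (map_pmf f p)) borel g = distr (measure_pmf p) borel (\<lambda>x. g (f x))"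
  by (simp add: map_pmf_rep_eq distr_distr comp_def)

text \<open>Needed because the rescaling by \<open>sqrt (real n)\<close> degenerates at
  \<open>n = 0\<close>.\<close>

lemma weak_conv_m_cong_eventually:
  assumes "weak_conv_m M L" "\<forall>\<^sub>F n in sequentially. M n = N n"
  shows "weak_conv_m N L"
  unfolding weak_conv_m_def weak_conv_def
proof (intro allI impI)
  fix x assume "isCont (cdf L) x"
  then have "(\<lambda>n. cdf (M n) x) \<longlonglongrightarrow> cdf L x"
    using assms(1) by (simp add: weak_conv_m_def weak_conv_def)
  moreover have "\<forall>\<^sub>F n in sequentially. cdf (M n) x = cdf (N n) x"
    using assms(2) by eventually_elim simp
  ultimately show "(\<lambda>n. cdf (N n) x) \<longlonglongrightarrow> cdf L x" by (rule Lim_transform_eventually)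
qed

theorem theorem6p1:
  fixes m :: nat
  assumes "m \<ge> 3"
  shows "(weak_conv_m
           (\<lambda>n. distr (measure_pmf (space_law m n)) borel
                    (\<lambda>x. (x - d1 m * (real n + 1)) / sqrt (real n)))
           (density lborel (normal_density 0 (sqrt (sigma2 m))))) \<and>
         (weak_conv_m
           (\<lambda>n. distr (measure_pmf (space_law m n)) borel
                    (\<lambda>x. (x - measure_pmf.expectation (space_law m n) (\<lambda>y. y))
                         / sqrt (measure_pmf.variance (space_law m n) (\<lambda>y. y))))
           std_normal_distribution)"
proof -
  obtain d where m: "m = Suc d" and d: "d \<ge> 2" using assms by (cases m) auto
  define f where "f n x = (x - d1 m * (real n + 1)) / sqrt (real n)" for n x
  define q where "q n = map_pmf (f n) (space_law m n)" for n
  have finS: "finite (set_pmf (space_law m n))" for n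
    unfolding space_law_def using assms by (intro addf_law_finite) auto
  then have fin: "finite (set_pmf (q n))" for n by (simp add: q_def)
  have s: "sigma2 m > 0" unfolding m by (rule sigma2_pos[OF d])
  have lim: "(\<lambda>n. measure_pmf.expectation (q n) (\<lambda>x. exp (t * x))) \<longlonglongrightarrow> exp ((sqrt (sigma2 m))\<^sup>2 * t\<^sup>2 / 2)" for t
    using mgf_space_law_limit[OF d, of t] s by (simp add: q_def f_def[abs_def] mgf_def m)
  have spos: "sqrt (sigma2 m) > 0" using s by simp
  note clt = clt_from_mgf[OF fin spos lim]
  have 1: "weak_conv_m (\<lambda>n. distr (measure_pmf (space_law m n)) borel (\<lambda>x. (x - d1 m * (real n + 1)) / sqrt (real n)))
           (density lborel (normal_density 0 (sqrt (sigma2 m))))"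
    using clt(1) by (simp add: q_def distr_map_pmf_borel f_def)
  \<comment> \<open>Standardisation is invariant under increasing affine maps, so centring by
    \<open>d1\<close> and scaling by \<open>sqrt (real n)\<close> leave no trace.\<close>
  have norm_eq: "distr (measure_pmf (q n)) borel (\<lambda>x. (x - measure_pmf.expectation (q n) (\<lambda>y. y)) / sqrt (measure_pmf.variance (q n) (\<lambda>y. y)))
     = distr (measure_pmf (space_law m n)) borel
                    (\<lambda>x. (x - measure_pmf.expectation (space_law m n) (\<lambda>y. y))
                         / sqrt (measure_pmf.variance (space_law m n) (\<lambda>y. y)))" if n: "n \<ge> 1" for n
  proof -
    let ?p = "space_law m n"
    define E where "E = measure_pmf.expectation ?p (\<lambda>y. y)"
    define V where "V = measure_pmf.expectation ?p (\<lambda>y. (y - E)\<^sup>2)"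
    have int: "integrable (measure_pmf ?p) g" for g :: "real \<Rightarrow> real"
      by (rule integrable_measure_pmf_finite[OF finS])
    have Eq: "measure_pmf.expectation (q n) (\<lambda>y. y) = f n E"
      by (simp add: q_def f_def E_def int)
    have ff: "f n x - f n E = (x - E) / sqrt (real n)" for x
      by (simp add: f_def diff_divide_distrib)
    have "measure_pmf.variance (q n) (\<lambda>y. y) = measure_pmf.expectation ?p (\<lambda>x. (f n x - f n E)\<^sup>2)"
      unfolding Eq by (simp add: q_def)
    also have "\<dots> = V / real n" by (simp add: ff power_divide V_def)
    finally have "(f n x - measure_pmf.expectation (q n) (\<lambda>y. y)) / sqrt (measure_pmf.variance (q n) (\<lambda>y. y)) = (x - E) / sqrt V" for x
      using n by (simp add: Eq ff real_sqrt_divide)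
    then show ?thesis unfolding E_def[symmetric] V_def[symmetric]
      by (subst q_def) (simp add: distr_map_pmf_borel)
  qed
  have "weak_conv_m
           (\<lambda>n. distr (measure_pmf (space_law m n)) borel
                    (\<lambda>x. (x - measure_pmf.expectation (space_law m n) (\<lambda>y. y))
                         / sqrt (measure_pmf.variance (space_law m n) (\<lambda>y. y))))
           std_normal_distribution"
  proof (rule weak_conv_m_cong_eventually[OF clt(2)], goal_cases)
    case 1
    show ?case using eventually_ge_at_top[of 1] by eventually_elim (rule norm_eq)
  qed
  with 1 show ?thesis by blast
qed

end
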